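(* Let $k$ be an even positive integer and let $f\in S_k$ be a cuspidal Hecke eigenform. Define the coefficients $q^f_{r,s}\in\mathbb{C}$ ($r+s=k$, $r,s\ge 1$) by $$P^{ev,0}_f(X+Y,X)=\sum_{\substack{r+s=k\\ r,s\ge 1}}\binom{k-2}{r-1}\,q^f_{r,s}\,X^{r-1}Y^{s-1}$$ and set $$\lambda_f=\frac{k-1}{2}\left(\sum_{\substack{r+s=k\\ r,s\ge 3\text{ odd}}}\frac{(-1)^{\frac{s-1}{2}}}{r\,2^{r-1}}\binom{k-2}{s-1}L_f^*(s)-L_f^*(1)\right).$$ Then $$\sum_{\substack{r+s=k\\ r,s\ge2}}q^f_{r,s}\,\hat\zeta(r,s)=\lambda_f\,\zeta(k).$$
   Context: $S_k$ denotes the space of cusp forms of weight $k$ for $\mathrm{SL}_2(\mathbb{Z})$, with $q=e^{2\pi i\tau}$. For $f=\sum_{n\ge1}a_nq^n\in S_k$, the completed $L$-function is $L_f^*(s)=\int_0^\infty f(iy)y^{s-1}\,dy=(2\pi)^{-s}\Gamma(s)\sum_{n\ge1}a_nn^{-s}$ (the second equality for $\Re(s)\gg0$). The even restricted period polynomial of $f$ is $$P^{ev,0}_f(X,Y)=\sum_{\substack{r+s=k\\ r,s\ge3\text{ odd}}}(-1)^{\frac{s-1}{2}}\binom{k-2}{s-1}L_f^*(s)X^{r-1}Y^{s-1}.$$ The modified double zeta values are $\hat\zeta(r,s)=\sum_{0<m<n}\frac{1}{(m+n)^rn^s}$ for $r\ge1$, $s\ge2$, and $\zeta$ is the Riemann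 zeta function. *)

theory Defs
  imports "HOL-Complex_Analysis.Complex_Analysis"
begin

definition upper_half_plane :: "complex set" where
  "upper_half_plane = {\<tau>. Im \<tau> > 0}"

text \<open>
  The space \<open>S\<^sub>k\<close> for \<open>SL\<^sub>2(\<int>)\<close>. Elements are functions on all of \<open>\<complex>\<close>, of which only the
  values on the upper half-plane matter. The last conjunct is the cusp condition: a \<open>q\<close>-expansion
  without constant term.
\<close>
definition cusp_forms :: "nat \<Rightarrow> (complex \<Rightarrow> complex) set" where
  "cusp_forms k = {f.
     f holomorphic_on upper_half_plane \<and>
     (\<forall>a b c d :: int. a * d - b * c = 1 \<longrightarrow>
        (\<forall>\<tau>\<in>upper_half_plane.
           f ((of_int a * \<tau> + of_int b) / (of_int c * \<tau> + of_int d))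
             = (of_int c * \<tau> + of_int d) ^ k * f \<tau>)) \<and>
     (\<exists>a :: nat \<Rightarrow> complex. a 0 = 0 \<and>
        (\<forall>\<tau>\<in>upper_half_plane. (\<lambda>n. a n * exp (2 * of_real pi * \<i> * \<tau>) ^ n) sums f \<tau>))}"

text \<open>
  \<open>(T\<^sub>n f)(\<tau>) = n\<^bsup>k-1\<^esup> \<Sum> d\<^bsup>-k\<^esup> f((a\<tau> + b)/d)\<close>, the sum being over \<open>a d = n\<close> and \<open>0 \<le> b < d\<close>.
\<close>
definition hecke_operator :: "nat \<Rightarrow> nat \<Rightarrow> (complex \<Rightarrow> complex) \<Rightarrow> complex \<Rightarrow> complex" where
  "hecke_operator k n f \<tau> =
     of_nat n ^ (k - 1) *
     (\<Sum>d | d dvd n. \<Sum>b<d. f ((of_nat (n div d) * \<tau> + of_nat b) / of_nat d) / of_nat d ^ k)"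

text \<open>Eigenforms are nonzero, but not assumed to be normalised by \<open>a\<^sub>1 = 1\<close>.\<close>
definition cuspidal_hecke_eigenform :: "nat \<Rightarrow> (complex \<Rightarrow> complex) \<Rightarrow> bool" where
  "cuspidal_hecke_eigenform k f \<longleftrightarrow>
     f \<in> cusp_forms k \<and>
     (\<exists>\<tau>\<in>upper_half_plane. f \<tau> \<noteq> 0) \<and>
     (\<forall>n\<ge>1. \<exists>c. \<forall>\<tau>\<in>upper_half_plane. hecke_operator k n f \<tau> = c * f \<tau>)"

definition completed_L :: "(complex \<Rightarrow> complex) \<Rightarrow> complex \<Rightarrow> complex" where
  "completed_L f s = (LINT y:{0<..}|lborel. f (\<i> * of_real y) * of_real y powr (s - 1))"

definition odd_pairs :: "nat \<Rightarrow> (nat \<times> nat) set" where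
  "odd_pairs k = {(r, s). r + s = k \<and> r \<ge> 3 \<and> s \<ge> 3 \<and> odd r \<and> odd s}"

text \<open>
  The even restricted period polynomial, as a polynomial function on \<open>\<complex>\<^sup>2\<close>; since \<open>\<complex>\<close> is infinite,
  an identity of such functions is the same as an identity of polynomials.
\<close>
definition even_restricted_period_poly ::
    "nat \<Rightarrow> (complex \<Rightarrow> complex) \<Rightarrow> complex \<Rightarrow> complex \<Rightarrow> complex" where
  "even_restricted_period_poly k f X Y =
     (\<Sum>(r, s)\<in>odd_pairs k.
        (-1) ^ ((s - 1) div 2) * of_nat ((k - 2) choose (s - 1)) * completed_L f (of_nat s)
          * X ^ (r - 1) * Y ^ (s - 1))"

text \<open>The series converges absolutely for \<open>r \<ge> 1\<close>, \<open>s \<ge> 2\<close>.\<close>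
definition zeta_hat :: "nat \<Rightarrow> nat \<Rightarrow> real" where
  "zeta_hat r s =
     (\<Sum>\<^sub>\<infinity>(m, n)\<in>{(m, n). 0 < m \<and> m < n}. 1 / (real (m + n) ^ r * real n ^ s))"

text \<open>The Riemann zeta function at integers \<open>k \<ge> 2\<close>, the only arguments needed.\<close>
definition zeta_nat :: "nat \<Rightarrow> real" where
  "zeta_nat k = (\<Sum>n. 1 / real (Suc n) ^ k)"

definition lambda_coeff :: "nat \<Rightarrow> (complex \<Rightarrow> complex) \<Rightarrow> complex" where
  "lambda_coeff k f =
     of_nat (k - 1) / 2 *
     ((\<Sum>(r, s)\<in>odd_pairs k.
         (-1) ^ ((s - 1) div 2) / (of_nat r * 2 ^ (r - 1)) * of_nat ((k - 2) choose (s - 1))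
           * completed_L f (of_nat s))
      - completed_L f 1)"

end

theory Submission
  imports Defs
begin

text \<open>
  Let \<open>K = k - 2\<close>. The Eichler--Shimura relations for \<open>L\<^sub>f\<^sup>*\<close>, after a
  Laplace transform in both variables, say that \<open>H(a, b) = \<Sum> q\<^bsub>r,s\<^esub> a\<^bsup>-r\<^esup> b\<^bsup>-s\<^esup>\<close> satisfies
  \<open>H(m + n, n) - H(m + n, m) = H(m, n) - H(n, m)\<close> for all nonzero \<open>m\<close>, \<open>n\<close>, \<open>m + n\<close>, and that the part of
  \<open>H\<close> with even exponents is symmetric. Summing this identity over \<open>0 < m < n\<close>, and over \<open>n > m > 0\<close> after
  a change of sign, expresses \<open>\<Sum> q\<^bsub>r,s\<^esub> \<zeta>^(r, s)\<close> through \<open>\<zeta>(k)\<close> and \<open>E = \<Sum> q\<^bsub>r,s\<^esub> \<zeta>(r) \<zeta>(s)\<close> over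
  even \<open>r\<close>, \<open>s\<close>.

  That \<open>E\<close> is a multiple of \<open>\<zeta>(k)\<close> is the relation of Kohnen and Zagier that singles out the cusp forms
  among the even period polynomials. With \<open>J(g) = \<integral> f g dz\<close> from \<open>0\<close> to \<open>\<i>\<infinity>\<close>, one has
  \<open>J(g) = J(g|T) + J(g|TST)\<close> for all holomorphic \<open>g\<close> of moderate growth, not only for polynomials. For the
  Eichler integral \<open>\<psi>\<close> of the Eisenstein series, \<open>\<psi>|T = \<psi>\<close> gives \<open>J(\<psi>|ST) = 0\<close>, and likewise for
  \<open>T\<^sup>-\<^sup>1\<close>; hence \<open>J(p|T) = J(p|T\<^sup>-\<^sup>1)\<close> for the period function \<open>p = \<psi> - \<psi>|S\<close>, which Ramanujan's formula gives in
  terms of \<open>\<zeta>(r) \<zeta>(s)\<close>.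
\<close>

section \<open>Sequences satisfying the even period relations\<close>

text \<open>Both parts of \<open>lambda_coeff\<close> have a visible origin. The powers of 2 come
  from the diagonal \<open>m = n\<close>, where \<open>(m + n, n) = (2 n, n)\<close>: it contributes
  \<open>H 2 1\<close> times \<zeta>(k). The term \<open>completed_L f 1\<close> comes from the
  restriction of the period polynomial. The full sequence of even periods would lead to the
  divergent \<zeta>(1). Deleting the indices 0 and \<open>K\<close> subtracts a multiple of the
  coboundary \<open>1 - z ^ K\<close>, which satisfies the same period relations, and makes the
  first and last coefficient \<open>q\<close> vanish. The Kohnen-Zagier relation, however, holds for
  the full sequence; the correction is \<open>completed_L f 1\<close> times a sum of products of
  even zeta values, which Euler's formula evaluates.

  That relation also needs periods of non-polynomial functions, such as \<open>1 / z\<close> and the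
  Eichler integral. Periods are therefore defined for every function of moderate growth, through
  antiderivatives that vanish at the cusp at infinity.\<close>

lemma coeff_linear_power_binomial:
  fixes a b :: "'a::comm_ring_1"
  shows "coeff ([:a, b:] ^ n) i = of_nat (n choose i) * b ^ i * a ^ (n - i)"
proof (cases "i \<le> n")
  case False
  have "degree ([:a, b:] ^ n) \<le> degree [:a, b:] * n" by (rule degree_power_le)
  also have "\<dots> \<le> n" by simp
  finally show ?thesis using False by (simp add: coeff_eq_0 binomial_eq_0)
qed (rule coeff_linear_poly_power)

text \<open>Expand \<open>(1 - 1 / 2) ^ Suc n\<close> and separate the constant term. This evaluates
  the inner sum in \<open>H_2_1\<close>.\<close>

lemma alternating_half_sum:
  "(\<Sum>j\<le>n. of_nat (Suc n choose Suc j) * (- 1) ^ j * (1 / 2) ^ Suc j)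
    = 1 - (1 / 2 :: complex) ^ Suc n"
proof -
  have "(1 - 1 / 2 :: complex) ^ Suc n
     = (\<Sum>i\<le>Suc n. of_nat (Suc n choose i) * (- (1 / 2)) ^ i)"
    using binomial_ring[of "- (1 / 2) :: complex" 1 "Suc n"] by simp
  also have "\<dots> = 1 + (\<Sum>j\<le>n. of_nat (Suc n choose Suc j) * (- (1 / 2)) ^ Suc j)"
    by (subst sum.atMost_Suc_shift) simp
  also have "(\<Sum>j\<le>n. of_nat (Suc n choose Suc j) * (- (1 / 2) :: complex) ^ Suc j)
     = - (\<Sum>j\<le>n. of_nat (Suc n choose Suc j) * (- 1) ^ j * (1 / 2) ^ Suc j)"
    unfolding sum_negf[symmetric]
  proof (intro sum.cong refl)
    fix j
    have "(- (1 / 2) :: complex) ^ Suc j = - ((- 1) ^ j * (1 / 2) ^ Suc j)"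
      by (subst power_minus) simp
    then show "of_nat (Suc n choose Suc j) * (- (1 / 2) :: complex) ^ Suc j
        = - (of_nat (Suc n choose Suc j) * (- 1) ^ j * (1 / 2) ^ Suc j)"
      by (simp only: mult_minus_right mult.assoc)
  qed
  finally have *: "(1 - 1 / 2 :: complex) ^ Suc n
     = 1 + - (\<Sum>j\<le>n. of_nat (Suc n choose Suc j) * (- 1) ^ j * (1 / 2) ^ Suc j)" .
  have "(1 - 1 / 2 :: complex) = 1 / 2" by simp
  with * have **: "(1 / 2 :: complex) ^ Suc n
     = 1 + - (\<Sum>j\<le>n. of_nat (Suc n choose Suc j) * (- 1) ^ j * (1 / 2) ^ Suc j)"
    by (simp only:)
  have "s = 1 - x" if "x = 1 + - s" for s x :: complex
    using that by simp
  from this[OF **] show ?thesis .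
qed

lemma smult_sum_right: "smult a (\<Sum>i\<in>A. p i) = (\<Sum>i\<in>A. smult a (p i))"
  by (induction A rule: infinite_finite_induct) (auto simp: smult_add_right)

lemma homogeneous_geometric_sum:
  fixes x y :: "'a::comm_ring_1"
  shows "(x - y) * (\<Sum>j\<le>n. x ^ j * y ^ (n - j)) = x ^ Suc n - y ^ Suc n"
  using power_diff_sumr2[of x "Suc n" y]
  by (simp add: lessThan_Suc_atMost mult.commute)

text \<open>
  Below, \<open>l i\<close> is \<open>(-1)\<^bsup>i/2\<^esup> L\<^sub>f\<^sup>*(i + 1)\<close> for even \<open>i\<close> with \<open>0 < i < K\<close>, and \<open>c j\<close> turns out to be \<open>q\<^bsub>r,s\<^esub>\<close>
  with \<open>r = j + 1\<close>, \<open>s = K - j + 1\<close>.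
\<close>
locale period_sequence =
  fixes K :: nat and l :: "nat \<Rightarrow> complex"
  assumes even_K: "even K"
    and l_odd: "odd i \<Longrightarrow> l i = 0"
    and l_antisym: "i \<le> K \<Longrightarrow> l (K - i) = - l i"
    and l_zero: "l 0 = 0"
    and l_three_term: "j \<le> K \<Longrightarrow>
      l j = (\<Sum>i\<le>j. of_nat (j choose i) * l i) - (\<Sum>i\<le>K - j. of_nat ((K - j) choose i) * l i)"
begin

definition c :: "nat \<Rightarrow> complex" where
  "c j = (\<Sum>i\<le>j. of_nat (j choose i) * l i)"

text \<open>The linear functional sending \<open>z ^ i\<close> to \<open>l i\<close>. The identities
  for \<open>H\<close> are images of polynomial identities under it; \<open>c j\<close> is its value
  at \<open>(1 + z) ^ j\<close>.\<close>

definition pairing :: "complex poly \<Rightarrow> complex" where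
  "pairing p = (\<Sum>i\<le>K. coeff p i * l i)"

definition H :: "complex \<Rightarrow> complex \<Rightarrow> complex" where
  "H a b = (\<Sum>j\<le>K. c j * ((1 / a) ^ Suc j * (1 / b) ^ Suc (K - j)))"

lemma l_eq: "j \<le> K \<Longrightarrow> l j = c j - c (K - j)"
  unfolding c_def by (rule l_three_term)

lemma c_0: "c 0 = 0"
  by (simp add: c_def l_zero)

text \<open>The relation at \<open>j = 0\<close> ties \<open>c K\<close> to \<open>c 0\<close>. The
  vanishing at both ends keeps \<zeta>(1) out of all later sums.\<close>

lemma c_K: "c K = 0"
  using l_eq[of 0] l_zero c_0 by simp

lemma c_extend: "j \<le> n \<Longrightarrow> c j = (\<Sum>i\<le>n. of_nat (j choose i) * l i)"
  unfolding c_def by (rule sum.mono_neutral_left) auto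

lemma pairing_diff: "pairing (p - q) = pairing p - pairing q"
  by (simp add: pairing_def sum_subtractf left_diff_distrib)

lemma pairing_smult: "pairing (smult a p) = a * pairing p"
  by (simp add: pairing_def sum_distrib_left mult.assoc)

lemma pairing_sum: "pairing (\<Sum>i\<in>A. p i) = (\<Sum>i\<in>A. pairing (p i))"
  unfolding pairing_def coeff_sum sum_distrib_right by (rule sum.swap)

lemma pairing_power: "j \<le> K \<Longrightarrow> pairing ([:1, 1:] ^ j) = c j"
  by (simp add: pairing_def coeff_linear_power_binomial c_extend)

lemma pairing_monom: "j \<le> K \<Longrightarrow> pairing ([:0, 1:] ^ j) = l j"
  unfolding pairing_def
  by (subst sum.mono_neutral_cong_right[of "{..K}" "{j}" _ "\<lambda>_. l j"])
     (auto simp: coeff_linear_power_binomial power_0_left)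

text \<open>Reversal of coefficients turns \<open>z ^ j * (1 + z) ^ (K - j)\<close> into
  \<open>(1 + z) ^ (K - j)\<close>, and by antisymmetry of \<open>l\<close> reversal changes the
  sign of the functional.\<close>

lemma pairing_shifted_power:
  assumes "j \<le> K"
  shows "pairing ([:0, 1:] ^ j * [:1, 1:] ^ (K - j)) = - c (K - j)"
proof -
  have co: "coeff ([:0, 1:] ^ j * [:1, 1:] ^ (K - j)) i
      = (if i < j then 0 else of_nat ((K - j) choose (i - j)) :: complex)" for i
  proof -
    have "[:0, 1:] ^ j = (monom 1 j :: complex poly)"
      by (metis monom_altdef smult_1_left)
    then show ?thesis by (simp add: coeff_monom_mult coeff_linear_power_binomial)
  qed
  have "pairing ([:0, 1:] ^ j * [:1, 1:] ^ (K - j))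
      = (\<Sum>i=j..K. of_nat ((K - j) choose (i - j)) * l i)"
    unfolding pairing_def co by (rule sum.mono_neutral_cong_right) auto
  also have "\<dots> = (\<Sum>i\<le>K - j. of_nat ((K - j) choose i) * l (K - i))"
  proof (rule sum.reindex_bij_witness[of _ "\<lambda>i. K - i" "\<lambda>i. K - i"])
    fix i assume "i \<in> {j..K}"
    then show "of_nat (K - j choose (K - i)) * l (K - (K - i)) = of_nat (K - j choose (i - j)) * l i"
      using binomial_symmetric[of "i - j" "K - j"] by (auto simp: diff_le_mono)
  qed (use assms in auto)
  also have "\<dots> = - c (K - j)"
    using assms by (auto simp: c_def l_antisym sum_negf[symmetric] intro!: sum.cong)
  finally show ?thesis .
qed

text \<open>Up to the factor \<open>u * v\<close>, the kernel is the divided difference of the power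
  \<open>K + 1\<close> at \<open>smult u p\<close> and \<open>smult v q\<close>. Keeping
  \<open>d\<close> as a multiplier avoids dividing polynomials.\<close>

lemma kernel_cancel:
  fixes p q d :: "complex poly" and u v :: complex
  assumes "smult (u * v) d = smult u p - smult v q"
  shows "d * (\<Sum>j\<le>K. smult (u ^ Suc j * v ^ Suc (K - j)) (p ^ j * q ^ (K - j)))
    = smult u p ^ Suc K - smult v q ^ Suc K"
proof -
  have "d * (\<Sum>j\<le>K. smult (u ^ Suc j * v ^ Suc (K - j)) (p ^ j * q ^ (K - j)))
     = smult (u * v) d * (\<Sum>j\<le>K. smult u p ^ j * smult v q ^ (K - j))"
    by (simp add: smult_power sum_distrib_left smult_sum_right mult_ac)
  then show ?thesis
    unfolding assms homogeneous_geometric_sum .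
qed

lemma H_symmetry: "H a b - H b a = (\<Sum>j\<le>K. l j * ((1 / a) ^ Suc j * (1 / b) ^ Suc (K - j)))"
proof -
  have "H b a = (\<Sum>j\<le>K. c (K - j) * ((1 / a) ^ Suc j * (1 / b) ^ Suc (K - j)))"
    unfolding H_def
    by (rule sum.reindex_bij_witness[of _ "\<lambda>i. K - i" "\<lambda>i. K - i"]) (auto simp: mult_ac)
  then show ?thesis
    by (simp only:) (unfold H_def sum_subtractf[symmetric],
      intro sum.cong refl, simp only: l_eq left_diff_distrib atMost_iff)
qed

text \<open>Partial fractions for \<open>1 / (n z - m)\<close>, paired with the sequence.\<close>
lemma H_three_term:
  assumes "m \<noteq> 0" "n \<noteq> 0" "m + n \<noteq> 0"
  shows "H (m + n) n - H (m + n) m = H m n - H n m"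
proof -
  define u v w where "u = 1 / m" and "v = 1 / n" and "w = 1 / (m + n)"
  let ?X = "[:0, 1:] :: complex poly" and ?Y = "[:1, 1:] :: complex poly"
  have uvw: "u * v * n = u" "u * v * m = v" "w * v * n = w" "w * v * m = v - w"
    "u * w * n = u - w" "u * w * m = w"
    using assms by (simp_all add: u_def v_def w_def divide_simps)
  define S where "S = (\<lambda>u v (p :: complex poly) q.
    (\<Sum>j\<le>K. smult (u ^ Suc j * v ^ Suc (K - j)) (p ^ j * q ^ (K - j))))"
  \<comment> \<open>The quantities \<open>z / m\<close>, \<open>(1 + z) / (m + n)\<close> and
    \<open>1 / n\<close> differ pairwise by multiples of \<open>n z - m\<close>, so the three
    kernels telescope after multiplication by \<open>?d\<close>.\<close>
  let ?d = "[:- m, n:]"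
  have "?d * S w v ?Y 1 = smult w ?Y ^ Suc K - smult v 1 ^ Suc K"
    unfolding S_def by (rule kernel_cancel) (simp add: uvw one_pCons)
  moreover have "?d * S u v ?X 1 = smult u ?X ^ Suc K - smult v 1 ^ Suc K"
    unfolding S_def by (rule kernel_cancel) (simp add: uvw one_pCons)
  moreover have "?d * S u w ?X ?Y = smult u ?X ^ Suc K - smult w ?Y ^ Suc K"
    unfolding S_def by (rule kernel_cancel) (simp add: uvw one_pCons)
  ultimately have "?d * S w v ?Y 1 = ?d * (S u v ?X 1 - S u w ?X ?Y)"
    by (simp only: right_diff_distrib) simp
  moreover have "?d \<noteq> 0" using assms by simp
  ultimately have "S w v ?Y 1 = S u v ?X 1 - S u w ?X ?Y"
    by (metis mult_left_cancel)
  then have "pairing (S w v ?Y 1) = pairing (S u v ?X 1) - pairing (S u w ?X ?Y)"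
    by (simp only: pairing_diff)
  moreover have "pairing (S w v ?Y 1) = H (m + n) n"
    unfolding S_def H_def pairing_sum
    by (auto simp: pairing_smult pairing_power v_def w_def mult_ac intro!: sum.cong)
  moreover have "pairing (S u v ?X 1) = H m n - H n m"
    unfolding S_def H_symmetry pairing_sum
    by (auto simp: pairing_smult pairing_monom u_def v_def mult_ac intro!: sum.cong)
  moreover have "pairing (S u w ?X ?Y) = - H (m + n) m"
  proof -
    have "pairing (S u w ?X ?Y) = - (\<Sum>j\<le>K. c (K - j) * (w ^ Suc (K - j) * u ^ Suc j))"
      unfolding S_def pairing_sum sum_negf[symmetric]
      by (auto simp: pairing_smult pairing_shifted_power mult_ac intro!: sum.cong)
    also have "(\<Sum>j\<le>K. c (K - j) * (w ^ Suc (K - j) * u ^ Suc j)) = H (m + n) m"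
      unfolding H_def u_def w_def
      by (rule sum.reindex_bij_witness[of _ "\<lambda>i. K - i" "\<lambda>i. K - i"]) auto
    finally show ?thesis .
  qed
  ultimately show ?thesis by simp
qed

lemma choose_reflect: "j \<le> K \<Longrightarrow> Suc K choose (K - j) = Suc K choose Suc j"
  using binomial_symmetric[of "Suc j" "Suc K"] by simp

text \<open>Hockey-stick summation gives \<open>Suc K choose Suc i\<close>; reversing the index by
  antisymmetry of \<open>l\<close> turns this into \<open>Suc K choose i\<close> and yields the
  sign.\<close>

lemma sum_c: "(\<Sum>j\<le>K. c j) = - (\<Sum>i\<le>K. of_nat (Suc K choose i) * l i)"
proof -
  have "(\<Sum>j\<le>K. c j) = (\<Sum>j\<le>K. \<Sum>i\<le>K. of_nat (j choose i) * l i)"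
    by (auto simp: c_extend intro!: sum.cong)
  also have "\<dots> = (\<Sum>i\<le>K. of_nat (Suc K choose Suc i) * l i)"
    by (subst sum.swap)
       (auto simp: sum_distrib_right[symmetric] of_nat_sum[symmetric] sum_choose_upper
        simp del: of_nat_sum binomial_Suc_Suc intro!: sum.cong)
  also have "\<dots> = (\<Sum>i\<le>K. of_nat (Suc K choose i) * l (K - i))"
    by (rule sum.reindex_bij_witness[of _ "\<lambda>i. K - i" "\<lambda>i. K - i"])
       (auto simp: choose_reflect simp del: binomial_Suc_Suc)
  also have "\<dots> = - (\<Sum>i\<le>K. of_nat (Suc K choose i) * l i)"
    by (auto simp: l_antisym sum_negf[symmetric] simp del: binomial_Suc_Suc intro!: sum.cong)
  finally show ?thesis .
qed

text \<open>Only even \<open>i\<close> carry a nonzero \<open>l i\<close>, so the functional is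
  invariant under \<open>z \<mapsto> - z\<close>, which sends \<open>(z - 1) ^ j\<close> to
  \<open>(- 1) ^ j * (z + 1) ^ j\<close>.\<close>

lemma pairing_reflected_power:
  assumes "j \<le> K"
  shows "pairing ([:- 1, 1:] ^ j) = (- 1) ^ j * c j"
proof -
  have "of_nat (j choose i) * (- 1) ^ (j - i) * l i = (- 1) ^ j * (of_nat (j choose i) * l i)"
    if "i \<le> j" for i
    using that by (cases "even i") (auto simp: l_odd minus_one_power_iff)
  then show ?thesis
    using assms unfolding c_def sum_distrib_left pairing_def coeff_linear_power_binomial
    by (intro sum.mono_neutral_cong_right) (auto simp: binomial_eq_0_iff)
qed

text \<open>\<open>\<Sum>\<^sub>j (1 + z)\<^sup>j 2\<^bsup>-j-1\<^esup>\<close> expanded in powers of \<open>z - 1\<close>.\<close>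
lemma H_2_1_expand:
  "H 2 1 = (\<Sum>j\<le>K. of_nat (Suc K choose Suc j) * (- 1) ^ j * (1 / 2) ^ Suc j * c j)"
proof -
  let ?Y = "[:1, 1:] :: complex poly" and ?Z = "[:- 1, 1:] :: complex poly"
  define A where "A = (\<Sum>j\<le>K. smult ((1 / 2) ^ Suc j) (?Y ^ j))"
  define B where "B = (\<Sum>j\<le>K. smult (of_nat (Suc K choose Suc j) * (1 / 2) ^ Suc j) (?Z ^ j))"
  have "?Z * A = smult (1 / 2) ?Y ^ Suc K - smult 1 1 ^ Suc K"
    using kernel_cancel[of "1/2" 1 ?Z ?Y 1] by (simp add: A_def del: smult_1_left power_Suc)
  moreover have "?Z * B = smult (1 / 2) ?Y ^ Suc K - smult 1 1 ^ Suc K"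
  proof -
    have "smult (1 / 2) ?Y = smult (1 / 2) ?Z + 1" by (simp add: one_pCons)
    then have "smult (1 / 2) ?Y ^ Suc K
        = (\<Sum>i\<le>Suc K. of_nat (Suc K choose i) * smult (1 / 2) ?Z ^ i)"
      using binomial_ring[of "smult (1 / 2) ?Z" 1 "Suc K"] by simp
    also have "\<dots> = 1 + (\<Sum>j\<le>K. of_nat (Suc K choose Suc j) * smult (1 / 2) ?Z ^ Suc j)"
      by (subst sum.atMost_Suc_shift) simp
    also have "(\<Sum>j\<le>K. of_nat (Suc K choose Suc j) * smult (1 / 2) ?Z ^ Suc j) = ?Z * B"
      unfolding B_def sum_distrib_left
    proof (intro sum.cong refl)
      fix j
      have "of_nat n * p = smult (of_nat n) p" for n and p :: "complex poly"
        by (simp add: of_nat_poly)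
      then show "of_nat (Suc K choose Suc j) * smult (1 / 2) ?Z ^ Suc j
          = ?Z * smult (of_nat (Suc K choose Suc j) * (1 / 2) ^ Suc j) (?Z ^ j)"
        by (simp only: smult_power smult_smult mult_smult_right) (simp only: power_Suc mult.commute)
    qed
    finally show ?thesis by (simp only: smult_1_left power_one add_diff_cancel_left')
  qed
  ultimately have "A = B"
    by (metis mult_left_cancel pCons_eq_0_iff zero_neq_one)
  then have "pairing A = pairing B" by simp
  moreover have "pairing A = H 2 1"
    unfolding A_def H_def pairing_sum
    by (auto simp: pairing_smult pairing_power mult_ac intro!: sum.cong)
  moreover have "pairing B
      = (\<Sum>j\<le>K. of_nat (Suc K choose Suc j) * (- 1) ^ j * (1 / 2) ^ Suc j * c j)"
    unfolding B_def pairing_sum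
    by (intro sum.cong refl) (simp add: pairing_smult pairing_reflected_power mult_ac del: binomial_Suc_Suc power_Suc)
  ultimately show ?thesis by simp
qed

text \<open>The second sum becomes the finite sum in \<open>lambda_coeff\<close>; the sum of the
  \<open>c j\<close> is a remainder that cancels in the final bookkeeping.\<close>

lemma H_2_1:
  "H 2 1 = - (\<Sum>j\<le>K. c j) - (\<Sum>i\<le>K. of_nat (Suc K choose i) * (1 / 2) ^ (K - i) * l i)"
proof -
  let ?C = "\<lambda>n i. of_nat (n choose i) :: complex"
  define M where "M = (\<Sum>i\<le>K. ?C (Suc K) i * (1 / 2) ^ Suc (K - i) * l i)"
  have "H 2 1 = (\<Sum>j\<le>K. ?C (Suc K) (Suc j) * (1 / 2) ^ Suc j * l j)
      + (\<Sum>j\<le>K. ?C (Suc K) (Suc j) * (- 1) ^ j * (1 / 2) ^ Suc j * c (K - j))"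
  proof -
    \<comment> \<open>For even \<open>j\<close> this is the three-term relation; for odd
      \<open>j\<close>, \<open>l j = 0\<close> makes \<open>c\<close> symmetric. Replacing
      \<open>c j\<close> by \<open>c (K - j)\<close> produces a double sum whose inner sum has a
      closed form.\<close>
    have eq: "(- 1) ^ j * c j = l j + (- 1) ^ j * c (K - j)" if "j \<le> K" for j
      using l_eq[OF that] by (cases "even j") (auto simp: l_odd algebra_simps)
    then have "?C (Suc K) (Suc j) * (- 1) ^ j * (1 / 2) ^ Suc j * c j
       = ?C (Suc K) (Suc j) * (1 / 2) ^ Suc j * l j
         + ?C (Suc K) (Suc j) * (- 1) ^ j * (1 / 2) ^ Suc j * c (K - j)"
      if "j \<le> K" for j
    proof -
      have "?C (Suc K) (Suc j) * (- 1) ^ j * (1 / 2) ^ Suc j * c j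
         = ?C (Suc K) (Suc j) * (1 / 2) ^ Suc j * ((- 1) ^ j * c j)"
        by (simp only: mult_ac)
      also have "\<dots> = ?C (Suc K) (Suc j) * (1 / 2) ^ Suc j * (l j + (- 1) ^ j * c (K - j))"
        by (simp only: eq[OF that])
      finally show ?thesis by (simp only: distrib_left mult_ac)
    qed
    then show ?thesis
      unfolding H_2_1_expand sum.distrib[symmetric] by (intro sum.cong) auto
  qed
  also have "(\<Sum>j\<le>K. ?C (Suc K) (Suc j) * (1 / 2) ^ Suc j * l j) = - M"
  proof -
    have "(\<Sum>j\<le>K. ?C (Suc K) (Suc j) * (1 / 2) ^ Suc j * l j)
       = (\<Sum>i\<le>K. ?C (Suc K) i * (1 / 2) ^ Suc (K - i) * l (K - i))"
      by (rule sum.reindex_bij_witness[of _ "\<lambda>i. K - i" "\<lambda>i. K - i"])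
         (auto simp: choose_reflect simp del: binomial_Suc_Suc)
    also have "\<dots> = - M"
      unfolding M_def
      by (auto simp: l_antisym sum_negf[symmetric] simp del: binomial_Suc_Suc intro!: sum.cong)
    finally show ?thesis .
  qed
  also have "(\<Sum>j\<le>K. ?C (Suc K) (Suc j) * (- 1) ^ j * (1 / 2) ^ Suc j * c (K - j))
     = (\<Sum>i\<le>K. ?C (Suc K) i * l i) - M"
  proof -
    have "(\<Sum>j\<le>K. ?C (Suc K) (Suc j) * (- 1) ^ j * (1 / 2) ^ Suc j * c (K - j))
       = (\<Sum>j\<le>K. \<Sum>i\<le>K. (- 1) ^ j * (1 / 2) ^ Suc j * l i
             * (?C (Suc K) (Suc j) * ?C (K - j) i))"
      by (intro sum.cong refl)
         (simp add: c_extend[of _ K] sum_distrib_left sum_distrib_right mult_ac del: binomial_Suc_Suc power_Suc)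
    also have "\<dots> = (\<Sum>i\<le>K. ?C (Suc K) i * l i *
        (\<Sum>j\<le>K - i. ?C (Suc (K - i)) (Suc j) * (- 1) ^ j * (1 / 2) ^ Suc j))"
    proof (subst sum.swap, intro sum.cong refl)
      fix i assume "i \<in> {..K}"
      then have i: "i \<le> K" by simp
      \<comment> \<open>Both products count the pairs of disjoint subsets of sizes \<open>i\<close>
        and \<open>Suc j\<close> in a set of \<open>Suc K\<close> elements.\<close>
      have ch: "?C (Suc K) (Suc j) * ?C (K - j) i = ?C (Suc K) i * ?C (Suc (K - i)) (Suc j)"
        if "j \<le> K - i" for j
      proof -
        have "(Suc K choose (Suc j + i)) * ((Suc j + i) choose i) = (Suc K choose i) * ((Suc K - i) choose Suc j)"
          using choose_mult[of i "Suc j + i" "Suc K"] that i by simp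
        moreover have "(Suc K choose (Suc j + i)) * ((Suc j + i) choose Suc j)
            = (Suc K choose Suc j) * ((Suc K - Suc j) choose i)"
          using choose_mult[of "Suc j" "Suc j + i" "Suc K"] that i by simp
        moreover have "(Suc j + i) choose i = (Suc j + i) choose Suc j"
          by (metis add_diff_cancel_right' binomial_symmetric le_add2)
        ultimately show ?thesis
          using i unfolding of_nat_mult[symmetric]
          by (metis (no_types, lifting) Suc_diff_le diff_Suc_Suc)
      qed
      have "(\<Sum>j\<le>K. (- 1) ^ j * (1 / 2) ^ Suc j * l i * (?C (Suc K) (Suc j) * ?C (K - j) i))
         = (\<Sum>j\<le>K - i. (- 1) ^ j * (1 / 2) ^ Suc j * l i * (?C (Suc K) (Suc j) * ?C (K - j) i))"
        by (rule sum.mono_neutral_right) (auto simp: binomial_eq_0_iff)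
      also have "\<dots> = ?C (Suc K) i * l i *
          (\<Sum>j\<le>K - i. ?C (Suc (K - i)) (Suc j) * (- 1) ^ j * (1 / 2) ^ Suc j)"
        unfolding sum_distrib_left
        by (intro sum.cong refl) (simp only: ch atMost_iff, simp only: mult_ac)
      finally show "(\<Sum>j\<le>K. (- 1) ^ j * (1 / 2) ^ Suc j * l i * (?C (Suc K) (Suc j) * ?C (K - j) i))
         = ?C (Suc K) i * l i *
          (\<Sum>j\<le>K - i. ?C (Suc (K - i)) (Suc j) * (- 1) ^ j * (1 / 2) ^ Suc j)" .
    qed
    also have "\<dots> = (\<Sum>i\<le>K. ?C (Suc K) i * l i) - M"
      unfolding alternating_half_sum M_def sum_subtractf[symmetric]
      by (intro sum.cong refl) (simp add: algebra_simps del: binomial_Suc_Suc)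
    finally show ?thesis .
  qed
  also have "M + M = (\<Sum>i\<le>K. ?C (Suc K) i * (1 / 2) ^ (K - i) * l i)"
    unfolding M_def sum.distrib[symmetric] by (intro sum.cong refl) (simp del: binomial_Suc_Suc)
  then have "- M + ((\<Sum>i\<le>K. ?C (Suc K) i * l i) - M)
      = (\<Sum>i\<le>K. ?C (Suc K) i * l i) - (\<Sum>i\<le>K. ?C (Suc K) i * (1 / 2) ^ (K - i) * l i)"
    by (simp add: algebra_simps)
  finally show ?thesis
    unfolding sum_c by simp
qed

end

section \<open>Double sums\<close>

lemma has_sum_diff_complex:
  fixes f g :: "'a \<Rightarrow> complex"
  assumes "(f has_sum a) A" "(g has_sum b) A"
  shows "((\<lambda>x. f x - g x) has_sum (a - b)) A"
  using has_sum_add[OF assms(1), of "\<lambda>x. - g x" "- b"] assms(2) by (simp add: has_sum_uminus)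

lemma has_sum_finite_sum:
  fixes f :: "'i \<Rightarrow> 'a \<Rightarrow> complex"
  assumes "\<And>i. i \<in> I \<Longrightarrow> (f i has_sum s i) A"
  shows "((\<lambda>x. \<Sum>i\<in>I. f i x) has_sum (\<Sum>i\<in>I. s i)) A"
  using assms by (induction I rule: infinite_finite_induct) (auto intro!: has_sum_add has_sum_0)

lemma has_sum_product_complex:
  fixes f :: "'a \<Rightarrow> complex" and g :: "'b \<Rightarrow> complex"
  assumes f: "(f has_sum s) A" and g: "(g has_sum t) B"
  shows "((\<lambda>(x, y). f x * g y) has_sum (s * t)) (A \<times> B)"
proof -
  have fa: "(\<lambda>x. norm (f x)) summable_on A" and ga: "(\<lambda>y. norm (g y)) summable_on B"
    using f g by (auto simp: summable_on_iff_abs_summable_on_complex[symmetric] summable_on_def)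
  have *: "(\<lambda>p. norm ((\<lambda>(x, y). f x * g y) p)) summable_on A \<times> B"
  proof (subst Infinite_Sum.abs_summable_on_Sigma_iff, intro conjI ballI)
    fix x show "(\<lambda>y. norm ((\<lambda>(x, y). f x * g y) (x, y))) summable_on B"
      using ga by (simp add: norm_mult summable_on_cmult_right)
  next
    have "0 \<le> infsum (\<lambda>y. norm (g y)) B" by (rule infsum_nonneg) auto
    then show "(\<lambda>x. norm (infsum (\<lambda>y. norm ((\<lambda>(x, y). f x * g y) (x, y))) B)) summable_on A"
      using fa by (simp add: norm_mult infsum_cmult_right' summable_on_cmult_left)
  qed
  then have sm: "(\<lambda>(x, y). f x * g y) summable_on A \<times> B"
    by (rule abs_summable_summable)
  have "infsum (\<lambda>(x, y). f x * g y) (A \<times> B) = infsum (\<lambda>x. infsum (\<lambda>y. f x * g y) B) A"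
    using infsum_Sigma'_banach[of "\<lambda>x y. f x * g y" A "\<lambda>_. B"] sm by simp
  also have "\<dots> = s * t"
    using f g by (simp add: infsum_cmult_right' infsum_cmult_left' infsumI)
  finally show ?thesis using sm by (simp add: has_sum_iff)
qed

lemma zeta_nat_has_sum_real:
  assumes "k \<ge> 2"
  shows "((\<lambda>n. (1 / real n) ^ k) has_sum zeta_nat k) {0<..}"
proof -
  have "summable (\<lambda>n. 1 / real (Suc n) ^ k)"
    using inverse_power_summable[OF assms, where ?'a = real]
    by (subst (asm) summable_Suc_iff[symmetric]) (simp add: field_simps)
  then have "(\<lambda>n. 1 / real (Suc n) ^ k) sums zeta_nat k"
    unfolding zeta_nat_def by (rule summable_sums)
  then have "((\<lambda>n. 1 / real (Suc n) ^ k) has_sum zeta_nat k) UNIV"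
    by (rule sums_nonneg_imp_has_sum) simp
  then show ?thesis
    by (subst has_sum_reindex_bij_witness[of _ Suc "\<lambda>n. n - 1" UNIV "\<lambda>n. 1 / real (Suc n) ^ k"])
       (auto simp: power_divide)
qed

lemma zeta_nat_has_sum:
  assumes "k \<ge> 2"
  shows "((\<lambda>n. (1 / of_nat n) ^ k) has_sum (of_real (zeta_nat k) :: complex)) {0<..}"
  using has_sum_of_real[OF zeta_nat_has_sum_real[OF assms], where ?'a = complex] by simp

definition pos_pairs :: "(nat \<times> nat) set" where "pos_pairs = {0<..} \<times> {0<..}"
definition lt_pairs :: "(nat \<times> nat) set" where "lt_pairs = {(m, n). 0 < m \<and> m < n}"
definition gt_pairs :: "(nat \<times> nat) set" where "gt_pairs = {(m, n). 0 < n \<and> n < m}"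

lemma zeta_nat_product_has_sum:
  assumes "r \<ge> 2" "s \<ge> 2"
  shows "((\<lambda>(m, n). (1 / of_nat m) ^ r * (1 / of_nat n) ^ s)
    has_sum (of_real (zeta_nat r * zeta_nat s) :: complex)) pos_pairs"
  using has_sum_product_complex[OF zeta_nat_has_sum[OF assms(1)] zeta_nat_has_sum[OF assms(2)]]
  by (simp add: pos_pairs_def)

text \<open>Convergence comes from the substitution \<open>(m, n) \<mapsto> (m + n, n)\<close>,
  which identifies the series over all positive pairs with the part of \<zeta>(r) \<zeta>(s) whose
  first index exceeds the second.\<close>

lemma zeta_hat_has_sum:
  assumes "r \<ge> 2" "s \<ge> 2"
  shows "((\<lambda>(m, n). (1 / of_nat (m + n)) ^ r * (1 / of_nat n) ^ s)
    has_sum (of_real (zeta_hat r s) :: complex)) lt_pairs"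
proof -
  let ?f = "\<lambda>(m, n). (1 / real m) ^ r * (1 / real n) ^ s"
  have "(?f has_sum (zeta_nat r * zeta_nat s)) pos_pairs"
    using zeta_nat_product_has_sum[OF assms]
    by (subst has_sum_of_real_iff[symmetric, where ?'a = complex]) (simp add: case_prod_unfold)
  then have "?f summable_on gt_pairs"
    by (rule summable_on_subset_banach[OF has_sum_imp_summable])
       (auto simp: pos_pairs_def gt_pairs_def)
  then have "(\<lambda>(m, n). (1 / real (m + n)) ^ r * (1 / real n) ^ s) summable_on pos_pairs"
    by (subst summable_on_reindex_bij_witness[of _ "\<lambda>(m, n). (m - n, n)" "\<lambda>(m, n). (m + n, n)" gt_pairs ?f])
       (auto simp: pos_pairs_def gt_pairs_def)
  then have "(\<lambda>(m, n). (1 / real (m + n)) ^ r * (1 / real n) ^ s) summable_on lt_pairs"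
    by (rule summable_on_subset_banach) (auto simp: pos_pairs_def lt_pairs_def)
  then have "((\<lambda>(m, n). (1 / real (m + n)) ^ r * (1 / real n) ^ s) has_sum zeta_hat r s) lt_pairs"
    unfolding zeta_hat_def by (simp add: lt_pairs_def power_divide has_sum_infsum)
  from has_sum_of_real[OF this, where ?'a = complex] show ?thesis
    by (simp add: case_prod_unfold)
qed

lemma infsum_pos_pairs_split:
  fixes f :: "nat \<times> nat \<Rightarrow> complex"
  assumes "f summable_on pos_pairs"
  shows "infsum f pos_pairs = infsum f lt_pairs + infsum f gt_pairs + infsum (\<lambda>n. f (n, n)) {0<..}"
proof -
  let ?D = "(\<lambda>n. (n, n)) ` {0<..} :: (nat \<times> nat) set"
  have eq: "pos_pairs = lt_pairs \<union> gt_pairs \<union> ?D"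
    by (force simp: pos_pairs_def lt_pairs_def gt_pairs_def image_iff)
  have s: "f summable_on A" if "A \<subseteq> pos_pairs" for A
    using assms that by (rule summable_on_subset_banach)
  have "infsum f pos_pairs = infsum f (lt_pairs \<union> gt_pairs) + infsum f ?D"
    unfolding eq by (intro infsum_Un_disjoint s) (auto simp: pos_pairs_def lt_pairs_def gt_pairs_def)
  also have "infsum f (lt_pairs \<union> gt_pairs) = infsum f lt_pairs + infsum f gt_pairs"
    by (intro infsum_Un_disjoint s) (auto simp: pos_pairs_def lt_pairs_def gt_pairs_def)
  also have "infsum f ?D = infsum (\<lambda>n. f (n, n)) {0<..}"
    by (subst infsum_reindex) (auto simp: inj_on_def o_def)
  finally show ?thesis .
qed

section \<open>Summing the three-term relation over positive pairs\<close>

context period_sequence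
begin

text \<open>The exponents are \<open>Suc j\<close> and \<open>Suc (K - j)\<close>, so it is odd
  \<open>j\<close> that gives even exponents.\<close>

definition H_even :: "complex \<Rightarrow> complex \<Rightarrow> complex" where
  "H_even a b = (\<Sum>j | j \<le> K \<and> odd j. c j * ((1 / a) ^ Suc j * (1 / b) ^ Suc (K - j)))"

definition H_odd :: "complex \<Rightarrow> complex \<Rightarrow> complex" where
  "H_odd a b = (\<Sum>j | j \<le> K \<and> even j. c j * ((1 / a) ^ Suc j * (1 / b) ^ Suc (K - j)))"

lemma H_split: "H a b = H_even a b + H_odd a b"
proof -
  have "{..K} = {j. j \<le> K \<and> odd j} \<union> {j. j \<le> K \<and> even j}" by auto
  then show ?thesis
    unfolding H_def H_even_def H_odd_def by (simp only:) (rule sum.union_disjoint; auto)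
qed

lemma H_even_minus: "H_even (- a) b = H_even a b" "H_even a (- b) = H_even a b"
  unfolding H_even_def using even_K by (auto intro!: sum.cong simp: uminus_power_if)

lemma H_odd_minus: "H_odd (- a) b = - H_odd a b" "H_odd a (- b) = - H_odd a b"
  unfolding H_odd_def sum_negf[symmetric]
  using even_K by (auto intro!: sum.cong simp: uminus_power_if)

text \<open>For odd \<open>j\<close> the three-term relation reads \<open>c j = c (K - j)\<close>,
  because \<open>l j = 0\<close>.\<close>

lemma H_even_commute: "H_even a b = H_even b a"
proof -
  have cc: "c (K - j) = c j" if "j \<le> K" "odd j" for j
    using l_eq[OF that(1)] l_odd[OF that(2)] by simp
  show ?thesis
    unfolding H_even_def
    by (rule sum.reindex_bij_witness[of _ "\<lambda>i. K - i" "\<lambda>i. K - i"])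
       (use even_K in \<open>auto simp: cc mult_ac\<close>)
qed

text \<open>This is \<open>H_three_term\<close> at \<open>(- (a + b), b)\<close>: the arguments add
  up to \<open>- a\<close>, so up to sign only \<open>a\<close>, \<open>b\<close> and
  \<open>a + b\<close> occur, and the signs affect \<open>H_odd\<close> alone. Over all positive
  \<open>a\<close>, \<open>b\<close>, the pairs \<open>(a, a + b)\<close> and
  \<open>(b, a + b)\<close> each run through \<open>lt_pairs\<close>.\<close>

lemma H_alternating_three_term:
  assumes "a \<noteq> 0" "b \<noteq> 0" "a + b \<noteq> 0"
  shows "H_even a b - H_odd a b - H_even a (a + b) - H_odd a (a + b)
    = H_odd b (a + b) - H_odd (a + b) b"
proof -
  have "H (- (a + b) + b) b - H (- (a + b) + b) (- (a + b)) = H (- (a + b)) b - H b (- (a + b))"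
    by (rule H_three_term) (use assms in auto)
  then have "H (- a) b - H (- a) (- (a + b)) = H (- (a + b)) b - H b (- (a + b))"
    by simp
  then show ?thesis
    unfolding H_split H_even_minus H_odd_minus by (simp add: H_even_commute[of b] algebra_simps)
qed

lemma term_has_sum:
  assumes "j \<le> K" "j \<noteq> 0" "j \<noteq> K"
  shows "((\<lambda>(m, n). (1 / of_nat m) ^ Suc j * (1 / of_nat n) ^ Suc (K - j))
    has_sum (of_real (zeta_nat (Suc j) * zeta_nat (Suc (K - j))) :: complex)) pos_pairs"
  by (rule zeta_nat_product_has_sum) (use assms in auto)

lemma c_term_has_sum:
  assumes "j \<le> K"
  shows "((\<lambda>(m, n). c j * ((1 / of_nat m) ^ Suc j * (1 / of_nat n) ^ Suc (K - j)))
    has_sum (c j * of_real (zeta_nat (Suc j) * zeta_nat (Suc (K - j))))) pos_pairs"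
proof (cases "j = 0 \<or> j = K")
  \<comment> \<open>Here \<open>zeta_nat 1\<close> occurs, the value assigned to a divergent series;
    its coefficient \<open>c j\<close> is 0.\<close>
  case True
  then show ?thesis by (auto simp: c_0 c_K case_prod_unfold)
next
  case False
  then show ?thesis
    using has_sum_cmult_right[OF term_has_sum[of j], of "c j"] assms by (simp add: case_prod_unfold)
qed

abbreviation at_nats :: "(complex \<Rightarrow> complex \<Rightarrow> complex) \<Rightarrow> nat \<times> nat \<Rightarrow> complex" where
  "at_nats h \<equiv> \<lambda>(m, n). h (of_nat m) (of_nat n)"

lemma H_even_has_sum:
  "(at_nats H_even has_sum
    (\<Sum>j | j \<le> K \<and> odd j. c j * of_real (zeta_nat (Suc j) * zeta_nat (Suc (K - j))))) pos_pairs"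
proof -
  have "((\<lambda>p. \<Sum>j | j \<le> K \<and> odd j.
      (\<lambda>(m, n). c j * ((1 / of_nat m) ^ Suc j * (1 / of_nat n) ^ Suc (K - j))) p) has_sum
    (\<Sum>j | j \<le> K \<and> odd j. c j * of_real (zeta_nat (Suc j) * zeta_nat (Suc (K - j))))) pos_pairs"
    by (intro has_sum_finite_sum c_term_has_sum) auto
  then show ?thesis unfolding H_even_def by (simp add: case_prod_unfold del: power_Suc)
qed

lemma H_odd_summable: "at_nats H_odd summable_on pos_pairs"
proof -
  have "((\<lambda>p. \<Sum>j | j \<le> K \<and> even j.
      (\<lambda>(m, n). c j * ((1 / of_nat m) ^ Suc j * (1 / of_nat n) ^ Suc (K - j))) p) has_sum
    (\<Sum>j | j \<le> K \<and> even j. c j * of_real (zeta_nat (Suc j) * zeta_nat (Suc (K - j))))) pos_pairs"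
    by (intro has_sum_finite_sum c_term_has_sum) auto
  then show ?thesis
    unfolding H_odd_def by (auto simp: summable_on_def case_prod_unfold simp del: power_Suc)
qed

lemma H_scale:
  "(\<lambda>n. \<Sum>j\<le>K. c j * ((1 / (x * of_nat n)) ^ Suc j * (1 / (y * of_nat n)) ^ Suc (K - j)))
    = (\<lambda>n. (1 / of_nat n) ^ (K + 2) * H x y)"
proof
  fix n :: nat
  have "(1 / (x * of_nat n)) ^ Suc j * (1 / (y * of_nat n)) ^ Suc (K - j)
     = (1 / of_nat n) ^ (K + 2) * ((1 / x) ^ Suc j * (1 / y) ^ Suc (K - j))" if "j \<le> K" for j
  proof -
    have "K + 2 = Suc j + Suc (K - j)" using that by simp
    then have "(1 / of_nat n :: complex) ^ (K + 2) = (1 / of_nat n) ^ Suc j * (1 / of_nat n) ^ Suc (K - j)"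
      by (simp only: power_add)
    moreover have "1 / (z * w) = 1 / z * (1 / w)" for z w :: complex by simp
    ultimately show ?thesis by (simp only: power_mult_distrib mult_ac)
  qed
  then show "(\<Sum>j\<le>K. c j * ((1 / (x * of_nat n)) ^ Suc j * (1 / (y * of_nat n)) ^ Suc (K - j)))
     = (1 / of_nat n) ^ (K + 2) * H x y"
    unfolding H_def sum_distrib_left by (intro sum.cong) auto
qed

text \<open>Two linear relations suffice. The three-term relation reduces the wanted sum to the sum
  of \<open>H\<close> over \<open>lt_pairs\<close>; the alternating relation and the symmetry of
  \<open>H_even\<close> reduce the latter to the full sum of \<open>H_even\<close> and the
  diagonal.\<close>

lemma double_H_sum:
  "2 * infsum (\<lambda>(m, n). H (of_nat (m + n)) (of_nat n)) lt_pairs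
    = 2 / 3 * (\<Sum>j | j \<le> K \<and> odd j. c j * of_real (zeta_nat (Suc j) * zeta_nat (Suc (K - j))))
      - of_real (zeta_nat (K + 2)) * ((\<Sum>j\<le>K. c j) / 3 + H 2 1)"
proof -
  define h e o' where "h = at_nats H" and "e = at_nats H_even" and "o' = at_nats H_odd"
  have e: "e summable_on pos_pairs" and o': "o' summable_on pos_pairs"
    using H_even_has_sum H_odd_summable by (auto simp: e_def o'_def has_sum_imp_summable)
  have h_eq: "h = (\<lambda>p. e p + o' p)" by (auto simp: h_def e_def o'_def H_split)
  have h: "h summable_on pos_pairs" unfolding h_eq by (intro summable_on_add e o')
  have sub: "lt_pairs \<subseteq> pos_pairs" "gt_pairs \<subseteq> pos_pairs"
    by (auto simp: pos_pairs_def lt_pairs_def gt_pairs_def)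
  note ss = summable_on_subset_banach
  define h1 h2 where "h1 = (\<lambda>(m, n). h (m + n, n))" and "h2 = (\<lambda>(m, n). h (m + n, m))"
  have h1: "h1 summable_on pos_pairs"
    by (subst summable_on_reindex_bij_witness[of _ "\<lambda>(m, n). (m - n, n)" "\<lambda>(m, n). (m + n, n)" gt_pairs h])
       (auto simp: pos_pairs_def gt_pairs_def h1_def intro: ss[OF h sub(2), unfolded gt_pairs_def])
  have h1_gt: "infsum h1 pos_pairs = infsum h gt_pairs"
    by (rule infsum_reindex_bij_witness[of _ "\<lambda>(m, n). (m - n, n)" "\<lambda>(m, n). (m + n, n)"])
       (auto simp: pos_pairs_def gt_pairs_def h1_def)
  have h2_lt: "infsum h1 gt_pairs = infsum h2 lt_pairs"
    by (rule infsum_reindex_bij_witness[of _ "\<lambda>(m, n). (n, m)" "\<lambda>(m, n). (n, m)"])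
       (auto simp: lt_pairs_def gt_pairs_def h1_def h2_def add.commute)
  have h2: "h2 summable_on pos_pairs"
    using h1
    by (subst summable_on_reindex_bij_witness[of _ "\<lambda>(m, n). (n, m)" "\<lambda>(m, n). (n, m)" pos_pairs h1])
       (auto simp: pos_pairs_def h1_def h2_def add.commute)
  have swap: "infsum (\<lambda>(m, n). h (n, m)) lt_pairs = infsum h gt_pairs"
    by (rule infsum_reindex_bij_witness[of _ "\<lambda>(m, n). (n, m)" "\<lambda>(m, n). (n, m)"])
       (auto simp: lt_pairs_def gt_pairs_def)
  have swap_s: "(\<lambda>(m, n). h (n, m)) summable_on lt_pairs"
    by (subst summable_on_reindex_bij_witness[of _ "\<lambda>(m, n). (n, m)" "\<lambda>(m, n). (n, m)" gt_pairs h])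
       (auto simp: lt_pairs_def gt_pairs_def intro: ss[OF h sub(2), unfolded gt_pairs_def])
  have A: "infsum h1 lt_pairs - infsum h2 lt_pairs = infsum h lt_pairs - infsum h gt_pairs"
  proof -
    have "infsum h1 lt_pairs - infsum h2 lt_pairs = infsum (\<lambda>p. h1 p - h2 p) lt_pairs"
      by (intro infsumI[symmetric] has_sum_diff_complex has_sum_infsum ss[OF h1 sub(1)] ss[OF h2 sub(1)])
    also have "\<dots> = infsum (\<lambda>p. h p - (\<lambda>(m, n). h (n, m)) p) lt_pairs"
      by (intro infsum_cong)
         (auto simp: h1_def h2_def h_def lt_pairs_def of_nat_add[symmetric] simp del: of_nat_add
           intro!: H_three_term[folded of_nat_add, of "of_nat _" "of_nat _", simplified])
    also have "\<dots> = infsum h lt_pairs - infsum (\<lambda>(m, n). h (n, m)) lt_pairs"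
      by (intro infsumI has_sum_diff_complex has_sum_infsum ss[OF h sub(1)] swap_s)
    finally show ?thesis unfolding swap .
  qed
  have h_diag: "infsum (\<lambda>n. h1 (n, n)) {0<..} = of_real (zeta_nat (K + 2)) * H 2 1"
  proof -
    have "(\<lambda>n. h1 (n, n)) = (\<lambda>n. (1 / of_nat n) ^ (K + 2) * H 2 1)"
      unfolding H_scale[symmetric] by (auto simp: h1_def h_def H_def simp del: power_Suc)
    then show ?thesis
      using has_sum_cmult_left[OF zeta_nat_has_sum[of "K + 2"], of "H 2 1"] by (simp add: infsumI)
  qed
  \<comment> \<open>Over all pairs, \<open>h1\<close> sums to the part of \<open>h\<close> on
    \<open>gt_pairs\<close>, while its own part on \<open>gt_pairs\<close> is the sum of
    \<open>h2\<close> on \<open>lt_pairs\<close>. Adding this to \<open>A\<close> eliminates both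
    \<open>h2\<close> and \<open>h\<close> on \<open>gt_pairs\<close>.\<close>
  have B: "2 * infsum h1 lt_pairs = infsum h lt_pairs - of_real (zeta_nat (K + 2)) * H 2 1"
    using A infsum_pos_pairs_split[OF h1] unfolding h1_gt h2_lt h_diag by (simp add: algebra_simps)
  have e_sym: "infsum e gt_pairs = infsum e lt_pairs"
    by (rule infsum_reindex_bij_witness[of _ "\<lambda>(m, n). (n, m)" "\<lambda>(m, n). (n, m)"])
       (auto simp: lt_pairs_def gt_pairs_def e_def intro: H_even_commute)
  note e_split = infsum_pos_pairs_split[OF e, unfolded e_sym]
  note o_split = infsum_pos_pairs_split[OF o']
  have shift: "((\<lambda>(a, b). f (a, a + b)) has_sum infsum f lt_pairs) pos_pairs"
              "((\<lambda>(a, b). f (b, a + b)) has_sum infsum f lt_pairs) pos_pairs"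
              "((\<lambda>(a, b). f (a + b, b)) has_sum infsum f gt_pairs) pos_pairs"
    if f: "f summable_on pos_pairs" for f :: "nat \<times> nat \<Rightarrow> complex"
  proof -
    have "(f has_sum infsum f lt_pairs) lt_pairs" "(f has_sum infsum f gt_pairs) gt_pairs"
      using ss[OF f sub(1)] ss[OF f sub(2)] by auto
    then show "((\<lambda>(a, b). f (a, a + b)) has_sum infsum f lt_pairs) pos_pairs"
              "((\<lambda>(a, b). f (b, a + b)) has_sum infsum f lt_pairs) pos_pairs"
              "((\<lambda>(a, b). f (a + b, b)) has_sum infsum f gt_pairs) pos_pairs"
      by (subst has_sum_reindex_bij_witness[of _ "\<lambda>(a, b). (a, b - a)" "\<lambda>(a, b). (a, a + b)" lt_pairs f],
          auto simp: pos_pairs_def lt_pairs_def)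
         (subst has_sum_reindex_bij_witness[of _ "\<lambda>(a, b). (b - a, a)" "\<lambda>(a, b). (b, a + b)" lt_pairs f],
          auto simp: pos_pairs_def lt_pairs_def,
          subst has_sum_reindex_bij_witness[of _ "\<lambda>(a, b). (a - b, b)" "\<lambda>(a, b). (a + b, b)" gt_pairs f],
          auto simp: pos_pairs_def gt_pairs_def)
  qed
  have C: "infsum e pos_pairs - infsum o' pos_pairs - infsum e lt_pairs - infsum o' lt_pairs
      = infsum o' lt_pairs - infsum o' gt_pairs"
  proof -
    have "((\<lambda>p. e p - o' p - (\<lambda>(a, b). e (a, a + b)) p - (\<lambda>(a, b). o' (a, a + b)) p) has_sum
       (infsum e pos_pairs - infsum o' pos_pairs - infsum e lt_pairs - infsum o' lt_pairs)) pos_pairs"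
      by (intro has_sum_diff_complex shift e o' has_sum_infsum)
    moreover have "((\<lambda>p. (\<lambda>(a, b). o' (b, a + b)) p - (\<lambda>(a, b). o' (a + b, b)) p) has_sum
       (infsum o' lt_pairs - infsum o' gt_pairs)) pos_pairs"
      by (intro has_sum_diff_complex shift o')
    moreover have "e p - o' p - (\<lambda>(a, b). e (a, a + b)) p - (\<lambda>(a, b). o' (a, a + b)) p
       = (\<lambda>(a, b). o' (b, a + b)) p - (\<lambda>(a, b). o' (a + b, b)) p" if p: "p \<in> pos_pairs" for p
    proof -
      obtain a b where [simp]: "p = (a, b)" by fastforce
      have "of_nat a + of_nat b \<noteq> (0 :: complex)"
        using p by (simp add: pos_pairs_def of_nat_add[symmetric] del: of_nat_add)
      then show ?thesis
        using H_alternating_three_term[of "of_nat a" "of_nat b"] p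
        by (simp add: pos_pairs_def e_def o'_def)
    qed
    ultimately show ?thesis
      by (metis (no_types, lifting) has_sum_cong has_sum_unique)
  qed
  have diag: "infsum (\<lambda>n. e (n, n)) {0<..} + infsum (\<lambda>n. o' (n, n)) {0<..}
      = of_real (zeta_nat (K + 2)) * (\<Sum>j\<le>K. c j)"
  proof -
    have d: "(\<lambda>n. f (n, n)) summable_on {0<..}" if "f summable_on pos_pairs" for f :: "nat \<times> nat \<Rightarrow> complex"
    proof -
      have "f summable_on (\<lambda>n. (n, n)) ` {0<..}"
        by (rule ss[OF that]) (auto simp: pos_pairs_def)
      then show ?thesis by (subst (asm) summable_on_reindex) (auto simp: inj_on_def o_def)
    qed
    have "infsum (\<lambda>n. e (n, n)) {0<..} + infsum (\<lambda>n. o' (n, n)) {0<..} = infsum (\<lambda>n. h (n, n)) {0<..}"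
      unfolding h_eq by (rule infsum_add[symmetric]) (intro d e o')+
    also have "(\<lambda>n. h (n, n)) = (\<lambda>n. (1 / of_nat n) ^ (K + 2) * H 1 1)"
      unfolding H_scale[symmetric] by (auto simp: h_def H_def simp del: power_Suc)
    also have "infsum \<dots> {0<..} = of_real (zeta_nat (K + 2)) * H 1 1"
      using has_sum_cmult_left[OF zeta_nat_has_sum[of "K + 2"], of "H 1 1"] by (simp add: infsumI)
    also have "H 1 1 = (\<Sum>j\<le>K. c j)" by (simp add: H_def)
    finally show ?thesis .
  qed
  have hl: "infsum h lt_pairs = infsum e lt_pairs + infsum o' lt_pairs"
    unfolding h_eq by (rule infsum_add) (intro ss[OF e sub(1)] ss[OF o' sub(1)])+
  \<comment> \<open>\<open>C\<close> and the splitting of \<open>o'\<close> give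
    \<open>3 * ol = ex - el - od\<close>; inserting \<open>2 * el = ex - ed\<close> produces the
    coefficients 4 and 2.\<close>
  have D: "6 * infsum h lt_pairs = 4 * infsum e pos_pairs - 2 * of_real (zeta_nat (K + 2)) * (\<Sum>j\<le>K. c j)"
  proof -
    have "6 * (el + ol) = 4 * ex - 2 * (ed + od)"
      if "ex - ox - el - ol = ol - og" "ex = el + el + ed" "ox = ol + og + od" for el ol og ex ox ed od :: complex
    proof -
      have "3 * ol = ex - el - od" using that(1) unfolding that(3) by (simp add: algebra_simps)
      then show ?thesis using that(2) by algebra
    qed
    from this[OF C e_split o_split] show ?thesis
      unfolding diag hl by (simp add: mult.assoc)
  qed
  have E: "infsum e pos_pairs
      = (\<Sum>j | j \<le> K \<and> odd j. c j * of_real (zeta_nat (Suc j) * zeta_nat (Suc (K - j))))"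
    unfolding e_def by (rule infsumI[OF H_even_has_sum])
  have h1_eq: "h1 = (\<lambda>(m, n). H (of_nat (m + n)) (of_nat n))" by (auto simp: h1_def h_def)
  have "2 * x = 2 / 3 * ex - z * (C / 3 + y)"
    if "2 * x = hl - z * y" "6 * hl = 4 * ex - 2 * z * C" for x ex z C y hl :: complex
  proof -
    have "hl = (4 * ex - 2 * z * C) / 6" using that(2) by (simp add: field_simps)
    then have "2 * x = (4 * ex - 2 * z * C) / 6 - z * y" using that(1) by simp
    also have "\<dots> = 2 / 3 * ex - z * (C / 3 + y)"
      by (simp add: diff_divide_distrib ring_distribs)
    finally show ?thesis .
  qed
  from this[OF B D] show ?thesis unfolding E h1_eq .
qed

end

section \<open>Periods of a cusp form\<close>

lemma convex_uhp: "convex upper_half_plane"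
  unfolding upper_half_plane_def by (rule convex_halfspace_Im_gt)

lemma open_uhp: "open upper_half_plane"
  unfolding upper_half_plane_def by (rule open_halfspace_Im_gt)

lemma uhp_iff: "z \<in> upper_half_plane \<longleftrightarrow> Im z > 0"
  by (simp add: upper_half_plane_def)

lemma uhp_nonzero: "z \<in> upper_half_plane \<Longrightarrow> z \<noteq> 0"
  by (auto simp: uhp_iff)

lemma Im_minus_inverse: "Im (- 1 / z) = Im z / (norm z)\<^sup>2"
  by (cases "z = 0") (auto simp: Im_divide cmod_power2)

lemma uhp_minus_inverse: "z \<in> upper_half_plane \<Longrightarrow> - 1 / z \<in> upper_half_plane"
  using Im_minus_inverse[of z] uhp_nonzero[of z] by (auto simp: uhp_iff)

lemma uhp_add_real: "z \<in> upper_half_plane \<Longrightarrow> z + of_real a \<in> upper_half_plane"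
  by (simp add: uhp_iff)

section \<open>Growth conditions on the upper half-plane\<close>

lemma power_le_fact_exp:
  fixes y :: real
  assumes "0 \<le> y"
  shows "y ^ n \<le> fact n * exp y"
proof -
  have "y ^ n /\<^sub>R fact n = (\<Sum>i\<in>{n}. y ^ i /\<^sub>R fact i)" by simp
  also have "\<dots> \<le> exp y"
    unfolding sums_unique[OF exp_converges]
    by (rule sum_le_suminf[OF sums_summable[OF exp_converges]]) (use assms in auto)
  finally show ?thesis by (simp add: field_simps)
qed

text \<open>\<open>uhp_size\<close> is invariant under \<open>z \<mapsto> -1/z\<close> and quasi-invariant under translations, so the
  growth condition below is stable under the modular group.\<close>
definition uhp_size :: "complex \<Rightarrow> real" where
  "uhp_size z = (1 + (norm z)\<^sup>2) / Im z"

definition moderate_growth :: "(complex \<Rightarrow> complex) \<Rightarrow> bool" where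
  "moderate_growth g \<longleftrightarrow> g holomorphic_on upper_half_plane \<and>
     (\<exists>C N. \<forall>z\<in>upper_half_plane. norm (g z) \<le> C * uhp_size z ^ N)"

lemma uhp_size_ge_norm:
  assumes "z \<in> upper_half_plane"
  shows "norm z \<le> uhp_size z"
proof -
  have "norm z * Im z \<le> norm z * norm z"
    using abs_Im_le_cmod[of z] by (intro mult_left_mono) auto
  then show ?thesis
    using assms by (simp add: uhp_size_def uhp_iff pos_le_divide_eq power2_eq_square)
qed

lemma uhp_size_ge_inverse_Im: "z \<in> upper_half_plane \<Longrightarrow> 1 / Im z \<le> uhp_size z"
  by (simp add: uhp_size_def uhp_iff divide_right_mono)

lemma uhp_size_ge_1:
  assumes "z \<in> upper_half_plane"
  shows "1 \<le> uhp_size z"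
proof -
  have "Im z \<le> norm z" using abs_Im_le_cmod[of z] by linarith
  also have "\<dots> \<le> 1 + (norm z)\<^sup>2"
  proof -
    have "2 * norm z \<le> 1 + (norm z)\<^sup>2"
      using zero_le_power2[of "norm z - 1"] by (simp add: power2_diff)
    then show ?thesis using norm_ge_zero[of z] by linarith
  qed
  finally show ?thesis using assms by (simp add: uhp_size_def uhp_iff)
qed

lemma uhp_size_minus_inverse:
  assumes "z \<in> upper_half_plane"
  shows "uhp_size (- 1 / z) = uhp_size z"
  using assms uhp_nonzero[OF assms] unfolding uhp_size_def Im_minus_inverse
  by (simp add: norm_divide power_divide divide_simps uhp_iff add_eq_0_iff sum_power2_eq_zero_iff)

lemma uhp_size_add_real:
  assumes "z \<in> upper_half_plane"
  shows "uhp_size (z + of_real a) \<le> (2 + 2 * a\<^sup>2) * uhp_size z"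
proof -
  have "(norm (z + of_real a))\<^sup>2 \<le> (norm z + \<bar>a\<bar>)\<^sup>2"
    using norm_triangle_ineq[of z "of_real a"] by (intro power_mono) auto
  also have "\<dots> \<le> 2 * (norm z)\<^sup>2 + 2 * a\<^sup>2"
    using zero_le_power2[of "norm z - \<bar>a\<bar>"] by (simp add: power2_sum power2_diff)
  finally have "1 + (norm (z + of_real a))\<^sup>2 \<le> 1 + (2 * (norm z)\<^sup>2 + 2 * a\<^sup>2)" by simp
  also have "\<dots> \<le> (2 + 2 * a\<^sup>2) * (1 + (norm z)\<^sup>2)" by (simp add: algebra_simps)
  finally show ?thesis
    using assms by (simp add: uhp_size_def uhp_iff divide_right_mono)
qed

lemma moderate_growthI:
  assumes "g holomorphic_on upper_half_plane"
    and "\<And>z. z \<in> upper_half_plane \<Longrightarrow> norm (g z) \<le> C * uhp_size z ^ N"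
  shows "moderate_growth g"
  using assms unfolding moderate_growth_def by blast

lemma moderate_growthE:
  assumes "moderate_growth g"
  obtains C N where "C \<ge> 0" "\<And>z. z \<in> upper_half_plane \<Longrightarrow> norm (g z) \<le> C * uhp_size z ^ N"
proof -
  from assms obtain C N where C: "\<And>z. z \<in> upper_half_plane \<Longrightarrow> norm (g z) \<le> C * uhp_size z ^ N"
    unfolding moderate_growth_def by blast
  have "norm (g z) \<le> \<bar>C\<bar> * uhp_size z ^ N" if "z \<in> upper_half_plane" for z
  proof -
    have "C * uhp_size z ^ N \<le> \<bar>C\<bar> * uhp_size z ^ N"
      using uhp_size_ge_1[OF that] by (intro mult_right_mono) auto
    with C[OF that] show ?thesis by linarith
  qed
  then show ?thesis using that[of "\<bar>C\<bar>" N] by auto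
qed

lemma moderate_growth_holomorphic: "moderate_growth g \<Longrightarrow> g holomorphic_on upper_half_plane"
  by (simp add: moderate_growth_def)

lemma moderate_growth_const: "moderate_growth (\<lambda>_. a)"
  by (rule moderate_growthI[of _ "norm a" 0]) auto

lemma moderate_growth_id: "moderate_growth (\<lambda>z. z)"
  by (rule moderate_growthI[of _ 1 1]) (auto intro: uhp_size_ge_norm holomorphic_intros)

lemma moderate_growth_add:
  assumes "moderate_growth g" "moderate_growth h"
  shows "moderate_growth (\<lambda>z. g z + h z)"
proof -
  obtain C N where C: "C \<ge> 0" "\<And>z. z \<in> upper_half_plane \<Longrightarrow> norm (g z) \<le> C * uhp_size z ^ N"
    using moderate_growthE[OF assms(1)] by metis
  obtain D M where D: "D \<ge> 0" "\<And>z. z \<in> upper_half_plane \<Longrightarrow> norm (h z) \<le> D * uhp_size z ^ M"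
    using moderate_growthE[OF assms(2)] by metis
  show ?thesis
  proof (rule moderate_growthI[of _ "C + D" "max N M"])
    fix z assume z: "z \<in> upper_half_plane"
    have "C * uhp_size z ^ N \<le> C * uhp_size z ^ max N M" "D * uhp_size z ^ M \<le> D * uhp_size z ^ max N M"
      using C(1) D(1) uhp_size_ge_1[OF z] by (auto intro!: mult_left_mono power_increasing)
    then show "norm (g z + h z) \<le> (C + D) * uhp_size z ^ max N M"
      using C(2)[OF z] D(2)[OF z] norm_triangle_ineq[of "g z" "h z"] by (simp add: distrib_right)
  qed (use assms in \<open>auto intro: holomorphic_intros moderate_growth_holomorphic\<close>)
qed

lemma moderate_growth_mult:
  assumes "moderate_growth g" "moderate_growth h"
  shows "moderate_growth (\<lambda>z. g z * h z)"
proof -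
  obtain C N where C: "C \<ge> 0" "\<And>z. z \<in> upper_half_plane \<Longrightarrow> norm (g z) \<le> C * uhp_size z ^ N"
    using moderate_growthE[OF assms(1)] by metis
  obtain D M where D: "D \<ge> 0" "\<And>z. z \<in> upper_half_plane \<Longrightarrow> norm (h z) \<le> D * uhp_size z ^ M"
    using moderate_growthE[OF assms(2)] by metis
  show ?thesis
  proof (rule moderate_growthI[of _ "C * D" "N + M"])
    fix z assume z: "z \<in> upper_half_plane"
    have "norm (g z) * norm (h z) \<le> (C * uhp_size z ^ N) * (D * uhp_size z ^ M)"
      using C D z uhp_size_ge_1[OF z] by (intro mult_mono) auto
    then show "norm (g z * h z) \<le> C * D * uhp_size z ^ (N + M)"
      by (simp add: norm_mult power_add mult_ac)
  qed (use assms in \<open>auto intro: holomorphic_intros moderate_growth_holomorphic\<close>)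
qed

lemma moderate_growth_power: "moderate_growth g \<Longrightarrow> moderate_growth (\<lambda>z. g z ^ n)"
  by (induction n) (auto intro: moderate_growth_const moderate_growth_mult)

lemma moderate_growth_sum:
  "(\<And>i. i \<in> A \<Longrightarrow> moderate_growth (g i)) \<Longrightarrow> moderate_growth (\<lambda>z. \<Sum>i\<in>A. g i z)"
  by (induction A rule: infinite_finite_induct) (auto intro: moderate_growth_const moderate_growth_add)

lemma moderate_growth_uminus: "moderate_growth g \<Longrightarrow> moderate_growth (\<lambda>z. - g z)"
  using moderate_growth_mult[OF moderate_growth_const[of "- 1"]] by simp

lemma moderate_growth_diff:
  "moderate_growth g \<Longrightarrow> moderate_growth h \<Longrightarrow> moderate_growth (\<lambda>z. g z - h z)"
  using moderate_growth_add[OF _ moderate_growth_uminus] by fastforce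

lemma moderate_growth_inverse: "moderate_growth (\<lambda>z. 1 / z)"
proof (rule moderate_growthI[of _ 1 1])
  fix z assume z: "z \<in> upper_half_plane"
  have "1 / norm z \<le> 1 / Im z"
    using z abs_Im_le_cmod[of z] by (intro divide_left_mono) (auto simp: uhp_iff uhp_nonzero)
  with uhp_size_ge_inverse_Im[OF z] show "norm (1 / z) \<le> 1 * uhp_size z ^ 1"
    by (simp add: norm_divide)
qed (auto intro!: holomorphic_intros dest: uhp_nonzero)

lemma moderate_growth_translate:
  assumes "moderate_growth g"
  shows "moderate_growth (\<lambda>z. g (z + of_real a))"
proof -
  obtain C N where C: "C \<ge> 0" "\<And>z. z \<in> upper_half_plane \<Longrightarrow> norm (g z) \<le> C * uhp_size z ^ N"
    using moderate_growthE[OF assms] by metis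
  show ?thesis
  proof (rule moderate_growthI[of _ "C * (2 + 2 * a\<^sup>2) ^ N" N])
    have "g \<circ> (\<lambda>z. z + of_real a) holomorphic_on upper_half_plane"
      by (rule holomorphic_on_compose_gen[of _ _ _ upper_half_plane])
         (auto intro!: holomorphic_intros uhp_add_real simp: moderate_growth_holomorphic[OF assms])
    then show "(\<lambda>z. g (z + of_real a)) holomorphic_on upper_half_plane" by (simp add: o_def)
    fix z assume z: "z \<in> upper_half_plane"
    have "norm (g (z + of_real a)) \<le> C * uhp_size (z + of_real a) ^ N"
      using C(2) uhp_add_real[OF z] by blast
    also have "\<dots> \<le> C * ((2 + 2 * a\<^sup>2) * uhp_size z) ^ N"
      using C(1) uhp_size_add_real[OF z] uhp_size_ge_1[OF uhp_add_real[OF z, of a]]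
      by (intro mult_left_mono power_mono) auto
    finally show "norm (g (z + of_real a)) \<le> C * (2 + 2 * a\<^sup>2) ^ N * uhp_size z ^ N"
      by (simp add: power_mult_distrib mult_ac)
  qed
qed

lemma moderate_growth_minus_inverse:
  assumes "moderate_growth g"
  shows "moderate_growth (\<lambda>z. g (- 1 / z))"
proof -
  obtain C N where C: "C \<ge> 0" "\<And>z. z \<in> upper_half_plane \<Longrightarrow> norm (g z) \<le> C * uhp_size z ^ N"
    using moderate_growthE[OF assms] by metis
  show ?thesis
  proof (rule moderate_growthI[of _ C N])
    have "g \<circ> (\<lambda>z. - 1 / z) holomorphic_on upper_half_plane"
      by (rule holomorphic_on_compose_gen[of _ _ _ upper_half_plane])
         (auto intro!: holomorphic_intros uhp_minus_inverse simp: moderate_growth_holomorphic[OF assms]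
           simp del: divide_minus_left dest: uhp_nonzero)
    then show "(\<lambda>z. g (- 1 / z)) holomorphic_on upper_half_plane" by (simp add: o_def)
    fix z assume z: "z \<in> upper_half_plane"
    show "norm (g (- 1 / z)) \<le> C * uhp_size z ^ N"
      using C(2)[OF uhp_minus_inverse[OF z]] uhp_size_minus_inverse[OF z] by simp
  qed
qed

lemma moderate_growth_cong:
  assumes "moderate_growth g" "\<And>z. z \<in> upper_half_plane \<Longrightarrow> g z = h z"
  shows "moderate_growth h"
  using assms holomorphic_cong[of upper_half_plane upper_half_plane g h]
  by (auto simp: moderate_growth_def)

lemmas moderate_growth_intros =
  moderate_growth_const moderate_growth_id moderate_growth_add moderate_growth_mult
  moderate_growth_power moderate_growth_sum moderate_growth_uminus moderate_growth_diff
  moderate_growth_inverse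

section \<open>Antiderivatives of f g that vanish at the cusp at infinity\<close>

locale cusp_form =
  fixes k :: nat and f :: "complex \<Rightarrow> complex"
  assumes cusp: "f \<in> cusp_forms k" and even_k: "even k" and k_ge_2: "k \<ge> 2"
begin

lemma f_holomorphic: "f holomorphic_on upper_half_plane"
  using cusp by (simp add: cusp_forms_def)

lemma f_modular:
  assumes "a * d - b * c = 1" "z \<in> upper_half_plane"
  shows "f ((of_int a * z + of_int b) / (of_int c * z + of_int d)) = (of_int c * z + of_int d) ^ k * f z"
  using cusp assms by (simp add: cusp_forms_def)

lemma f_add_1: "z \<in> upper_half_plane \<Longrightarrow> f (z + 1) = f z"
  using f_modular[of 1 1 1 0 z] by simp

lemma f_diff_1: "z \<in> upper_half_plane \<Longrightarrow> f (z - 1) = f z"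
  using f_modular[of 1 1 "- 1" 0 z] by simp

lemma f_minus_inverse: "z \<in> upper_half_plane \<Longrightarrow> f (- 1 / z) = z ^ k * f z"
  using f_modular[of 0 0 "- 1" 1 z] by simp

text \<open>The vanishing constant term lets one factor \<open>q\<close> be taken out of the series,
  uniformly for \<open>Im z \<ge> 1\<close>.\<close>

lemma f_decay: "\<exists>C\<ge>0. \<forall>z. Im z \<ge> 1 \<longrightarrow> norm (f z) \<le> C * exp (- 2 * pi * Im z)"
proof -
  obtain a where a: "a 0 = 0"
    "\<And>z. z \<in> upper_half_plane \<Longrightarrow> (\<lambda>n. a n * exp (2 * of_real pi * \<i> * z) ^ n) sums f z"
    using cusp by (auto simp: cusp_forms_def)
  define r where "r = exp (- 2 * pi)"
  have r: "r > 0" by (simp add: r_def)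
  have nq: "norm (exp (2 * of_real pi * \<i> * z)) = exp (- 2 * pi * Im z)" for z
    by (simp add: norm_exp_eq_Re)
  \<comment> \<open>Plain convergence at \<open>\<i> / 2\<close>, which belongs to a larger radius,
    gives absolute convergence at radius \<open>r\<close>.\<close>
  have "summable (\<lambda>n. norm (a n * of_real r ^ n))"
  proof (rule powser_insidea)
    show "summable (\<lambda>n. a n * exp (2 * of_real pi * \<i> * (\<i> / 2)) ^ n)"
      by (rule sums_summable[OF a(2)]) (simp add: uhp_iff)
    show "norm (complex_of_real r) < norm (exp (2 * of_real pi * \<i> * (\<i> / 2)))"
      unfolding nq using r by (simp add: r_def)
  qed
  then have sr: "summable (\<lambda>n. norm (a n) * r ^ n)"
    using r by (simp add: norm_mult norm_power)
  define C where "C = (\<Sum>n. norm (a n) * r ^ n) / r"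
  have "C \<ge> 0" unfolding C_def using r sr by (intro divide_nonneg_pos suminf_nonneg) auto
  moreover have "norm (f z) \<le> C * exp (- 2 * pi * Im z)" if z: "Im z \<ge> 1" for z
  proof -
    define q where "q = exp (2 * of_real pi * \<i> * z)"
    have q: "norm q = exp (- 2 * pi * Im z)" by (simp add: q_def nq)
    have qr: "norm q \<le> r" unfolding q r_def using z by simp
    have le: "norm (a n * q ^ n) \<le> norm q / r * (norm (a n) * r ^ n)" for n
    proof (cases n)
      case 0 then show ?thesis by (simp add: a(1))
    next
      case (Suc m)
      have "norm q ^ m \<le> r ^ m" using qr by (intro power_mono) auto
      then have "norm (a n) * (norm q * norm q ^ m) \<le> norm (a n) * (norm q * r ^ m)"
        by (intro mult_left_mono) auto
      then show ?thesis using r Suc by (simp add: norm_mult norm_power field_simps)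
    qed
    have s2: "summable (\<lambda>n. norm q / r * (norm (a n) * r ^ n))"
      by (intro summable_mult sr)
    have s1: "summable (\<lambda>n. norm (a n * q ^ n))"
      by (rule summable_comparison_test[OF _ s2]) (use le in auto)
    have "f z = (\<Sum>n. a n * q ^ n)"
      using a(2)[of z] z by (simp add: uhp_iff q_def sums_iff)
    then have "norm (f z) \<le> (\<Sum>n. norm (a n * q ^ n))"
      using summable_norm[OF s1] by simp
    also have "\<dots> \<le> (\<Sum>n. norm q / r * (norm (a n) * r ^ n))"
      by (rule suminf_le[OF le s1 s2])
    also have "\<dots> = norm q / r * (\<Sum>n. norm (a n) * r ^ n)"
      by (rule suminf_mult[OF sr])
    finally show ?thesis by (simp add: C_def q mult.commute)
  qed
  ultimately show ?thesis by blast
qed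

text \<open>On a strip above height 1, \<open>uhp_size z\<close> is at most
  \<open>(2 + X\<^sup>2) * Im z\<close>, so moderate growth costs one factor
  \<open>exp (Im z)\<close>, while \<open>f\<close> supplies
  \<open>exp (- 2 * pi * Im z)\<close>.\<close>

lemma product_decay:
  assumes "moderate_growth g" "X \<ge> 0"
  shows "\<exists>D\<ge>0. \<forall>z. Im z \<ge> 1 \<longrightarrow> \<bar>Re z\<bar> \<le> X \<longrightarrow> norm (f z * g z) \<le> D * exp (- Im z)"
proof -
  obtain C where C: "C \<ge> 0" "\<And>z. Im z \<ge> 1 \<Longrightarrow> norm (f z) \<le> C * exp (- 2 * pi * Im z)"
    using f_decay by blast
  obtain B N where B: "B \<ge> 0" "\<And>z. z \<in> upper_half_plane \<Longrightarrow> norm (g z) \<le> B * uhp_size z ^ N"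
    using moderate_growthE[OF assms(1)] by metis
  define D where "D = C * (B * ((2 + X\<^sup>2) ^ N * fact N))"
  have "D \<ge> 0" using C(1) B(1) by (simp add: D_def)
  moreover have "norm (f z * g z) \<le> D * exp (- Im z)" if z: "Im z \<ge> 1" "\<bar>Re z\<bar> \<le> X" for z
  proof -
    define y where "y = Im z"
    have y: "y \<ge> 1" using z by (simp add: y_def)
    have "(Re z)\<^sup>2 \<le> X\<^sup>2" using z(2) assms(2) by (simp add: abs_le_square_iff[symmetric])
    moreover have yy: "1 \<le> y * y" using mult_mono[OF y y] y by simp
    then have "X\<^sup>2 * 1 \<le> X\<^sup>2 * (y * y)" by (intro mult_left_mono) auto
    ultimately have "1 + (norm z)\<^sup>2 \<le> (2 + X\<^sup>2) * (y * y)"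
      using yy unfolding cmod_power2 y_def[symmetric] by (simp add: algebra_simps power2_eq_square)
    then have size: "uhp_size z \<le> (2 + X\<^sup>2) * y"
      using y by (simp add: uhp_size_def y_def[symmetric] pos_divide_le_eq mult_ac)
    have zu: "z \<in> upper_half_plane" using z by (simp add: uhp_iff)
    have "norm (g z) \<le> B * uhp_size z ^ N" by (rule B(2)[OF zu])
    also have "\<dots> \<le> B * ((2 + X\<^sup>2) * y) ^ N"
      using B(1) size uhp_size_ge_1[OF zu] by (intro mult_left_mono power_mono) auto
    also have "\<dots> \<le> B * ((2 + X\<^sup>2) ^ N * (fact N * exp y))"
      unfolding power_mult_distrib using B(1) power_le_fact_exp[of y N] y
      by (intro mult_left_mono) auto
    finally have "norm (f z) * norm (g z)
        \<le> (C * exp (- 2 * pi * y)) * (B * ((2 + X\<^sup>2) ^ N * (fact N * exp y)))"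
      using C z y_def by (intro mult_mono) auto
    also have "\<dots> = D * exp (- 2 * pi * y + y)"
      unfolding exp_add D_def by (simp only: mult_ac)
    also have "\<dots> \<le> D * exp (- y)"
    proof -
      have "2 * y \<le> 2 * pi * y" using y pi_ge_two by (intro mult_right_mono) auto
      then show ?thesis using \<open>D \<ge> 0\<close> by (intro mult_left_mono) auto
    qed
    finally show ?thesis by (simp add: norm_mult y_def)
  qed
  ultimately show ?thesis by blast
qed

text \<open>This plays the role of the contour integral of \<open>f g\<close> from the cusp at
  infinity. A derivative and a limit replace improper contour integrals; the limit is required on
  every vertical line so that translates are again primitives of this kind.\<close>

definition cusp_primitive :: "(complex \<Rightarrow> complex) \<Rightarrow> (complex \<Rightarrow> complex) \<Rightarrow> bool" where
  "cusp_primitive g V \<longleftrightarrow>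
     (\<forall>z\<in>upper_half_plane. (V has_field_derivative f z * g z) (at z)) \<and>
     (\<forall>x. ((\<lambda>y. V (Complex x y)) \<longlongrightarrow> 0) at_top)"

text \<open>The derivative is exponentially small in the height, so the values along the imaginary
  axis satisfy the Cauchy criterion.\<close>

lemma vertical_limit:
  assumes g: "moderate_growth g"
    and V: "\<And>z. z \<in> upper_half_plane \<Longrightarrow> (V has_field_derivative f z * g z) (at z)"
  shows "\<exists>L. ((\<lambda>y. V (Complex 0 y)) \<longlongrightarrow> L) at_top"
proof -
  obtain D where D: "D \<ge> 0"
    "\<And>z. Im z \<ge> 1 \<Longrightarrow> \<bar>Re z\<bar> \<le> 0 \<Longrightarrow> norm (f z * g z) \<le> D * exp (- Im z)"
    using product_decay[OF g, of 0] by auto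
  define \<phi> where "\<phi> = (\<lambda>y. V (Complex 0 y))"
  have der: "(\<phi> has_vector_derivative \<i> * (f (Complex 0 y) * g (Complex 0 y))) (at y)" if "y > 0" for y
  proof -
    have "((\<lambda>y. Complex 0 y) has_vector_derivative \<i>) (at y)"
    proof -
      have "((\<lambda>y. \<i> * of_real y) has_vector_derivative \<i> * 1) (at y)"
        by (intro derivative_eq_intros has_vector_derivative_mult_right) (auto intro: has_vector_derivative_of_real derivative_eq_intros)
      then show ?thesis by (simp add: Complex_eq)
    qed
    from field_vector_diff_chain_at[OF this V[of "Complex 0 y"]] that
    show ?thesis by (simp add: \<phi>_def o_def uhp_iff)
  qed
  have bound: "norm (\<phi> v - \<phi> u) \<le> D * exp (- u) - D * exp (- v)" if uv: "1 \<le> u" "u < v" for u v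
  proof -
    have "norm (\<phi> v - \<phi> u) \<le> - D * exp (- v) - (- D * exp (- u))"
    proof (rule differentiable_bound_general[OF uv(2)])
      show "continuous_on {u..v} \<phi>"
        by (rule continuous_at_imp_continuous_on)
           (use uv in \<open>auto intro!: has_vector_derivative_continuous der\<close>)
      show "continuous_on {u..v} (\<lambda>x. - D * exp (- x))" by (intro continuous_intros)
      fix x assume x: "u < x" "x < v"
      show "(\<phi> has_vector_derivative \<i> * (f (Complex 0 x) * g (Complex 0 x))) (at x)"
        using der x uv by simp
      show "((\<lambda>x. - D * exp (- x)) has_vector_derivative D * exp (- x)) (at x)"
        unfolding has_real_derivative_iff_has_vector_derivative[symmetric]
        by (auto intro!: derivative_eq_intros)
      show "norm (\<i> * (f (Complex 0 x) * g (Complex 0 x))) \<le> D * exp (- x)"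
        using D(2)[of "Complex 0 x"] x uv by (simp add: norm_mult)
    qed
    then show ?thesis by simp
  qed
  have bound': "norm (\<phi> v - \<phi> u) \<le> D * exp (- u)" if "1 \<le> u" "u \<le> v" for u v
    using bound[of u v] that D(1) by (cases "u = v") (auto simp: less_le intro: order_trans)
  have e0: "((\<lambda>y::real. D * exp (- y)) \<longlongrightarrow> 0) at_top"
    by (intro tendsto_mult_right_zero filterlim_compose[OF exp_at_bot] filterlim_uminus_at_bot_at_top)
  have "convergent (\<lambda>n. \<phi> (real n))"
  proof (rule Cauchy_convergent, rule metric_CauchyI)
    fix e :: real assume "e > 0"
    have "eventually (\<lambda>y. D * exp (- y) < e / 2) at_top"
      by (rule order_tendstoD(2)[OF e0]) (use \<open>e > 0\<close> in simp)
    then obtain Y where Y: "\<And>y. y \<ge> Y \<Longrightarrow> D * exp (- y) < e / 2"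
      by (auto simp: eventually_at_top_linorder)
    define M where "M = nat \<lceil>max 1 Y\<rceil>"
    have M: "real M \<ge> 1" "real M \<ge> Y" unfolding M_def by linarith+
    show "\<exists>M. \<forall>m\<ge>M. \<forall>n\<ge>M. dist (\<phi> (real m)) (\<phi> (real n)) < e"
    proof (intro exI[of _ M] allI impI)
      fix m n assume "m \<ge> M" "n \<ge> M"
      then have "norm (\<phi> (real m) - \<phi> (real M)) < e / 2" "norm (\<phi> (real n) - \<phi> (real M)) < e / 2"
        using bound'[of "real M"] Y[of "real M"] M by (meson le_less_trans of_nat_le_iff)+
      then show "dist (\<phi> (real m)) (\<phi> (real n)) < e"
        by (metis dist_norm dist_triangle_half_l)
    qed
  qed
  then obtain L where L: "(\<lambda>n. \<phi> (real n)) \<longlonglongrightarrow> L" by (auto simp: convergent_def)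
  have "norm (\<phi> u - L) \<le> D * exp (- u)" if "u \<ge> 1" for u
  proof (rule tendsto_upperbound)
    show "(\<lambda>n. norm (\<phi> u - \<phi> (real n))) \<longlonglongrightarrow> norm (\<phi> u - L)"
      by (intro tendsto_intros L)
    show "eventually (\<lambda>n. norm (\<phi> u - \<phi> (real n)) \<le> D * exp (- u)) sequentially"
      using eventually_ge_at_top[of "nat \<lceil>u\<rceil>"]
    proof eventually_elim
      case (elim n)
      then have "u \<le> real n" by linarith
      with bound'[OF that this] show ?case by (simp add: norm_minus_commute)
    qed
  qed simp
  then have "eventually (\<lambda>u. norm (\<phi> u - L) \<le> D * exp (- u)) at_top"
    unfolding eventually_at_top_linorder by blast
  then have "((\<lambda>y. \<phi> y - L) \<longlongrightarrow> 0) at_top"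
    by (rule Lim_null_comparison[OF _ e0])
  then show ?thesis unfolding \<phi>_def by (auto simp: LIM_zero_iff)
qed

text \<open>A horizontal segment of fixed length carries an exponentially small integrand, so the
  constant found on the imaginary axis normalises every vertical line.\<close>

lemma horizontal_difference:
  assumes g: "moderate_growth g"
    and V: "\<And>z. z \<in> upper_half_plane \<Longrightarrow> (V has_field_derivative f z * g z) (at z)"
  shows "((\<lambda>y. V (Complex x y) - V (Complex 0 y)) \<longlongrightarrow> 0) at_top"
proof -
  obtain D where D: "D \<ge> 0"
    "\<And>z. Im z \<ge> 1 \<Longrightarrow> \<bar>Re z\<bar> \<le> \<bar>x\<bar> \<Longrightarrow> norm (f z * g z) \<le> D * exp (- Im z)"
    using product_decay[OF g, of "\<bar>x\<bar>"] by auto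
  have "norm (V (Complex x y) - V (Complex 0 y)) \<le> \<bar>x\<bar> * D * exp (- y)" if "y \<ge> 1" for y
  proof -
    have "norm (V (Complex x y) - V (Complex 0 y))
       \<le> (D * exp (- y)) * norm (Complex x y - Complex 0 y)"
    proof (rule field_differentiable_bound[of "closed_segment (Complex 0 y) (Complex x y)" V "\<lambda>z. f z * g z"])
      fix z assume "z \<in> closed_segment (Complex 0 y) (Complex x y)"
      then obtain t where t: "0 \<le> t" "t \<le> 1" "z = (1 - t) *\<^sub>R Complex 0 y + t *\<^sub>R Complex x y"
        by (auto simp: closed_segment_def)
      have re: "Re z = t * x" and im: "Im z = y" unfolding t(3) by simp_all (simp add: algebra_simps)
      have "\<bar>t\<bar> * \<bar>x\<bar> \<le> 1 * \<bar>x\<bar>" by (rule mult_right_mono) (use t in auto)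
      then have "\<bar>Re z\<bar> \<le> \<bar>x\<bar>" by (simp add: re abs_mult)
      from D(2)[OF _ this] show "norm (f z * g z) \<le> D * exp (- y)"
        unfolding im using that by simp
      show "(V has_field_derivative f z * g z) (at z within closed_segment (Complex 0 y) (Complex x y))"
        by (rule has_field_derivative_at_within[OF V]) (use im that in \<open>simp add: uhp_iff\<close>)
    qed (rule convex_closed_segment, rule ends_in_segment, rule ends_in_segment)
    also have "norm (Complex x y - Complex 0 y) = \<bar>x\<bar>" by (simp add: cmod_def)
    finally show ?thesis by (simp add: mult_ac)
  qed
  then have "eventually (\<lambda>y. norm (V (Complex x y) - V (Complex 0 y)) \<le> \<bar>x\<bar> * D * exp (- y)) at_top"
    unfolding eventually_at_top_linorder by blast
  moreover have "((\<lambda>y::real. \<bar>x\<bar> * D * exp (- y)) \<longlongrightarrow> 0) at_top"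
    by (intro tendsto_mult_right_zero filterlim_compose[OF exp_at_bot] filterlim_uminus_at_bot_at_top)
  ultimately show ?thesis by (rule Lim_null_comparison)
qed

lemma cusp_primitive_exists:
  assumes g: "moderate_growth g"
  shows "\<exists>V. cusp_primitive g V"
proof -
  have "(\<lambda>z. f z * g z) holomorphic_on upper_half_plane"
    by (intro holomorphic_intros f_holomorphic moderate_growth_holomorphic g)
  then obtain V where V: "\<And>z. z \<in> upper_half_plane \<Longrightarrow>
      (V has_field_derivative f z * g z) (at z within upper_half_plane)"
    using holomorphic_convex_primitive'[OF convex_uhp open_uhp] by metis
  then have V': "(V has_field_derivative f z * g z) (at z)" if "z \<in> upper_half_plane" for z
    using V[OF that] at_within_open[OF that open_uhp] by simp
  obtain L where L: "((\<lambda>y. V (Complex 0 y)) \<longlongrightarrow> L) at_top"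
    using vertical_limit[OF g V'] by blast
  have "((\<lambda>y. (V (Complex x y) - V (Complex 0 y)) + (V (Complex 0 y) - L)) \<longlongrightarrow> 0 + (L - L)) at_top" for x
    by (intro tendsto_add tendsto_diff tendsto_const L horizontal_difference[OF g V'])
  then have "cusp_primitive g (\<lambda>z. V z - L)"
    unfolding cusp_primitive_def using V' by (auto intro!: derivative_eq_intros)
  then show ?thesis by blast
qed

lemma uhp_constant:
  assumes "\<And>z. z \<in> upper_half_plane \<Longrightarrow> (W has_field_derivative 0) (at z)"
    and "z \<in> upper_half_plane" "w \<in> upper_half_plane"
  shows "W z = W w"
proof -
  have "\<exists>c. \<forall>z\<in>upper_half_plane. W z = c"
    by (rule has_field_derivative_zero_constant[OF convex_uhp])
       (use assms(1) in \<open>auto intro: has_field_derivative_at_within\<close>)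
  then show ?thesis using assms(2,3) by metis
qed

lemma cusp_primitive_unique:
  assumes "cusp_primitive g V" "cusp_primitive g W" "z \<in> upper_half_plane"
  shows "V z = W z"
proof -
  have "((\<lambda>y. V (Complex 0 y) - W (Complex 0 y)) \<longlongrightarrow> 0 - 0) at_top"
    using assms by (intro tendsto_diff) (auto simp: cusp_primitive_def)
  moreover have "eventually (\<lambda>y. V (Complex 0 y) - W (Complex 0 y) = V z - W z) at_top"
    using eventually_gt_at_top[of 0]
  proof eventually_elim
    case (elim y)
    show ?case
      by (rule uhp_constant[of "\<lambda>z. V z - W z"])
         (use assms elim in \<open>auto simp: cusp_primitive_def uhp_iff intro!: derivative_eq_intros\<close>)
  qed
  ultimately have "((\<lambda>y::real. V z - W z) \<longlongrightarrow> 0 - 0) at_top"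
    by (rule Lim_transform_eventually)
  then show ?thesis by (simp add: tendsto_const_iff)
qed

definition prim :: "(complex \<Rightarrow> complex) \<Rightarrow> complex \<Rightarrow> complex" where
  "prim g = (SOME V. cusp_primitive g V)"

lemma prim: "moderate_growth g \<Longrightarrow> cusp_primitive g (prim g)"
  unfolding prim_def by (rule someI_ex[OF cusp_primitive_exists])

lemma prim_deriv:
  "moderate_growth g \<Longrightarrow> z \<in> upper_half_plane \<Longrightarrow> (prim g has_field_derivative f z * g z) (at z)"
  using prim by (auto simp: cusp_primitive_def)

lemma prim_limit: "moderate_growth g \<Longrightarrow> ((\<lambda>y. prim g (Complex x y)) \<longlongrightarrow> 0) at_top"
  using prim by (auto simp: cusp_primitive_def)

lemma prim_eqI:
  "moderate_growth g \<Longrightarrow> cusp_primitive g V \<Longrightarrow> z \<in> upper_half_plane \<Longrightarrow> prim g z = V z"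
  using cusp_primitive_unique prim by blast

lemma prim_cong:
  assumes "moderate_growth g" "\<And>z. z \<in> upper_half_plane \<Longrightarrow> g z = h z" "z \<in> upper_half_plane"
  shows "prim g z = prim h z"
proof -
  have "moderate_growth h" using assms moderate_growth_cong by blast
  from prim[OF this] have "cusp_primitive g (prim h)"
    using assms(2) by (auto simp: cusp_primitive_def)
  then show ?thesis using prim_eqI assms by blast
qed

lemma prim_add:
  assumes "moderate_growth g" "moderate_growth h" "z \<in> upper_half_plane"
  shows "prim (\<lambda>z. g z + h z) z = prim g z + prim h z"
proof (rule prim_eqI[OF _ _ assms(3)])
  have "((\<lambda>y. prim g (Complex x y) + prim h (Complex x y)) \<longlongrightarrow> 0 + 0) at_top" for x
    by (intro tendsto_add prim_limit assms)
  then show "cusp_primitive (\<lambda>z. g z + h z) (\<lambda>z. prim g z + prim h z)"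
    unfolding cusp_primitive_def
    by (auto intro!: derivative_eq_intros prim_deriv assms simp: algebra_simps)
qed (intro moderate_growth_intros assms)

lemma prim_cmult:
  assumes "moderate_growth g" "z \<in> upper_half_plane"
  shows "prim (\<lambda>z. a * g z) z = a * prim g z"
proof (rule prim_eqI[OF _ _ assms(2)])
  have "((\<lambda>y. a * prim g (Complex x y)) \<longlongrightarrow> a * 0) at_top" for x
    by (intro tendsto_mult tendsto_const prim_limit assms)
  then show "cusp_primitive (\<lambda>z. a * g z) (\<lambda>z. a * prim g z)"
    unfolding cusp_primitive_def
    by (auto intro!: derivative_eq_intros prim_deriv assms simp: algebra_simps)
qed (intro moderate_growth_intros assms)

lemma prim_translate:
  assumes "moderate_growth g" "a = 1 \<or> a = - 1" "z \<in> upper_half_plane"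
  shows "prim (\<lambda>z. g (z + of_real a)) z = prim g (z + of_real a)"
proof (rule prim_eqI[OF _ _ assms(3)])
  have fa: "f (z + of_real a) = f z" if "z \<in> upper_half_plane" for z
    using assms(2) f_add_1[OF that] f_diff_1[OF that] by auto
  have "((\<lambda>z. prim g (z + of_real a)) has_field_derivative f z * g (z + of_real a)) (at z)"
    if z: "z \<in> upper_half_plane" for z
    using prim_deriv[OF assms(1) uhp_add_real[OF z, of a]] fa[OF z] by (simp add: DERIV_shift)
  moreover have "((\<lambda>y. prim g (Complex x y + of_real a)) \<longlongrightarrow> 0) at_top" for x
  proof -
    have "Complex x y + of_real a = Complex (x + a) y" for y by (simp add: complex_eq_iff)
    then show ?thesis using prim_limit[OF assms(1), of "x + a"] by simp
  qed
  ultimately show "cusp_primitive (\<lambda>z. g (z + of_real a)) (\<lambda>z. prim g (z + of_real a))"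
    by (auto simp: cusp_primitive_def)
qed (intro moderate_growth_translate assms)

section \<open>The action of the inversion and the period functional\<close>

definition slash :: "(complex \<Rightarrow> complex) \<Rightarrow> complex \<Rightarrow> complex" where
  "slash g z = z ^ (k - 2) * g (- 1 / z)"

text \<open>This is \<open>\<integral> f(z) g(z) dz\<close> along the imaginary axis from \<open>0\<close> to \<open>\<i>\<infinity>\<close>.\<close>
definition period :: "(complex \<Rightarrow> complex) \<Rightarrow> complex" where
  "period g = prim (slash g) \<i> - prim g \<i>"

lemma moderate_growth_slash: "moderate_growth g \<Longrightarrow> moderate_growth (slash g)"
  unfolding slash_def[abs_def] by (intro moderate_growth_intros moderate_growth_minus_inverse)

text \<open>Modularity of \<open>f\<close> and the derivative of \<open>- 1 / z\<close> make the
  derivatives of both sides agree; the constant is read off at \<open>\<i>\<close>, the fixed point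
  of the inversion.\<close>

lemma prim_minus_inverse:
  assumes g: "moderate_growth g" and z: "z \<in> upper_half_plane"
  shows "prim g (- 1 / z) = prim (slash g) z - period g"
proof -
  define W where "W = (\<lambda>z. prim g (- 1 / z) - prim (slash g) z)"
  have "(W has_field_derivative 0) (at z)" if z: "z \<in> upper_half_plane" for z
  proof -
    have z0: "z \<noteq> 0" using z by (rule uhp_nonzero)
    have "((\<lambda>z. - 1 / z) has_field_derivative 1 / z\<^sup>2) (at z)"
      using z0 by (auto intro!: derivative_eq_intros simp: power2_eq_square)
    from DERIV_chain2[OF prim_deriv[OF g uhp_minus_inverse[OF z]] this]
    have "((\<lambda>z. prim g (- 1 / z)) has_field_derivative f (- 1 / z) * g (- 1 / z) * (1 / z\<^sup>2)) (at z)" .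
    moreover have "f (- 1 / z) * g (- 1 / z) * (1 / z\<^sup>2) = f z * slash g z"
    proof -
      have "k = (k - 2) + 2" using k_ge_2 by simp
      then have "z ^ k = z ^ (k - 2) * z\<^sup>2" by (metis power_add)
      then show ?thesis unfolding f_minus_inverse[OF z] slash_def using z0 by (simp add: field_simps)
    qed
    ultimately have "(W has_field_derivative f z * slash g z - f z * slash g z) (at z)"
      unfolding W_def by (intro DERIV_diff prim_deriv moderate_growth_slash g z) simp
    then show ?thesis by simp
  qed
  then have "W z = W \<i>" by (rule uhp_constant) (use z in \<open>auto simp: uhp_iff\<close>)
  then show ?thesis by (simp add: W_def period_def algebra_simps)
qed

lemma period_cong:
  assumes "moderate_growth g" "\<And>z. z \<in> upper_half_plane \<Longrightarrow> g z = h z"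
  shows "period g = period h"
proof -
  have "slash g z = slash h z" if "z \<in> upper_half_plane" for z
    using assms(2)[OF uhp_minus_inverse[OF that]] by (simp add: slash_def)
  then show ?thesis
    unfolding period_def using prim_cong[of g h \<i>] prim_cong[of "slash g" "slash h" \<i>] assms
    by (simp add: moderate_growth_slash uhp_iff)
qed

lemma period_add:
  assumes "moderate_growth g" "moderate_growth h"
  shows "period (\<lambda>z. g z + h z) = period g + period h"
proof -
  have "slash (\<lambda>z. g z + h z) = (\<lambda>z. slash g z + slash h z)"
    by (auto simp: slash_def algebra_simps)
  then show ?thesis
    unfolding period_def using assms by (simp add: prim_add moderate_growth_slash uhp_iff)
qed

lemma period_cmult:
  assumes "moderate_growth g"
  shows "period (\<lambda>z. a * g z) = a * period g"
proof -
  have "slash (\<lambda>z. a * g z) = (\<lambda>z. a * slash g z)"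
    by (auto simp: slash_def algebra_simps)
  then show ?thesis
    unfolding period_def using assms
    by (simp add: prim_cmult moderate_growth_slash uhp_iff right_diff_distrib)
qed

lemma period_uminus: "moderate_growth g \<Longrightarrow> period (\<lambda>z. - g z) = - period g"
  using period_cmult[of g "- 1"] by simp

lemma period_diff:
  assumes "moderate_growth g" "moderate_growth h"
  shows "period (\<lambda>z. g z - h z) = period g - period h"
  using period_add[OF assms(1) moderate_growth_uminus[OF assms(2)]] period_uminus[OF assms(2)]
  by simp

lemma period_sum:
  assumes "\<And>i. i \<in> A \<Longrightarrow> moderate_growth (g i)"
  shows "period (\<lambda>z. \<Sum>i\<in>A. g i z) = (\<Sum>i\<in>A. period (g i))"
  using assms
proof (induction A rule: infinite_finite_induct)
  case (insert i A)
  then show ?case by (simp add: period_add moderate_growth_sum)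
qed (use period_cmult[OF moderate_growth_const[of 0], of 0] in auto)

lemma slash_slash: "z \<in> upper_half_plane \<Longrightarrow> slash (slash g) z = g z"
  using even_k k_ge_2 uhp_nonzero[of z] by (simp add: slash_def power_divide uminus_power_if)

lemma period_slash:
  assumes "moderate_growth g"
  shows "period (slash g) = - period g"
proof -
  have "prim (slash (slash g)) \<i> = prim g \<i>"
    by (rule prim_cong) (auto simp: slash_slash uhp_iff intro!: moderate_growth_slash assms)
  then show ?thesis by (simp add: period_def)
qed

text \<open>The relation \<open>1 + U + U\<^sup>2 = 0\<close> for \<open>a = 1\<close>; it holds for all \<open>g\<close>, polynomial or not.\<close>
lemma period_three_term:
  assumes g: "moderate_growth g" and a: "a = 1 \<or> a = - 1"
  shows "period g = period (\<lambda>z. g (z + of_real a))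
    + period (\<lambda>z. (z + of_real a) ^ (k - 2) * g (of_real a - 1 / (z + of_real a)))"
proof -
  define gT g3 where "gT = (\<lambda>z. g (z + of_real a))"
    and "g3 = (\<lambda>z. (z + of_real a) ^ (k - 2) * g (of_real a - 1 / (z + of_real a)))"
  have gT: "moderate_growth gT" unfolding gT_def by (intro moderate_growth_translate g)
  have g3_eq: "g3 = (\<lambda>z. slash gT (z + of_real a))"
    by (auto simp: g3_def gT_def slash_def add.commute)
  have g3: "moderate_growth g3"
    unfolding g3_eq by (intro moderate_growth_translate moderate_growth_slash gT)
  have 1: "prim g (of_real a - 1 / (z + of_real a)) = prim g3 z - period gT"
    if z: "z \<in> upper_half_plane" for z
  proof -
    have za: "z + of_real a \<in> upper_half_plane" using z by (rule uhp_add_real)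
    have "prim g (of_real a - 1 / (z + of_real a)) = prim gT (- 1 / (z + of_real a))"
      unfolding gT_def prim_translate[OF g a uhp_minus_inverse[OF za]] by simp
    also have "\<dots> = prim (slash gT) (z + of_real a) - period gT"
      by (rule prim_minus_inverse[OF gT za])
    also have "prim (slash gT) (z + of_real a) = prim g3 z"
      unfolding g3_eq by (rule prim_translate[symmetric, OF moderate_growth_slash[OF gT] a z])
    finally show ?thesis .
  qed
  define z where "z = \<i> + of_real a"
  have z: "z \<in> upper_half_plane" by (simp add: z_def uhp_iff)
  have a2: "of_real a * of_real a = (1 :: complex)" using a by auto
  \<comment> \<open>For \<open>a = 1\<close> this is the relation \<open>(T S)^3 = 1\<close> of the
    modular group, as an identity of Moebius maps. It closes the cycle of the four equations
    \<open>q1\<close> to \<open>q4\<close>, in which every value of \<open>prim\<close> then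
    cancels.\<close>
  have moebius: "of_real a - 1 / (- 1 / w + of_real a) = - 1 / (w - of_real a)"
    if w: "w \<in> upper_half_plane" for w
  proof -
    have w0: "w \<noteq> 0" "w - of_real a \<noteq> 0" "w * of_real a - 1 \<noteq> 0"
      using w a by (auto simp: uhp_iff complex_eq_iff)
    have "- 1 / w + of_real a = (w * of_real a - 1) / w" using w0 by (simp add: field_simps)
    then show ?thesis using w0 a2 a by (auto simp: field_simps)
  qed
  have q1: "prim g (of_real a - 1 / (- 1 / z + of_real a)) = prim g3 (- 1 / z) - period gT"
    by (rule 1[OF uhp_minus_inverse[OF z]])
  have q2: "prim g (- 1 / (z - of_real a)) = prim (slash g) (z - of_real a) - period g"
    by (rule prim_minus_inverse[OF g]) (simp add: z_def uhp_iff)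
  have q3: "prim g3 (- 1 / z) = prim (slash g3) z - period g3"
    by (rule prim_minus_inverse[OF g3 z])
  have q4: "prim (slash g3) z = prim (slash g) (z - of_real a)"
  proof -
    have "prim (slash g3) z = prim (\<lambda>z. slash g (z + of_real (- a))) z"
    proof (rule prim_cong[OF moderate_growth_slash[OF g3] _ z])
      fix w assume w: "w \<in> upper_half_plane"
      have "w ^ (k - 2) * (- 1 / w + of_real a) ^ (k - 2) = (w * of_real a - 1) ^ (k - 2)"
      proof -
        have "w * (- 1 / w + of_real a) = w * of_real a - 1"
          using uhp_nonzero[OF w] by (simp add: field_simps)
        then show ?thesis by (simp only: power_mult_distrib[symmetric])
      qed
      also have "\<dots> = (w - of_real a) ^ (k - 2)"
      proof -
        have "even (k - 2)" using even_k by simp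
        then have "of_real a ^ (k - 2) = (1 :: complex)" using a by auto
        moreover have "w * of_real a - 1 = of_real a * (w - of_real a)"
          using a2 by (simp add: algebra_simps)
        ultimately show ?thesis by (simp add: power_mult_distrib)
      qed
      finally show "slash g3 w = slash g (w + of_real (- a))"
        unfolding slash_def g3_def mult.assoc[symmetric] moebius[OF w] by simp
    qed
    also have "\<dots> = prim (slash g) (z - of_real a)"
      using prim_translate[OF moderate_growth_slash[OF g], of "- a"] a z by auto
    finally show ?thesis .
  qed
  have "p = b + c"
    if "x = y - b" "x = s - p" "y = s' - c" "s' = s" for x y s s' p b c :: complex
    using that by algebra
  from this[OF q1[unfolded moebius[OF z]] q2 q3 q4] show ?thesis
    unfolding gT_def[symmetric] g3_def[symmetric] .
qed

end

section \<open>Periods of monomials as values of the completed L-function\<close>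

lemma exp_minus_set_integrable: "set_integrable lborel {0<..} (\<lambda>y::real. D * exp (- y))"
proof -
  have "set_integrable lborel (einterval 0 \<infinity>) (\<lambda>y::real. exp (- y))"
  proof (rule interval_integral_FTC_nonneg(1)[where F = "\<lambda>y. - exp (- y)" and A = "- 1" and B = 0])
    have "((\<lambda>y::real. - exp (- y)) \<longlongrightarrow> - exp (- 0)) (at_right 0)"
      by (intro tendsto_intros)
    then show "(((\<lambda>y::real. - exp (- y)) \<circ> real_of_ereal) \<longlongrightarrow> - 1) (at_right 0)"
      by (simp add: zero_ereal_def ereal_tendsto_simps1)
    have "((\<lambda>y::real. - exp (- y)) \<longlongrightarrow> - 0) at_top"
      by (intro tendsto_minus filterlim_compose[OF exp_at_bot] filterlim_uminus_at_bot_at_top)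
    then show "(((\<lambda>y::real. - exp (- y)) \<circ> real_of_ereal) \<longlongrightarrow> 0) (at_left \<infinity>)"
      by (simp add: ereal_tendsto_simps1)
  qed (auto intro!: derivative_eq_intros)
  moreover have "einterval 0 \<infinity> = {0<..}" by (auto simp: einterval_def)
  ultimately show ?thesis by simp
qed

context cusp_form
begin

lemma prim_vertical_deriv:
  assumes "moderate_growth g" "y > 0"
  shows "((\<lambda>y. prim g (\<i> * of_real y)) has_vector_derivative
    \<i> * (f (\<i> * of_real y) * g (\<i> * of_real y))) (at y)"
proof -
  have "((\<lambda>y. \<i> * of_real y) has_vector_derivative \<i> * 1) (at y)"
    by (intro has_vector_derivative_mult_right) (auto intro: has_vector_derivative_of_real derivative_eq_intros)
  from field_vector_diff_chain_at[OF this prim_deriv[OF assms(1)]] assms(2)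
  show ?thesis by (simp add: o_def uhp_iff)
qed

text \<open>For \<open>y < 1\<close> the inversion passes to height \<open>1 / y\<close> and changes
  the exponent \<open>i\<close> into \<open>k - i\<close>, where the decay at infinity applies. The
  factor \<open>exp 1\<close> is there because \<open>exp (- y)\<close> is only bounded below by
  \<open>exp (- 1)\<close> on this range.\<close>

lemma monomial_vertical_decay:
  assumes "i \<le> k"
  shows "\<exists>D. \<forall>y>0. norm (\<i> * (f (\<i> * of_real y) * (\<i> * of_real y) ^ i)) \<le> D * exp (- y)"
proof -
  obtain A where A: "A \<ge> 0"
    "\<And>z. Im z \<ge> 1 \<Longrightarrow> \<bar>Re z\<bar> \<le> 0 \<Longrightarrow> norm (f z * z ^ i) \<le> A * exp (- Im z)"
    using product_decay[OF moderate_growth_power[OF moderate_growth_id], of 0 i] by auto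
  obtain B where B: "B \<ge> 0"
    "\<And>z. Im z \<ge> 1 \<Longrightarrow> \<bar>Re z\<bar> \<le> 0 \<Longrightarrow> norm (f z * z ^ (k - i)) \<le> B * exp (- Im z)"
    using product_decay[OF moderate_growth_power[OF moderate_growth_id], of 0 "k - i"] by auto
  have "norm (f (\<i> * of_real y) * (\<i> * of_real y) ^ i) \<le> (A + B * exp 1) * exp (- y)" if y: "y > 0" for y
  proof (cases "y \<ge> 1")
    case True
    then have "norm (f (\<i> * of_real y) * (\<i> * of_real y) ^ i) \<le> A * exp (- y)"
      using A(2)[of "\<i> * of_real y"] by simp
    also have "\<dots> \<le> (A + B * exp 1) * exp (- y)"
      using B(1) by (intro mult_right_mono) auto
    finally show ?thesis .
  next
    case False
    define w where "w = - 1 / (\<i> * complex_of_real y)"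
    have w: "w = \<i> * of_real (1 / y)" using y by (simp add: w_def field_simps)
    have w0: "w \<noteq> 0" "w \<in> upper_half_plane" using y by (auto simp: w uhp_iff)
    have wy: "\<i> * of_real y = - 1 / w" using y by (simp add: w_def field_simps)
    have "f (\<i> * of_real y) * (\<i> * of_real y) ^ i = f w * (w ^ k * (- 1 / w) ^ i)"
      unfolding wy f_minus_inverse[OF w0(2)] by (simp only: mult_ac)
    also have "w ^ k * (- 1 / w) ^ i = (- 1) ^ i * w ^ (k - i)"
      unfolding power_divide using w0 assms by (simp add: power_diff)
    finally have "norm (f (\<i> * of_real y) * (\<i> * of_real y) ^ i) = norm (f w * w ^ (k - i))"
      by (simp add: norm_mult norm_power)
    also have "\<dots> \<le> B * exp (- (1 / y))"
      using B(2)[of w] False y by (simp add: w)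
    also have "\<dots> \<le> B * (exp 1 * exp (- y))"
      unfolding exp_add[symmetric] using B(1) False y
      by (intro mult_left_mono) (auto intro: order_trans[of _ 0])
    also have "\<dots> \<le> (A + B * exp 1) * exp (- y)"
      using A(1) by (simp add: distrib_right)
    finally show ?thesis .
  qed
  then show ?thesis by (intro exI[of _ "A + B * exp 1"]) (simp add: norm_mult)
qed

text \<open>The inversion carries the cusp 0 to the cusp at infinity, where
  \<open>prim (slash g)\<close> tends to 0; only the constant in \<open>prim_minus_inverse\<close>
  survives.\<close>

lemma prim_limit_zero:
  assumes "moderate_growth g"
  shows "((\<lambda>y. prim g (\<i> * of_real y)) \<longlongrightarrow> - period g) (at_right 0)"
proof -
  have "((\<lambda>y. prim (slash g) (Complex 0 (inverse y)) - period g) \<longlongrightarrow> 0 - period g) (at_right 0)"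
    by (intro tendsto_diff tendsto_const
        filterlim_compose[OF prim_limit[OF moderate_growth_slash[OF assms]]] filterlim_inverse_at_top_right)
  moreover have "eventually (\<lambda>y. prim (slash g) (Complex 0 (inverse y)) - period g
      = prim g (\<i> * of_real y)) (at_right 0)"
    using eventually_at_right_less[of 0]
  proof eventually_elim
    case (elim y)
    have "- 1 / Complex 0 (inverse y) = \<i> * of_real y"
      using elim by (simp add: Complex_eq field_simps)
    then show ?case
      using prim_minus_inverse[OF assms, of "Complex 0 (inverse y)"] elim by (simp add: uhp_iff)
  qed
  ultimately show ?thesis
    using Lim_transform_eventually by fastforce
qed

text \<open>With \<open>z = \<i> y\<close> the monomial contributes \<open>\<i> ^ i\<close> and
  \<open>dz\<close> one more \<open>\<i>\<close>; the exponent \<open>i\<close> of \<open>y\<close>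
  corresponds to \<open>s = i + 1\<close>.\<close>

lemma period_monomial:
  assumes "i \<le> k"
  shows "period (\<lambda>z. z ^ i) = \<i> ^ Suc i * completed_L f (of_nat (Suc i))"
proof -
  define g :: "complex \<Rightarrow> complex" where "g = (\<lambda>z. z ^ i)"
  define \<phi> where "\<phi> = (\<lambda>y. \<i> * (f (\<i> * complex_of_real y) * g (\<i> * of_real y)))"
  have g: "moderate_growth g" unfolding g_def by (intro moderate_growth_intros)
  have ei: "einterval 0 \<infinity> = {0<..}" by (auto simp: einterval_def)
  have cont: "continuous_on {0<..} \<phi>"
    unfolding \<phi>_def g_def
    by (intro continuous_intros continuous_on_compose2[OF holomorphic_on_imp_continuous_on[OF f_holomorphic]])
       (auto simp: uhp_iff)
  obtain D where D: "\<And>y. y > 0 \<Longrightarrow> norm (\<phi> y) \<le> D * exp (- y)"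
    using monomial_vertical_decay[OF assms] unfolding \<phi>_def g_def by blast
  have int: "set_integrable lborel {0<..} \<phi>"
  proof (rule set_integrable_bound[OF exp_minus_set_integrable[of D]])
    show "set_borel_measurable lborel {0<..} \<phi>"
      using borel_measurable_continuous_on_indicator[OF _ cont] by (simp add: set_borel_measurable_def)
    have "norm (\<phi> y) \<le> norm (D * exp (- y))" if "y \<in> {0<..}" for y
      using D[of y] that by auto
    then show "AE y in lborel. y \<in> {0<..} \<longrightarrow> norm (\<phi> y) \<le> norm (D * exp (- y))" by blast
  qed
  have "(LBINT y=0..\<infinity>. \<phi> y) = 0 - (- period g)"
  proof (rule interval_integral_FTC_integrable[where F = "\<lambda>y. prim g (\<i> * of_real y)"])
    fix y :: real assume "0 < ereal y"
    then have y: "y > 0" by (simp add: zero_ereal_def)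
    show "((\<lambda>y. prim g (\<i> * of_real y)) has_vector_derivative \<phi> y) (at y)"
      unfolding \<phi>_def by (rule prim_vertical_deriv[OF g y])
    show "isCont \<phi> y"
      using cont y by (simp add: continuous_on_eq_continuous_at)
  next
    show "set_integrable lborel (einterval 0 \<infinity>) \<phi>" unfolding ei by (rule int)
    show "(((\<lambda>y. prim g (\<i> * of_real y)) \<circ> real_of_ereal) \<longlongrightarrow> - period g) (at_right 0)"
      using prim_limit_zero[OF g] by (simp add: zero_ereal_def ereal_tendsto_simps1)
    show "(((\<lambda>y. prim g (\<i> * of_real y)) \<circ> real_of_ereal) \<longlongrightarrow> 0) (at_left \<infinity>)"
      using prim_limit[OF g, of 0] by (simp add: ereal_tendsto_simps1 Complex_eq)
  qed simp
  then have "period g = (LINT y:{0<..}|lborel. \<phi> y)"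
    by (simp add: interval_lebesgue_integral_def ei)
  also have "\<dots> = (LINT y:{0<..}|lborel. \<i> ^ Suc i * (f (\<i> * of_real y) * of_real y powr (of_nat (Suc i) - 1)))"
  proof (rule set_lebesgue_integral_cong)
    show "\<forall>y. y \<in> {0<..} \<longrightarrow> \<phi> y = \<i> ^ Suc i * (f (\<i> * of_real y) * of_real y powr (of_nat (Suc i) - 1))"
    proof (intro allI impI)
      fix y :: real assume "y \<in> {0<..}"
      then have "complex_of_real y powr (of_nat (Suc i) - 1) = of_real y ^ i"
        by (simp add: powr_nat)
      then show "\<phi> y = \<i> ^ Suc i * (f (\<i> * of_real y) * of_real y powr (of_nat (Suc i) - 1))"
        by (simp only: \<phi>_def g_def power_mult_distrib power_Suc mult_ac)
    qed
  qed simp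
  also have "\<dots> = \<i> ^ Suc i * completed_L f (of_nat (Suc i))"
    unfolding completed_L_def by (rule set_integral_mult_right)
  finally show ?thesis by (simp only: g_def)
qed

end

section \<open>The Eichler integral of the Eisenstein series\<close>

text \<open>The terms of \<open>m\<close> and \<open>- m\<close> are paired: the pair is of order
  \<open>1 / m^2\<close>, whereas the single terms are not absolutely summable over
  \<open>m\<close>.\<close>

definition eis_term :: "nat \<Rightarrow> complex \<Rightarrow> nat \<times> nat \<Rightarrow> complex" where
  "eis_term K z = (\<lambda>(m, n). (1 / of_nat n) ^ Suc K *
     (1 / (of_nat n * z + of_nat m) + 1 / (of_nat n * z - of_nat m)))"

text \<open>Up to a factor \<open>\<pi>\<close> this is \<open>\<Sum>\<^sub>n n\<^bsup>-K-1\<^esup> cot (\<pi> n z)\<close>, the Eichler integral of the Eisenstein series of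
  weight \<open>K + 2\<close>.\<close>
definition eis_integral :: "nat \<Rightarrow> complex \<Rightarrow> complex" where
  "eis_integral K z = of_real (zeta_nat (K + 2)) * (1 / z) + infsum (eis_term K z) pos_pairs"

definition eis_bound :: "nat \<Rightarrow> nat \<times> nat \<Rightarrow> real" where
  "eis_bound K = (\<lambda>(m, n). 2 * ((1 / real m) ^ 2 * (1 / real n) ^ K))"

text \<open>The imaginary part alone would bound the modulus by \<open>n * Im z\<close>; multiplying
  by \<open>cnj z\<close> first yields a bound that grows with \<open>m\<close>, as convergence in
  \<open>m\<close> requires.\<close>

lemma norm_lattice_ge:
  fixes n :: nat and m :: int
  assumes "z \<in> upper_half_plane"
  shows "norm (of_nat n * z + of_int m) * norm z \<ge> \<bar>real_of_int m\<bar> * Im z"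
proof -
  have "\<bar>Im (cnj z * (of_nat n * z + of_int m))\<bar> \<le> norm (cnj z * (of_nat n * z + of_int m))"
    by (rule abs_Im_le_cmod)
  moreover have "Im (cnj z * (of_nat n * z + of_int m)) = - (of_int m * Im z)"
    by (simp add: algebra_simps)
  ultimately show ?thesis
    using assms by (simp add: norm_mult abs_mult uhp_iff mult.commute)
qed

lemma lattice_nonzero:
  assumes "z \<in> upper_half_plane" "n > 0"
  shows "of_nat n * z + of_nat m \<noteq> 0" "of_nat n * z - of_nat m \<noteq> 0"
  using assms by (auto simp: uhp_iff complex_eq_iff)

text \<open>The paired fractions combine to \<open>2 n z / ((n z)^2 - m^2)\<close>, which gains
  \<open>1 / m^2\<close> at the price of one factor \<open>n\<close>. The exponent 5 collects
  \<open>norm z ^ 3\<close> and \<open>(1 / Im z) ^ 2\<close>.\<close>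

lemma norm_eis_term_le:
  assumes z: "z \<in> upper_half_plane" and p: "p \<in> pos_pairs"
  shows "norm (eis_term K z p) \<le> uhp_size z ^ 5 * eis_bound K p"
proof -
  obtain m n where [simp]: "p = (m, n)" by fastforce
  have mn: "m > 0" "n > 0" using p by (auto simp: pos_pairs_def)
  define a b where "a = of_nat n * z + of_nat m" and "b = of_nat n * z - of_nat m"
  define R y where "R = norm z" and "y = Im z"
  have y: "y > 0" and R: "R > 0" using z uhp_nonzero[OF z] by (auto simp: y_def R_def uhp_iff)
  have nz: "a \<noteq> 0" "b \<noteq> 0" unfolding a_def b_def by (rule lattice_nonzero[OF z mn(2)])+
  have ge: "norm a * R \<ge> real m * y" "norm b * R \<ge> real m * y"
    using norm_lattice_ge[OF z, where n = n and m = "int m"] norm_lattice_ge[OF z, where n = n and m = "- int m"]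
    by (simp_all add: a_def b_def R_def y_def)
  have "(real m * y) * (real m * y) \<le> (norm a * R) * (norm b * R)"
    by (rule mult_mono) (use ge y R in auto)
  then have prod: "real m ^ 2 * y ^ 2 \<le> (norm a * norm b) * R ^ 2"
    by (simp add: power2_eq_square mult_ac)
  have "1 / a + 1 / b = 2 * of_nat n * z / (a * b)"
    using nz by (simp add: field_simps) (simp add: a_def b_def)
  then have "norm (1 / a + 1 / b) = 2 * real n * R / (norm a * norm b)"
    by (simp add: norm_mult norm_divide R_def)
  also have "\<dots> \<le> 2 * real n * R * (R ^ 2 / (real m ^ 2 * y ^ 2))"
  proof -
    have "1 / (norm a * norm b) \<le> R ^ 2 / (real m ^ 2 * y ^ 2)"
      using prod nz mn y by (simp add: field_simps)
    then have "2 * real n * R * (1 / (norm a * norm b)) \<le> 2 * real n * R * (R ^ 2 / (real m ^ 2 * y ^ 2))"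
      using R by (intro mult_left_mono) auto
    then show ?thesis by simp
  qed
  also have "\<dots> = 2 * real n * (1 / real m) ^ 2 * (R ^ 3 * (1 / y) ^ 2)"
    by (simp add: power2_eq_square power3_eq_cube)
  also have "\<dots> \<le> 2 * real n * (1 / real m) ^ 2 * (uhp_size z ^ 3 * uhp_size z ^ 2)"
    using uhp_size_ge_norm[OF z] uhp_size_ge_inverse_Im[OF z] order_trans[OF zero_le_one uhp_size_ge_1[OF z]] y R
    unfolding R_def[symmetric] y_def[symmetric]
    by (intro mult_left_mono mult_mono power_mono) (auto simp: y_def R_def)
  finally have "norm (1 / a + 1 / b) \<le> 2 * real n * (1 / real m) ^ 2 * uhp_size z ^ 5"
    by (simp add: power_add[symmetric])
  then have "(1 / real n) ^ Suc K * norm (1 / a + 1 / b)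
      \<le> (1 / real n) ^ Suc K * (2 * real n * (1 / real m) ^ 2 * uhp_size z ^ 5)"
    by (intro mult_left_mono) auto
  also have "\<dots> = uhp_size z ^ 5 * (2 * ((1 / real m) ^ 2 * (1 / real n) ^ K))"
    using mn by simp
  finally show ?thesis
    by (simp add: eis_term_def eis_bound_def a_def[symmetric] b_def[symmetric] norm_mult norm_power norm_divide
      del: power_Suc)
qed

lemma eis_bound_summable:
  assumes "K \<ge> 2"
  shows "eis_bound K summable_on pos_pairs"
proof -
  have "((\<lambda>(m, n). (1 / real m) ^ 2 * (1 / real n) ^ K) has_sum (zeta_nat 2 * zeta_nat K)) pos_pairs"
    using zeta_nat_product_has_sum[of 2 K] assms
    by (subst has_sum_of_real_iff[symmetric, where ?'a = complex]) (simp add: case_prod_unfold)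
  from has_sum_cmult_right[OF this, of 2] show ?thesis
    by (auto simp: eis_bound_def summable_on_def case_prod_unfold)
qed

lemma eis_term_summable:
  assumes "K \<ge> 2" "z \<in> upper_half_plane"
  shows "(\<lambda>p. norm (eis_term K z p)) summable_on pos_pairs" "eis_term K z summable_on pos_pairs"
proof -
  show *: "(\<lambda>p. norm (eis_term K z p)) summable_on pos_pairs"
    by (rule Infinite_Sum.abs_summable_on_comparison_test'[OF summable_on_cmult_right[OF eis_bound_summable[OF assms(1)]]])
       (rule norm_eis_term_le[OF assms(2)])
  then show "eis_term K z summable_on pos_pairs" by (rule abs_summable_summable)
qed

lemma eis_term_holomorphic: "p \<in> pos_pairs \<Longrightarrow> (\<lambda>z. eis_term K z p) holomorphic_on upper_half_plane"
  unfolding eis_term_def pos_pairs_def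
  by (auto intro!: holomorphic_intros dest: lattice_nonzero)

lemma eis_sum_holomorphic:
  assumes K: "K \<ge> 2"
  shows "(\<lambda>z. infsum (eis_term K z) pos_pairs) holomorphic_on upper_half_plane"
proof (rule holomorphic_onI)
  fix z assume "z \<in> upper_half_plane"
  then obtain r where r: "r > 0" "cball z r \<subseteq> upper_half_plane"
    using open_uhp by (meson open_contains_cball)
  have "continuous_on (cball z r) uhp_size"
    unfolding uhp_size_def[abs_def] using r(2) by (intro continuous_intros) (force simp: uhp_iff)
  then have "compact (uhp_size ` cball z r)" by (rule compact_continuous_image) simp
  then obtain B where "\<forall>x\<in>uhp_size ` cball z r. norm x \<le> B"
    using compact_imp_bounded bounded_iff by metis
  then have B: "uhp_size w \<le> B" if "w \<in> cball z r" for w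
  proof -
    have "norm (uhp_size w) \<le> B"
      using \<open>\<forall>x\<in>uhp_size ` cball z r. norm x \<le> B\<close> that by blast
    then show ?thesis by simp
  qed
  have ulim: "uniform_limit (cball z r) (\<lambda>X w. \<Sum>p\<in>X. eis_term K w p)
      (\<lambda>w. \<Sum>\<^sub>\<infinity>p\<in>pos_pairs. eis_term K w p) (finite_subsets_at_top pos_pairs)"
  proof (rule Weierstrass_m_test_general)
    fix p w assume p: "p \<in> pos_pairs" and w: "w \<in> cball z r"
    have wu: "w \<in> upper_half_plane" using w r by auto
    have "norm (eis_term K w p) \<le> uhp_size w ^ 5 * eis_bound K p"
      by (rule norm_eis_term_le[OF wu p])
    also have "\<dots> \<le> B ^ 5 * eis_bound K p"
      using B[OF w] uhp_size_ge_1[OF wu]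
      by (intro mult_right_mono power_mono) (auto simp: eis_bound_def case_prod_unfold)
    finally show "norm (eis_term K w p) \<le> B ^ 5 * eis_bound K p" .
  qed (intro summable_on_cmult_right eis_bound_summable K)
  have "(\<lambda>w. \<Sum>\<^sub>\<infinity>p\<in>pos_pairs. eis_term K w p) holomorphic_on ball z r"
  proof (rule holomorphic_uniform_limit[OF _ ulim])
    show "eventually (\<lambda>X. continuous_on (cball z r) (\<lambda>w. \<Sum>p\<in>X. eis_term K w p) \<and>
        (\<lambda>w. \<Sum>p\<in>X. eis_term K w p) holomorphic_on ball z r) (finite_subsets_at_top pos_pairs)"
    proof (intro eventually_finite_subsets_at_top_weakI conjI)
      fix X assume X: "X \<subseteq> pos_pairs"
      have h: "(\<lambda>w. \<Sum>p\<in>X. eis_term K w p) holomorphic_on upper_half_plane"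
        using X by (intro holomorphic_on_sum eis_term_holomorphic) auto
      show "continuous_on (cball z r) (\<lambda>w. \<Sum>p\<in>X. eis_term K w p)"
        by (rule holomorphic_on_imp_continuous_on[OF holomorphic_on_subset[OF h r(2)]])
      show "(\<lambda>w. \<Sum>p\<in>X. eis_term K w p) holomorphic_on ball z r"
        by (rule holomorphic_on_subset[OF h subset_trans[OF ball_subset_cball r(2)]])
    qed
  qed simp
  from holomorphic_on_imp_differentiable_at[OF this open_ball]
  have "(\<lambda>z. infsum (eis_term K z) pos_pairs) field_differentiable at z"
    using r(1) by simp
  then show "(\<lambda>z. infsum (eis_term K z) pos_pairs) field_differentiable at z within upper_half_plane"
    by (rule field_differentiable_at_within)
qed

lemma eis_integral_moderate_growth:
  assumes K: "K \<ge> 2"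
  shows "moderate_growth (eis_integral K)"
proof -
  have "moderate_growth (\<lambda>z. infsum (eis_term K z) pos_pairs)"
  proof (rule moderate_growthI[OF eis_sum_holomorphic[OF K]])
    fix z assume z: "z \<in> upper_half_plane"
    have "norm (infsum (eis_term K z) pos_pairs) \<le> infsum (\<lambda>p. norm (eis_term K z p)) pos_pairs"
      by (rule norm_infsum_bound[OF eis_term_summable(1)[OF K z]])
    also have "\<dots> \<le> infsum (\<lambda>p. uhp_size z ^ 5 * eis_bound K p) pos_pairs"
      by (intro infsum_mono eis_term_summable K z summable_on_cmult_right eis_bound_summable norm_eis_term_le)
    also have "\<dots> = infsum (eis_bound K) pos_pairs * uhp_size z ^ 5"
      unfolding infsum_cmult_right' by (rule mult.commute)
    finally show "norm (infsum (eis_term K z) pos_pairs) \<le> infsum (eis_bound K) pos_pairs * uhp_size z ^ 5" .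
  qed
  then show ?thesis
    unfolding eis_integral_def[abs_def] by (intro moderate_growth_intros)
qed

text \<open>Periodicity of the cotangent: the symmetric partial sums at \<open>w + 1\<close> and
  \<open>w\<close> differ by two boundary terms, both tending to 0.\<close>

lemma symmetric_sum_shift:
  assumes w: "Im w > 0"
    and 1: "((\<lambda>m. 1 / (w + of_nat m) + 1 / (w - of_nat m)) has_sum A) {0<..}"
    and 2: "((\<lambda>m. 1 / (w + 1 + of_nat m) + 1 / (w + 1 - of_nat m)) has_sum B) {0<..}"
  shows "1 / (w + 1) + B = 1 / w + A"
proof -
  define S where "S = (\<lambda>v n. 1 / v + (\<Sum>m<n. 1 / (v + of_nat (Suc m)) + 1 / (v - of_nat (Suc m))) :: complex)"
  have lim: "S v \<longlonglongrightarrow> 1 / v + C"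
    if "((\<lambda>m. 1 / (v + of_nat m) + 1 / (v - of_nat m)) has_sum C) {0<..}" for v C
  proof -
    have "((\<lambda>m. 1 / (v + of_nat (Suc m)) + 1 / (v - of_nat (Suc m))) has_sum C) UNIV"
      using that
      by (subst has_sum_reindex_bij_witness[of _ "\<lambda>n. n - 1" Suc "{0<..}"
            "\<lambda>m. 1 / (v + of_nat m) + 1 / (v - of_nat m)"]) auto
    then show ?thesis
      unfolding S_def by (intro tendsto_add tendsto_const has_sum_imp_sums[unfolded sums_def])
  qed
  have diff: "S (w + 1) n - S w n = 1 / (w + of_nat (Suc n)) - 1 / (w - of_nat n)" for n
  proof (induction n)
    case (Suc n)
    have "S (w + 1) (Suc n) - S w (Suc n) = (S (w + 1) n - S w n)
       + (1 / (w + 1 + of_nat (Suc n)) + 1 / (w + 1 - of_nat (Suc n)))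
       - (1 / (w + of_nat (Suc n)) + 1 / (w - of_nat (Suc n)))"
      by (simp add: S_def)
    also have "\<dots> = 1 / (w + of_nat (Suc (Suc n))) - 1 / (w - of_nat (Suc n))"
      unfolding Suc.IH by (simp add: add_ac)
    finally show ?case .
  qed (simp add: S_def)
  have inv: "(\<lambda>n. 1 / (w + of_nat (Suc n))) \<longlonglongrightarrow> 0" "(\<lambda>n. 1 / (w - of_nat n)) \<longlonglongrightarrow> 0"
  proof -
    have "filterlim (\<lambda>n. w + of_nat (Suc n)) at_infinity sequentially"
      by (intro tendsto_add_filterlim_at_infinity[OF tendsto_const]
          filterlim_compose[OF tendsto_of_nat filterlim_Suc])
    then show "(\<lambda>n. 1 / (w + of_nat (Suc n))) \<longlonglongrightarrow> 0"
      by (rule tendsto_divide_0[OF tendsto_const])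
    have "filterlim (\<lambda>n. w + - of_nat n) at_infinity sequentially"
      by (intro tendsto_add_filterlim_at_infinity[OF tendsto_const])
         (simp add: filterlim_at_infinity_conv_norm_at_top filterlim_real_sequentially)
    then show "(\<lambda>n. 1 / (w - of_nat n)) \<longlonglongrightarrow> 0"
      by (simp add: tendsto_divide_0[OF tendsto_const])
  qed
  have "(\<lambda>n. S (w + 1) n - S w n) \<longlonglongrightarrow> 0 - 0"
    unfolding diff by (intro tendsto_diff inv)
  moreover have "(\<lambda>n. S (w + 1) n - S w n) \<longlonglongrightarrow> (1 / (w + 1) + B) - (1 / w + A)"
    by (intro tendsto_diff lim 1 2)
  ultimately have "(1 / (w + 1) + B) - (1 / w + A) = 0"
    using LIMSEQ_unique by fastforce
  then show ?thesis by simp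
qed

text \<open>Summing over \<open>m\<close> first leaves cotangent series at \<open>n z\<close>; the
  zeta term of \<open>eis_integral\<close> supplies exactly their \<open>m = 0\<close> terms
  \<open>1 / (n z)\<close>.\<close>

lemma eis_integral_fibre:
  assumes K: "K \<ge> 2" and z: "z \<in> upper_half_plane"
  shows "((\<lambda>n. (1 / of_nat n) ^ Suc K * (1 / (of_nat n * z)
      + infsum (\<lambda>m. 1 / (of_nat n * z + of_nat m) + 1 / (of_nat n * z - of_nat m)) {0<..}))
    has_sum eis_integral K z) {0<..}"
    and "n > 0 \<Longrightarrow> (\<lambda>m. 1 / (of_nat n * z + of_nat m) + 1 / (of_nat n * z - of_nat m)) summable_on {0<..}"
proof -
  define g where "g = (\<lambda>n m. 1 / (of_nat n * z + of_nat m) + 1 / (of_nat n * z - of_nat m) :: complex)"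
  have "((\<lambda>(n, m). (1 / of_nat n) ^ Suc K * g n m) has_sum infsum (eis_term K z) pos_pairs) ({0<..} \<times> {0<..})"
    using has_sum_infsum[OF eis_term_summable(2)[OF K z]]
    by (subst has_sum_reindex_bij_witness[of _ "\<lambda>(m, n). (n, m)" "\<lambda>(m, n). (n, m)" pos_pairs "eis_term K z"])
       (auto simp: pos_pairs_def eis_term_def g_def)
  then have sm: "(\<lambda>(n, m). (1 / of_nat n) ^ Suc K * g n m) summable_on ({0<..} \<times> {0<..})"
    and eq: "infsum (\<lambda>(n, m). (1 / of_nat n) ^ Suc K * g n m) ({0<..} \<times> {0<..}) = infsum (eis_term K z) pos_pairs"
    by (auto simp: has_sum_iff)
  have fib: "(\<lambda>m. (1 / of_nat n) ^ Suc K * g n m) summable_on {0<..}" if "n > 0" for n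
    using summable_on_SigmaD1[OF sm, of n] that by simp
  have "g n summable_on {0<..}" if "n > 0" for n
    using fib[OF that] that by (subst (asm) summable_on_cmult_right') auto
  then show "n > 0 \<Longrightarrow> (\<lambda>m. 1 / (of_nat n * z + of_nat m) + 1 / (of_nat n * z - of_nat m)) summable_on {0<..}"
    by (simp add: g_def)
  have "((\<lambda>n. infsum (\<lambda>m. (1 / of_nat n) ^ Suc K * g n m) {0<..}) has_sum infsum (eis_term K z) pos_pairs) {0<..}"
    unfolding eq[symmetric]
    by (rule has_sum_SigmaD[OF has_sum_infsum[OF sm]]) (use fib in auto)
  then have "((\<lambda>n. (1 / of_nat n) ^ Suc K * infsum (g n) {0<..}) has_sum infsum (eis_term K z) pos_pairs) {0<..}"
    by (simp only: infsum_cmult_right')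
  moreover have "((\<lambda>n. (1 / of_nat n) ^ (K + 2) * (1 / z)) has_sum of_real (zeta_nat (K + 2)) * (1 / z)) {0<..}"
    by (rule has_sum_cmult_left[OF zeta_nat_has_sum]) simp
  ultimately have "((\<lambda>n. (1 / of_nat n) ^ (K + 2) * (1 / z) + (1 / of_nat n) ^ Suc K * infsum (g n) {0<..})
      has_sum eis_integral K z) {0<..}"
    unfolding eis_integral_def by (intro has_sum_add)
  from this show "((\<lambda>n. (1 / of_nat n) ^ Suc K * (1 / (of_nat n * z) +
      infsum (\<lambda>m. 1 / (of_nat n * z + of_nat m) + 1 / (of_nat n * z - of_nat m)) {0<..}))
      has_sum eis_integral K z) {0<..}"
  proof -
    have "(1 / of_nat n) ^ (K + 2) * (1 / z) + (1 / of_nat n) ^ Suc K * x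
       = (1 / of_nat n) ^ Suc K * (1 / (of_nat n * z) + x)" for n x
      by (simp add: distrib_left)
    then show ?thesis
      using \<open>((\<lambda>n. (1 / of_nat n) ^ (K + 2) * (1 / z) + (1 / of_nat n) ^ Suc K * infsum (g n) {0<..})
        has_sum eis_integral K z) {0<..}\<close> by (simp only: g_def)
  qed
qed

lemma eis_integral_add_1:
  assumes K: "K \<ge> 2" and z: "z \<in> upper_half_plane"
  shows "eis_integral K (z + 1) = eis_integral K z"
proof -
  define D where "D = (\<lambda>w. 1 / w + infsum (\<lambda>m. 1 / (w + of_nat m) + 1 / (w - of_nat m)) {0<..} :: complex)"
  have "D (of_nat n * (z + 1)) = D (of_nat n * z)" if n: "n > 0" for n
  proof -
    \<comment> \<open>Translating \<open>z\<close> by 1 moves \<open>n z\<close> by \<open>n\<close>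
      unit shifts. The intermediate points are written as \<open>n\<close> times a point of the
      half-plane, since summability is available in that form.\<close>
    have step: "D (of_nat n * (z + of_real (real i / real n)) + 1) = D (of_nat n * (z + of_real (real i / real n)))" for i
    proof -
      define v v' where "v = z + of_real (real i / real n)" and "v' = z + of_real (real (Suc i) / real n)"
      have v: "v \<in> upper_half_plane" "v' \<in> upper_half_plane"
        unfolding v_def v'_def by (rule uhp_add_real[OF z])+
      have nv: "of_nat n * v' = of_nat n * v + 1"
        using n by (simp add: v_def v'_def field_simps)
      show ?thesis
        unfolding D_def v_def[symmetric]
        by (rule symmetric_sum_shift)
           (use v n eis_integral_fibre(2)[OF K v(1) n] eis_integral_fibre(2)[OF K v(2) n, unfolded nv]
            in \<open>auto simp: uhp_iff intro: has_sum_infsum\<close>)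
    qed
    have "D (of_nat n * z + of_nat i) = D (of_nat n * z)" for i
    proof (induction i)
      case (Suc i)
      have "of_nat n * (z + of_real (real i / real n)) = of_nat n * z + of_nat i"
        using n by (simp add: field_simps)
      with step[of i] Suc show ?case by (simp add: add_ac)
    qed simp
    from this[of n] show ?thesis by (simp add: distrib_left)
  qed
  then have eq: "(1 / of_nat n) ^ Suc K * D (of_nat n * (z + 1)) = (1 / of_nat n) ^ Suc K * D (of_nat n * z)"
    if "n \<in> {0<..}" for n using that by simp
  have "z + 1 \<in> upper_half_plane" using z by (simp add: uhp_iff)
  from eis_integral_fibre(1)[OF K this]
  have "((\<lambda>n. (1 / of_nat n) ^ Suc K * D (of_nat n * (z + 1))) has_sum eis_integral K (z + 1)) {0<..}"
    by (simp only: D_def)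
  then have "((\<lambda>n. (1 / of_nat n) ^ Suc K * D (of_nat n * z)) has_sum eis_integral K (z + 1)) {0<..}"
    by (simp only: has_sum_cong[OF eq])
  moreover have "((\<lambda>n. (1 / of_nat n) ^ Suc K * D (of_nat n * z)) has_sum eis_integral K z) {0<..}"
    using eis_integral_fibre(1)[OF K z] by (simp only: D_def)
  ultimately show ?thesis by (rule has_sum_unique)
qed

text \<open>Up to a factor, this is the odd period polynomial of the Eisenstein series of weight \<open>K + 2\<close>, with
  Bernoulli numbers written as even zeta values.\<close>
definition eis_period :: "nat \<Rightarrow> complex \<Rightarrow> complex" where
  "eis_period K z = (\<Sum>j | j \<le> K \<and> odd j.
     of_real (zeta_nat (Suc j) * zeta_nat (Suc (K - j))) * z ^ j)"

text \<open>The fractions come from two geometric sums, with ratios of opposite sign; as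
  \<open>K\<close> is even, the terms with even \<open>j\<close> cancel in their difference.\<close>

lemma power_sum_difference:
  fixes t v :: complex
  assumes "even K" "t + v \<noteq> 0" "t - v \<noteq> 0"
  shows "v ^ Suc K * (1 / (t + v) + 1 / (t - v)) - t ^ Suc K * (1 / (t - v) - 1 / (t + v))
    = - 2 * (\<Sum>j | j \<le> K \<and> odd j. t ^ j * v ^ (K - j))"
proof -
  have "(t + v) * (\<Sum>j\<le>K. t ^ j * (- v) ^ (K - j)) = t ^ Suc K + v ^ Suc K"
    using homogeneous_geometric_sum[of t "- v" K] assms(1) by simp
  moreover have "(t - v) * (\<Sum>j\<le>K. t ^ j * v ^ (K - j)) = t ^ Suc K - v ^ Suc K"
    by (rule homogeneous_geometric_sum)
  ultimately have "v ^ Suc K * (1 / (t + v) + 1 / (t - v)) - t ^ Suc K * (1 / (t - v) - 1 / (t + v))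
    = (\<Sum>j\<le>K. t ^ j * (- v) ^ (K - j)) - (\<Sum>j\<le>K. t ^ j * v ^ (K - j))"
  proof -
    assume a: "(t + v) * (\<Sum>j\<le>K. t ^ j * (- v) ^ (K - j)) = t ^ Suc K + v ^ Suc K"
      and b: "(t - v) * (\<Sum>j\<le>K. t ^ j * v ^ (K - j)) = t ^ Suc K - v ^ Suc K"
    have a': "(\<Sum>j\<le>K. t ^ j * (- v) ^ (K - j)) = (t ^ Suc K + v ^ Suc K) / (t + v)"
      unfolding a[symmetric] using assms(2) by simp
    have b': "(\<Sum>j\<le>K. t ^ j * v ^ (K - j)) = (t ^ Suc K - v ^ Suc K) / (t - v)"
      unfolding b[symmetric] using assms(3) by simp
    show ?thesis unfolding a' b'
      by (simp only: add_divide_distrib diff_divide_distrib) (simp add: algebra_simps del: power_Suc)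
  qed
  also have "\<dots> = (\<Sum>j\<le>K. t ^ j * ((- v) ^ (K - j) - v ^ (K - j)))"
    by (simp add: sum_subtractf right_diff_distrib)
  also have "\<dots> = (\<Sum>j | j \<le> K \<and> odd j. - 2 * (t ^ j * v ^ (K - j)))"
    by (rule sum.mono_neutral_cong_right) (use assms(1) in auto)
  finally show ?thesis by (simp add: sum_distrib_left)
qed

text \<open>The transformed series is summed with its indices exchanged. Both series then have the
  denominators \<open>n z + m\<close> and \<open>n z - m\<close> up to scaling, and the termwise
  difference is a polynomial in \<open>z\<close> whose coefficients sum to products of zeta
  values.\<close>

lemma eis_integral_minus_inverse:
  assumes K: "K \<ge> 2" "even K" and z: "z \<in> upper_half_plane"
  shows "eis_integral K z - z ^ K * eis_integral K (- 1 / z)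
    = of_real (zeta_nat (K + 2)) * (1 / z + z ^ Suc K) - 2 * eis_period K z"
proof -
  have z0: "z \<noteq> 0" by (rule uhp_nonzero[OF z])
  define I where "I = (\<lambda>z. infsum (eis_term K z) pos_pairs)"
  have sI: "(eis_term K z has_sum I z) pos_pairs" "(eis_term K (- 1 / z) has_sum I (- 1 / z)) pos_pairs"
    unfolding I_def using eis_term_summable(2) K z uhp_minus_inverse[OF z] by auto
  have "((\<lambda>(m, n). z ^ K * eis_term K (- 1 / z) (n, m)) has_sum z ^ K * I (- 1 / z)) pos_pairs"
    using has_sum_cmult_right[OF sI(2), of "z ^ K"]
    by (subst has_sum_reindex_bij_witness[of _ "\<lambda>(m, n). (n, m)" "\<lambda>(m, n). (n, m)" pos_pairs
          "\<lambda>p. z ^ K * eis_term K (- 1 / z) p"]) (auto simp: pos_pairs_def)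
  from has_sum_diff_complex[OF sI(1) this]
  have L: "((\<lambda>p. eis_term K z p - (\<lambda>(m, n). z ^ K * eis_term K (- 1 / z) (n, m)) p)
      has_sum (I z - z ^ K * I (- 1 / z))) pos_pairs" .
  have "((\<lambda>p. \<Sum>j | j \<le> K \<and> odd j. (\<lambda>(m, n). - 2 * z ^ j * ((1 / of_nat m) ^ Suc j * (1 / of_nat n) ^ Suc (K - j))) p)
     has_sum (\<Sum>j | j \<le> K \<and> odd j. - 2 * z ^ j * of_real (zeta_nat (Suc j) * zeta_nat (Suc (K - j))))) pos_pairs"
  proof (rule has_sum_finite_sum)
    fix j assume "j \<in> {j. j \<le> K \<and> odd j}"
    then have j: "j \<le> K" "odd j" "j \<noteq> K" using K(2) by auto
    then have "Suc j \<ge> 2" "Suc (K - j) \<ge> 2" using odd_pos[OF j(2)] by auto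
    from has_sum_cmult_right[OF zeta_nat_product_has_sum[OF this], of "- 2 * z ^ j"]
    show "((\<lambda>(m, n). - 2 * z ^ j * ((1 / of_nat m) ^ Suc j * (1 / of_nat n) ^ Suc (K - j)))
       has_sum - 2 * z ^ j * of_real (zeta_nat (Suc j) * zeta_nat (Suc (K - j)))) pos_pairs"
      by (simp add: case_prod_unfold del: power_Suc)
  qed
  moreover have "eis_term K z p - (\<lambda>(m, n). z ^ K * eis_term K (- 1 / z) (n, m)) p
     = (\<Sum>j | j \<le> K \<and> odd j. (\<lambda>(m, n). - 2 * z ^ j * ((1 / of_nat m) ^ Suc j * (1 / of_nat n) ^ Suc (K - j))) p)"
    if p: "p \<in> pos_pairs" for p
  proof -
    obtain m n where [simp]: "p = (m, n)" by fastforce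
    have mn: "m > 0" "n > 0" using p by (auto simp: pos_pairs_def)
    \<comment> \<open>In these variables \<open>n z + m\<close> and \<open>n z - m\<close> become
      \<open>t + v\<close> and \<open>t - v\<close> up to \<open>u * v\<close>, and the inversion
      with exchanged indices replaces the power of \<open>v\<close> by that of
      \<open>t\<close>.\<close>
    define u v t where "u = (1 / of_nat m :: complex)" and "v = (1 / of_nat n :: complex)" and "t = z * u"
    have uv: "u \<noteq> 0" "v \<noteq> 0" using mn by (auto simp: u_def v_def)
    have nm: "of_nat n = 1 / v" "of_nat m = 1 / u" by (auto simp: u_def v_def)
    have nz: "of_nat n * z + of_nat m = (t + v) / (u * v)" "of_nat n * z - of_nat m = (t - v) / (u * v)"
      unfolding nm t_def using uv by (auto simp: field_simps)
    have nzS: "of_nat m * (- 1 / z) + of_nat n = (t - v) / (u * v * z)"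
        "of_nat m * (- 1 / z) - of_nat n = - (t + v) / (u * v * z)"
      unfolding nm t_def using uv z0 by (auto simp: field_simps)
    have tv: "t + v \<noteq> 0" "t - v \<noteq> 0"
      using lattice_nonzero[OF z mn(2), of m] uv unfolding nz by auto
    have e1: "eis_term K z (m, n) = u * v * (v ^ Suc K * (1 / (t + v) + 1 / (t - v)))"
      unfolding eis_term_def split nz v_def[symmetric] using tv uv
      by (simp add: distrib_left mult_ac del: power_Suc)
    have e2: "z ^ K * eis_term K (- 1 / z) (n, m) = u * v * (t ^ Suc K * (1 / (t - v) - 1 / (t + v)))"
    proof -
      have "z ^ K * eis_term K (- 1 / z) (n, m)
         = z ^ K * (u ^ Suc K * (1 / ((t - v) / (u * v * z)) + 1 / (- (t + v) / (u * v * z))))"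
        by (simp only: eis_term_def split nzS u_def[symmetric])
      also have "1 / ((t - v) / (u * v * z)) + 1 / (- (t + v) / (u * v * z))
         = u * v * z * (1 / (t - v) - 1 / (t + v))"
      proof -
        have "1 / (a / c) + 1 / (- b / c) = c * (1 / a - 1 / b)" for a b c :: complex
          by (simp add: right_diff_distrib)
        then show ?thesis .
      qed
      also have "z ^ K * (u ^ Suc K * (u * v * z * (1 / (t - v) - 1 / (t + v))))
         = u * v * ((z * u) ^ Suc K * (1 / (t - v) - 1 / (t + v)))"
        by (simp add: power_mult_distrib mult_ac)
      finally show ?thesis by (simp only: t_def)
    qed
    have "eis_term K z (m, n) - z ^ K * eis_term K (- 1 / z) (n, m)
       = u * v * (- 2 * (\<Sum>j | j \<le> K \<and> odd j. t ^ j * v ^ (K - j)))"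
      unfolding e1 e2 right_diff_distrib[symmetric] power_sum_difference[OF K(2) tv] ..
    also have "\<dots> = (\<Sum>j | j \<le> K \<and> odd j. - 2 * z ^ j * (u ^ Suc j * v ^ Suc (K - j)))"
      unfolding sum_distrib_left t_def by (intro sum.cong refl) (simp add: power_mult_distrib mult_ac)
    finally show ?thesis by (simp add: u_def v_def del: power_Suc)
  qed
  ultimately have "((\<lambda>p. eis_term K z p - (\<lambda>(m, n). z ^ K * eis_term K (- 1 / z) (n, m)) p)
     has_sum (\<Sum>j | j \<le> K \<and> odd j. - 2 * z ^ j * of_real (zeta_nat (Suc j) * zeta_nat (Suc (K - j))))) pos_pairs"
    by (subst has_sum_cong) auto
  from has_sum_unique[OF L this]
  have R: "I z - z ^ K * I (- 1 / z) = - 2 * eis_period K z"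
    by (simp add: eis_period_def sum_distrib_left mult_ac sum_negf)
  have "z ^ K * (of_real (zeta_nat (K + 2)) * (1 / (- 1 / z))) = - of_real (zeta_nat (K + 2)) * z ^ Suc K"
    by simp
  then have "eis_integral K z - z ^ K * eis_integral K (- 1 / z)
     = of_real (zeta_nat (K + 2)) * (1 / z + z ^ Suc K) + (I z - z ^ K * I (- 1 / z))"
    unfolding eis_integral_def I_def by (simp only: distrib_left right_diff_distrib) simp
  then show ?thesis unfolding R by simp
qed

section \<open>The relation between the periods\<close>

text \<open>Euler's formula \<open>\<Sum> \<zeta>(2 i) \<zeta>(2 n - 2 i) = (n + 1/2) \<zeta>(2 n)\<close>, from the three-term relation
  \<open>p(z) = p(z + 1) + (z + 1)\<^sup>K p(z / (z + 1))\<close> in the limit \<open>z \<rightarrow> 0\<close>.\<close>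
lemma eis_period_one:
  assumes K: "K \<ge> 2" "even K"
  shows "eis_period K 1 = of_nat (K + 3) / 2 * of_real (zeta_nat (K + 2))"
proof -
  define Z :: complex where "Z = of_real (zeta_nat (K + 2))"
  define w where "w = eis_period K"
  define p where "p = (\<lambda>z. eis_integral K z - z ^ K * eis_integral K (- 1 / z))"
  have p: "p z = Z * (1 / z + z ^ Suc K) - 2 * w z" if "z \<in> upper_half_plane" for z
    unfolding p_def Z_def w_def by (rule eis_integral_minus_inverse[OF K that])
  \<comment> \<open>The difference of the two sides of the three-term relation after cancelling the
    poles \<open>1 / z\<close> they share, hence continuous at 0.\<close>
  define G where "G = (\<lambda>z. Z * z ^ Suc K - 2 * w z - (Z * (1 / (z + 1) + (z + 1) ^ Suc K) - 2 * w (z + 1)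
     + (z + 1) ^ K * (Z * (z / (z + 1)) ^ Suc K - 2 * w (z / (z + 1))) + Z * (\<Sum>j\<le>K. (z + 1) ^ j)))"
  have G0: "G z = 0" if z: "z \<in> upper_half_plane" for z
  proof -
    have z0: "z \<noteq> 0" by (rule uhp_nonzero[OF z])
    have z1: "z + 1 \<in> upper_half_plane" using z by (simp add: uhp_iff)
    have z10: "z + 1 \<noteq> 0" by (rule uhp_nonzero[OF z1])
    define v where "v = z / (z + 1)"
    have v_eq: "v = - 1 / (z + 1) + 1" using z10 by (simp add: v_def field_simps)
    have v: "v \<in> upper_half_plane"
      unfolding v_eq using uhp_minus_inverse[OF z1] by (simp add: uhp_iff)
    have v_inv: "- 1 / z = - 1 / v + 1" using z0 z10 by (simp add: v_def field_simps)
    have e1: "p z = p (z + 1) + (z + 1) ^ K * p v"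
    proof -
      have "eis_integral K v = eis_integral K (- 1 / (z + 1))"
        unfolding v_eq by (rule eis_integral_add_1[OF K(1) uhp_minus_inverse[OF z1]])
      moreover have "eis_integral K (- 1 / z) = eis_integral K (- 1 / v)"
        unfolding v_inv by (rule eis_integral_add_1[OF K(1) uhp_minus_inverse[OF v]])
      moreover have "(z + 1) ^ K * v ^ K = z ^ K"
        using z10 by (simp add: v_def power_mult_distrib[symmetric])
      moreover have "x - y = x' - c * d + c * (d' - vK * e)"
        if "d' = d" "y = zK * e" "c * vK = zK" "x' = x" for x y x' c d d' vK e zK :: complex
        using that by (auto simp: algebra_simps)
      ultimately show ?thesis
        unfolding p_def using eis_integral_add_1[OF K(1) z] by metis
    qed
    have "(z + 1) ^ K * (1 / v) = 1 / z + (\<Sum>j\<le>K. (z + 1) ^ j)"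
    proof -
      have "z * (\<Sum>j\<le>K. (z + 1) ^ j) = (z + 1) ^ Suc K - 1"
        using homogeneous_geometric_sum[of "z + 1" 1 K] by simp
      then have "(\<Sum>j\<le>K. (z + 1) ^ j) = ((z + 1) ^ Suc K - 1) / z"
        using z0 by (simp add: nonzero_eq_divide_eq mult.commute)
      then show ?thesis using z0 by (simp add: v_def diff_divide_distrib mult.commute)
    qed
    then have e2: "(z + 1) ^ K * (Z * (1 / v + v ^ Suc K) - 2 * w v)
      = Z * (1 / z) + Z * (\<Sum>j\<le>K. (z + 1) ^ j) + (z + 1) ^ K * (Z * v ^ Suc K - 2 * w v)"
      by (simp only: distrib_left right_diff_distrib mult.left_commute[of _ Z]) (simp only: distrib_left add_ac add_diff_eq)
    have "Z * b - c - (r + e + d) = 0" if "Z * (a + b) - c = r + (Z * a + d + e)" for a b c d e r :: complex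
      using that by (simp add: algebra_simps)
    from this[OF e1[unfolded p[OF z] p[OF z1] p[OF v] e2]] show ?thesis
      unfolding G_def v_def[symmetric] .
  qed
  have "isCont G 0"
    unfolding G_def w_def eis_period_def[abs_def] by (intro continuous_intros) auto
  moreover have "(\<lambda>n. \<i> * of_real (1 / real (Suc n))) \<longlonglongrightarrow> \<i> * of_real 0"
    by (intro tendsto_intros LIMSEQ_Suc[OF lim_1_over_n])
  ultimately have "(\<lambda>n. G (\<i> * of_real (1 / real (Suc n)))) \<longlonglongrightarrow> G 0"
    by (auto intro: isCont_tendsto_compose)
  moreover have "G (\<i> * of_real (1 / real (Suc n))) = 0" for n
    by (rule G0) (simp add: uhp_iff)
  ultimately have "G 0 = 0" by (simp add: LIMSEQ_const_iff)
  moreover have "w 0 = 0"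
    unfolding w_def eis_period_def by (intro sum.neutral) auto
  \<comment> \<open>At 0 the geometric sum contributes \<open>K + 1\<close> and the two terms in
    \<open>z + 1\<close> contribute 2, whence \<open>K + 3\<close>.\<close>
  ultimately have "2 * w 1 = Z * (2 + of_nat (Suc K))" by (simp add: G_def algebra_simps)
  then show ?thesis by (simp add: w_def Z_def field_simps)
qed

lemma moderate_growth_eis_period: "moderate_growth (eis_period K)"
  unfolding eis_period_def[abs_def] by (intro moderate_growth_intros)

context cusp_form
begin

text \<open>The right-hand side does not depend on \<open>a\<close>, so a comparison of both signs
  removes the period of the Eichler integral.\<close>

lemma period_eis_relation:
  assumes k: "k \<ge> 4" and a: "a = 1 \<or> a = - 1"
  shows "of_real (zeta_nat k) * (period (\<lambda>z. 1 / (z + of_real a)) + period (\<lambda>z. (z + of_real a) ^ (k - 1)))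
    - 2 * period (\<lambda>z. eis_period (k - 2) (z + of_real a)) = period (eis_integral (k - 2))"
proof -
  define K where "K = k - 2"
  have K: "K \<ge> 2" "even K" "K + 2 = k" "Suc K = k - 1" using k even_k by (auto simp: K_def)
  define g where "g = eis_integral K"
  have g: "moderate_growth g" unfolding g_def by (rule eis_integral_moderate_growth[OF K(1)])
  have ga: "g (z + of_real a) = g z" if z: "z \<in> upper_half_plane" for z
  proof (cases "a = 1")
    case False
    have "z - 1 \<in> upper_half_plane" using z by (simp add: uhp_iff)
    then show ?thesis using False a eis_integral_add_1[OF K(1), of "z - 1"] by (simp add: g_def)
  qed (use eis_integral_add_1[OF K(1) z] in \<open>simp add: g_def\<close>)
  have t1: "period (\<lambda>z. g (z + of_real a)) = period g"
    by (rule period_cong) (auto simp: ga intro: moderate_growth_translate g)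
  \<comment> \<open>By translation invariance the first term of \<open>period_three_term\<close> is
    already \<open>period g\<close>, and the second term is the present one.\<close>
  have t2: "period (\<lambda>z. slash g (z + of_real a)) = 0"
  proof -
    have "period (\<lambda>z. slash g (z + of_real a))
       = period (\<lambda>z. (z + of_real a) ^ (k - 2) * g (of_real a - 1 / (z + of_real a)))"
    proof (rule period_cong[OF moderate_growth_translate[OF moderate_growth_slash[OF g]]])
      fix z assume "z \<in> upper_half_plane"
      from ga[OF uhp_minus_inverse[OF uhp_add_real[OF this, of a]]]
      show "slash g (z + of_real a) = (z + of_real a) ^ (k - 2) * g (of_real a - 1 / (z + of_real a))"
        by (simp add: slash_def add.commute)
    qed
    with period_three_term[OF g a] show ?thesis unfolding t1 by simp
  qed
  have "period g = period (\<lambda>z. g (z + of_real a) - slash g (z + of_real a))"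
    by (subst period_diff) (simp_all add: t1 t2 moderate_growth_translate moderate_growth_slash g)
  also have "\<dots> = period (\<lambda>z. of_real (zeta_nat k) * (1 / (z + of_real a) + (z + of_real a) ^ (k - 1))
      - 2 * eis_period K (z + of_real a))"
  proof (rule period_cong)
    show "moderate_growth (\<lambda>z. g (z + of_real a) - slash g (z + of_real a))"
      by (intro moderate_growth_diff moderate_growth_translate moderate_growth_slash g)
    fix z assume "z \<in> upper_half_plane"
    from eis_integral_minus_inverse[OF K(1,2) uhp_add_real[OF this, of a]]
    show "g (z + of_real a) - slash g (z + of_real a)
       = of_real (zeta_nat k) * (1 / (z + of_real a) + (z + of_real a) ^ (k - 1)) - 2 * eis_period K (z + of_real a)"
      unfolding g_def slash_def K_def[symmetric] K(3,4) .
  qed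
  also have "\<dots> = period (\<lambda>z. of_real (zeta_nat k) * (1 / (z + of_real a) + (z + of_real a) ^ (k - 1)))
      - period (\<lambda>z. 2 * eis_period K (z + of_real a))"
    by (intro period_diff moderate_growth_mult moderate_growth_const moderate_growth_add moderate_growth_power
        moderate_growth_translate[OF moderate_growth_inverse] moderate_growth_id
        moderate_growth_translate[OF moderate_growth_eis_period])
  also have "period (\<lambda>z. of_real (zeta_nat k) * (1 / (z + of_real a) + (z + of_real a) ^ (k - 1)))
      = of_real (zeta_nat k) * (period (\<lambda>z. 1 / (z + of_real a)) + period (\<lambda>z. (z + of_real a) ^ (k - 1)))"
    by (subst period_cmult, (intro moderate_growth_add moderate_growth_power moderate_growth_id moderate_growth_const
          moderate_growth_translate[OF moderate_growth_inverse])[1], subst period_add)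
       (auto intro!: moderate_growth_power moderate_growth_add moderate_growth_id moderate_growth_const
          moderate_growth_translate[OF moderate_growth_inverse])
  also have "period (\<lambda>z. 2 * eis_period K (z + of_real a)) = 2 * period (\<lambda>z. eis_period K (z + of_real a))"
    by (rule period_cmult[OF moderate_growth_translate[OF moderate_growth_eis_period]])
  finally show ?thesis by (simp add: g_def K_def)
qed

text \<open>In the three-term relation for \<open>1 / z\<close> the last function is minus the slash
  of \<open>(z - a) ^ (k - 1)\<close>, so one of the three periods becomes polynomial.\<close>

lemma period_inverse_relation:
  assumes a: "a = 1 \<or> a = - 1"
  shows "period (\<lambda>z. 1 / z) = period (\<lambda>z. 1 / (z + of_real a)) + period (\<lambda>z. (z - of_real a) ^ (k - 1))"
proof -
  define K where "K = k - 2"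
  have k_eq: "k - 1 = Suc K" "k - 2 = K" using k_ge_2 by (auto simp: K_def)
  have aK: "of_real a ^ K = (1 :: complex)" "of_real a * of_real a = (1 :: complex)"
    using a even_k by (auto simp: K_def)
  define h where "h = (\<lambda>z. (z - of_real a) ^ Suc K :: complex)"
  have h: "moderate_growth h" unfolding h_def by (intro moderate_growth_intros)
  have "period (\<lambda>z. - slash h z)
      = period (\<lambda>z. (z + of_real a) ^ (k - 2) * (1 / (of_real a - 1 / (z + of_real a))))"
  proof (rule period_cong[OF moderate_growth_uminus[OF moderate_growth_slash[OF h]]])
    fix z assume z: "z \<in> upper_half_plane"
    have z0: "z \<noteq> 0" "z + of_real a \<noteq> 0"
      using uhp_nonzero[OF z] uhp_nonzero[OF uhp_add_real[OF z]] by auto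
    have "of_real a - 1 / (z + of_real a) = of_real a * z / (z + of_real a)"
      using z0 aK(2) by (simp add: field_simps)
    then have "(z + of_real a) ^ K * (1 / (of_real a - 1 / (z + of_real a)))
       = (z + of_real a) ^ Suc K / (of_real a * z)"
      by (simp add: mult_ac)
    also have "\<dots> = of_real a * (z + of_real a) ^ Suc K / z"
    proof -
      have "1 / (of_real a :: complex) = of_real a" using a by auto
      then show ?thesis by (metis (no_types, lifting) divide_divide_eq_left mult.commute mult_1 times_divide_eq_left)
    qed
    also have "\<dots> = - (z ^ K * (- 1 / z - of_real a) ^ Suc K)"
    proof -
      have "- 1 / z - of_real a = - (of_real a * (z + of_real a) / z)"
        using z0 aK(2) by (simp add: field_simps)
      then have "(- 1 / z - of_real a) ^ Suc K = - ((of_real a * (z + of_real a) / z) ^ Suc K)"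
        using even_k by (simp only:) (simp add: K_def)
      also have "\<dots> = - (of_real a * (z + of_real a) ^ Suc K / z ^ Suc K)"
        by (simp add: power_divide power_mult_distrib aK(1))
      finally show ?thesis using z0 by simp
    qed
    finally show "- slash h z = (z + of_real a) ^ (k - 2) * (1 / (of_real a - 1 / (z + of_real a)))"
      by (simp only: slash_def h_def k_eq)
  qed
  moreover have "period (\<lambda>z. - slash h z) = period h"
    by (subst period_uminus[OF moderate_growth_slash[OF h]]) (simp add: period_slash[OF h])
  ultimately have "period (\<lambda>z. (z + of_real a) ^ (k - 2) * (1 / (of_real a - 1 / (z + of_real a)))) = period h"
    by (simp only:)
  with period_three_term[OF moderate_growth_inverse a] show ?thesis
    unfolding k_eq(1) h_def[symmetric] by (simp only:)
qed

text \<open>The periods of \<open>1 / (z + 1)\<close> and \<open>1 / (z - 1)\<close> enter only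
  through their difference, which both cases of \<open>period_inverse_relation\<close> together
  express by polynomial periods.\<close>

lemma period_eis_period:
  assumes "k \<ge> 4"
  shows "period (\<lambda>z. eis_period (k - 2) (z + 1)) - period (\<lambda>z. eis_period (k - 2) (z - 1))
    = of_real (zeta_nat k) * (period (\<lambda>z. (z + 1) ^ (k - 1)) - period (\<lambda>z. (z - 1) ^ (k - 1)))"
proof -
  have "W1 - W2 = Z * (P1 - P2)"
    if "Z * (R1 + P1) - 2 * W1 = J" "Z * (R2 + P2) - 2 * W2 = J" "I = R1 + P2" "I = R2 + P1"
    for W1 W2 Z P1 P2 R1 R2 I J :: complex
  proof -
    have "w = y - j" if "y - w = j" for w y j :: complex using that by auto
    from this[OF that(1)] this[OF that(2)]
    have W: "2 * W1 = Z * (R1 + P1) - J" "2 * W2 = Z * (R2 + P2) - J" .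
    have R: "R1 = R2 + P1 - P2" using that(3,4) by (simp add: eq_diff_eq)
    have "2 * (W1 - W2) = 2 * W1 - 2 * W2" by simp
    also have "\<dots> = 2 * (Z * (P1 - P2))" unfolding W R by (simp add: algebra_simps)
    finally have "2 * (W1 - W2) = 2 * (Z * (P1 - P2))" .
    then show ?thesis by (simp only: mult_left_cancel[OF zero_neq_numeral[symmetric]])
  qed
  from this[OF period_eis_relation[OF assms, of 1, simplified] period_eis_relation[OF assms, of "- 1", simplified]
      period_inverse_relation[of 1, simplified] period_inverse_relation[of "- 1", simplified]]
  show ?thesis by simp
qed

section \<open>Even periods and their relations\<close>

definition even_period :: "nat \<Rightarrow> complex" where
  "even_period i = (if even i then - \<i> * period (\<lambda>z. z ^ i) else 0)"

text \<open>Writing the parity condition as the projection \<open>1 + (- 1) ^ i\<close> lets the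
  relations for \<open>a = 1\<close> and \<open>a = - 1\<close> be averaged termwise.\<close>

lemma even_period_alt: "even_period i = - (\<i> / 2) * ((1 + (- 1) ^ i) * period (\<lambda>z. z ^ i))"
  by (simp add: even_period_def)

lemma sum_even_period:
  "(\<Sum>i\<in>A. b i * even_period (g i)) = - (\<i> / 2) * ((\<Sum>i\<in>A. b i * period (\<lambda>z. z ^ g i))
    + (\<Sum>i\<in>A. b i * ((- 1) ^ g i * period (\<lambda>z. z ^ g i))))"
  unfolding even_period_alt sum_distrib_left sum.distrib[symmetric]
  by (intro sum.cong refl) (simp add: algebra_simps)

lemma period_polynomial:
  "period (\<lambda>z. \<Sum>i\<in>A. b i * z ^ g i) = (\<Sum>i\<in>A. b i * period (\<lambda>z. z ^ g i))"
  by (subst period_sum) (auto intro!: moderate_growth_intros period_cmult sum.cong)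

text \<open>The factor \<open>- \<i>\<close> in \<open>even_period\<close> offsets the odd power of
  \<open>\<i>\<close> in \<open>period_monomial\<close> and leaves the sign of the period
  polynomial.\<close>

lemma even_period_eq:
  assumes "i \<le> k" "even i"
  shows "even_period i = (- 1) ^ (i div 2) * completed_L f (of_nat (Suc i))"
proof -
  have "\<i> ^ i = (- 1) ^ (i div 2)"
    using assms(2) by (metis dvd_mult_div_cancel power2_i power_mult)
  moreover have "\<i> * (\<i> * x) = - x" for x by (simp add: mult.assoc[symmetric])
  ultimately have "- \<i> * (\<i> ^ Suc i * x) = (- 1) ^ (i div 2) * x" for x
    by (simp add: mult.assoc)
  then show ?thesis unfolding even_period_def period_monomial[OF assms(1)] using assms(2) by simp
qed

lemma period_monomial_antisym:
  assumes "i \<le> k - 2"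
  shows "(- 1) ^ i * period (\<lambda>z. z ^ (k - 2 - i)) = - period (\<lambda>z. z ^ i)"
proof -
  have m: "moderate_growth (\<lambda>z. z ^ i)" by (intro moderate_growth_intros)
  have "period (slash (\<lambda>z. z ^ i)) = period (\<lambda>z. (- 1) ^ i * z ^ (k - 2 - i))"
  proof (rule period_cong[OF moderate_growth_slash[OF m]])
    fix z assume "z \<in> upper_half_plane"
    then show "slash (\<lambda>z. z ^ i) z = (- 1) ^ i * z ^ (k - 2 - i)"
      unfolding slash_def power_divide power_diff[OF uhp_nonzero[OF \<open>z \<in> upper_half_plane\<close>] assms] by simp
  qed
  also have "\<dots> = (- 1) ^ i * period (\<lambda>z. z ^ (k - 2 - i))"
    by (intro period_cmult moderate_growth_intros)
  finally show ?thesis using period_slash[OF m] by simp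
qed

lemma even_period_antisym:
  assumes "i \<le> k - 2"
  shows "even_period (k - 2 - i) = - even_period i"
proof -
  have "even (k - 2 - i) \<longleftrightarrow> even i" using assms even_k k_ge_2 by (auto simp: even_diff_nat)
  then show ?thesis
    using period_monomial_antisym[OF assms] by (auto simp: even_period_def simp del: diff_diff_left)
qed

lemma period_binomial:
  fixes e :: complex
  shows "period (\<lambda>z. (z + e) ^ j) = (\<Sum>i\<le>j. of_nat (j choose i) * e ^ (j - i) * period (\<lambda>z. z ^ i))"
proof -
  have "(\<lambda>z. (z + e) ^ j) = (\<lambda>z. \<Sum>i\<le>j. (of_nat (j choose i) * e ^ (j - i)) * z ^ i)"
    by (auto simp: binomial_ring mult_ac)
  then show ?thesis by (simp only: period_polynomial)
qed

lemma period_binomial_monomial: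
  fixes e :: complex
  shows "period (\<lambda>z. (z + e) ^ j * z ^ l)
    = (\<Sum>i\<le>j. of_nat (j choose i) * e ^ (j - i) * period (\<lambda>z. z ^ (i + l)))"
proof -
  have "(\<lambda>z. (z + e) ^ j * z ^ l) = (\<lambda>z. \<Sum>i\<le>j. (of_nat (j choose i) * e ^ (j - i)) * z ^ (i + l))"
    unfolding binomial_ring sum_distrib_right by (intro ext sum.cong refl) (simp add: power_add mult_ac)
  then show ?thesis by (simp only: period_polynomial)
qed

text \<open>The Moebius image in \<open>period_three_term\<close> equals
  \<open>a z / (z + a)\<close>, since \<open>a^2 = 1\<close>; the weight factor clears its
  denominator, so all terms are polynomial.\<close>

lemma period_monomial_three_term:
  assumes j: "j \<le> k - 2" and a: "a = 1 \<or> a = - 1"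
  shows "period (\<lambda>z. z ^ j) = (\<Sum>i\<le>j. of_nat (j choose i) * of_real a ^ (j - i) * period (\<lambda>z. z ^ i))
    + of_real a ^ j * (\<Sum>i\<le>k - 2 - j. of_nat ((k - 2 - j) choose i) * of_real a ^ (k - 2 - j - i)
        * period (\<lambda>z. z ^ (i + j)))"
proof -
  have m: "moderate_growth (\<lambda>z. z ^ j)" by (intro moderate_growth_intros)
  have "period (\<lambda>z. of_real a ^ j * ((z + of_real a) ^ (k - 2 - j) * z ^ j))
     = period (\<lambda>z. (z + of_real a) ^ (k - 2) * (of_real a - 1 / (z + of_real a)) ^ j)"
  proof (rule period_cong)
    show "moderate_growth (\<lambda>z. of_real a ^ j * ((z + of_real a) ^ (k - 2 - j) * z ^ j))"
      by (intro moderate_growth_intros)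
    fix z assume z: "z \<in> upper_half_plane"
    have za: "z + of_real a \<noteq> 0" by (rule uhp_nonzero[OF uhp_add_real[OF z]])
    have "of_real a - 1 / (z + of_real a) = of_real a * z / (z + of_real a)"
      using za a by (auto simp: field_simps)
    then show "of_real a ^ j * ((z + of_real a) ^ (k - 2 - j) * z ^ j)
       = (z + of_real a) ^ (k - 2) * (of_real a - 1 / (z + of_real a)) ^ j"
      unfolding power_diff[OF za j] by (simp add: power_divide power_mult_distrib)
  qed
  moreover have "period (\<lambda>z. of_real a ^ j * ((z + of_real a) ^ (k - 2 - j) * z ^ j))
     = of_real a ^ j * period (\<lambda>z. (z + of_real a) ^ (k - 2 - j) * z ^ j)"
    by (intro period_cmult moderate_growth_intros)
  ultimately show ?thesis
    using period_three_term[OF m a] unfolding period_binomial period_binomial_monomial by simp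
qed

text \<open>Adding the case \<open>a = 1\<close> and \<open>(- 1) ^ j\<close> times the case
  \<open>a = - 1\<close> projects onto even indices; antisymmetry then gives the second sum its
  sign.\<close>

lemma even_period_three_term:
  assumes j: "j \<le> k - 2"
  shows "even_period j = (\<Sum>i\<le>j. of_nat (j choose i) * even_period i)
    - (\<Sum>i\<le>k - 2 - j. of_nat ((k - 2 - j) choose i) * even_period i)"
proof -
  define K where "K = k - 2"
  define \<pi> where "\<pi> = (\<lambda>i. period (\<lambda>z. z ^ i))"
  have jK: "j \<le> K" and evK: "even K" using j even_k by (auto simp: K_def)
  have ch: "(K - j) choose (K - (a + j)) = (K - j) choose a" if "a \<le> K - j" for a
    using binomial_symmetric[OF that] by (simp add: add.commute)
  have s1: "(- 1) ^ j * (- 1) ^ (j - i) = (- 1 :: complex) ^ i" if "i \<le> j" for i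
    using that by (auto simp: minus_one_power_iff)
  have s2: "(- 1) ^ (K - j - i) = (- 1 :: complex) ^ (i + j)" if "i \<le> K - j" for i
    using that jK evK by (auto simp: minus_one_power_iff)
  have p: "\<pi> j = (\<Sum>i\<le>j. of_nat (j choose i) * \<pi> i) + (\<Sum>i\<le>K - j. of_nat ((K - j) choose i) * \<pi> (i + j))"
    using period_monomial_three_term[OF j, of 1] by (simp add: K_def \<pi>_def)
  have "\<pi> j = (\<Sum>i\<le>j. of_nat (j choose i) * (- 1) ^ (j - i) * \<pi> i)
     + (- 1) ^ j * (\<Sum>i\<le>K - j. of_nat ((K - j) choose i) * (- 1) ^ (K - j - i) * \<pi> (i + j))"
    using period_monomial_three_term[OF j, of "- 1"] by (simp add: K_def \<pi>_def)
  then have "(- 1) ^ j * \<pi> j = (- 1) ^ j * (\<Sum>i\<le>j. of_nat (j choose i) * (- 1) ^ (j - i) * \<pi> i)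
     + (- 1) ^ j * (- 1) ^ j * (\<Sum>i\<le>K - j. of_nat ((K - j) choose i) * (- 1) ^ (K - j - i) * \<pi> (i + j))"
    by (metis (no_types, lifting) distrib_left mult.assoc)
  also have "(- 1) ^ j * (\<Sum>i\<le>j. of_nat (j choose i) * (- 1) ^ (j - i) * \<pi> i)
      = (\<Sum>i\<le>j. of_nat (j choose i) * ((- 1) ^ i * \<pi> i))"
    unfolding sum_distrib_left
  proof (intro sum.cong refl)
    fix i assume "i \<in> {..j}"
    have "(- 1) ^ j * (of_nat (j choose i) * (- 1) ^ (j - i) * \<pi> i)
       = of_nat (j choose i) * ((- 1) ^ j * (- 1) ^ (j - i) * \<pi> i)"
      by (simp only: mult_ac)
    with s1[of i] \<open>i \<in> {..j}\<close> show "(- 1) ^ j * (of_nat (j choose i) * (- 1) ^ (j - i) * \<pi> i)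
       = of_nat (j choose i) * ((- 1) ^ i * \<pi> i)"
      by simp
  qed
  also have "(- 1) ^ j * (- 1) ^ j * (\<Sum>i\<le>K - j. of_nat ((K - j) choose i) * (- 1) ^ (K - j - i) * \<pi> (i + j))
      = (\<Sum>i\<le>K - j. of_nat ((K - j) choose i) * ((- 1) ^ (i + j) * \<pi> (i + j)))"
  proof -
    have "(- 1) ^ j * (- 1) ^ j = (1 :: complex)" by (simp add: power_mult_distrib[symmetric])
    then show ?thesis
      by (simp only: mult_1_left) (intro sum.cong refl, simp only: s2 atMost_iff mult.assoc)
  qed
  finally have m: "(- 1) ^ j * \<pi> j = (\<Sum>i\<le>j. of_nat (j choose i) * ((- 1) ^ i * \<pi> i))
      + (\<Sum>i\<le>K - j. of_nat ((K - j) choose i) * ((- 1) ^ (i + j) * \<pi> (i + j)))" .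
  have "even_period j = - (\<i> / 2) * (\<pi> j + (- 1) ^ j * \<pi> j)"
    by (simp only: even_period_alt \<pi>_def distrib_right mult_1_left)
  also have "\<dots> = - (\<i> / 2) * ((\<Sum>i\<le>j. of_nat (j choose i) * \<pi> i)
        + (\<Sum>i\<le>K - j. of_nat ((K - j) choose i) * \<pi> (i + j))
      + ((\<Sum>i\<le>j. of_nat (j choose i) * ((- 1) ^ i * \<pi> i))
        + (\<Sum>i\<le>K - j. of_nat ((K - j) choose i) * ((- 1) ^ (i + j) * \<pi> (i + j)))))"
    by (rule arg_cong2[where f = "\<lambda>x y. - (\<i> / 2) * (x + y)", OF p m])
  also have "\<dots> = (\<Sum>i\<le>j. of_nat (j choose i) * even_period i)
     + (\<Sum>i\<le>K - j. of_nat ((K - j) choose i) * even_period (i + j))"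
    unfolding sum_even_period \<pi>_def by (simp add: algebra_simps)
  also have "(\<Sum>i\<le>K - j. of_nat ((K - j) choose i) * even_period (i + j))
     = (\<Sum>i\<le>K - j. of_nat ((K - j) choose i) * even_period (K - i))"
    by (rule sum.reindex_bij_witness[of _ "\<lambda>i. K - j - i" "\<lambda>i. K - j - i"])
       (use jK ch in \<open>auto simp: add.commute\<close>)
  also have "\<dots> = - (\<Sum>i\<le>K - j. of_nat ((K - j) choose i) * even_period i)"
    unfolding sum_negf[symmetric]
    using even_period_antisym by (intro sum.cong refl) (simp add: K_def)
  finally show ?thesis by (simp add: K_def)
qed

lemma even_period_binomial:
  assumes "odd j"
  shows "(\<Sum>i\<le>j. of_nat (j choose i) * even_period i)
    = - (\<i> / 2) * (period (\<lambda>z. (z + 1) ^ j) - period (\<lambda>z. (z - 1) ^ j))"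
proof -
  have "(- 1) ^ (j - i) = - ((- 1 :: complex) ^ i)" if "i \<le> j" for i
    using that assms by (auto simp: minus_one_power_iff)
  then have "period (\<lambda>z. (z - 1) ^ j) = - (\<Sum>i\<le>j. of_nat (j choose i) * ((- 1) ^ i * period (\<lambda>z. z ^ i)))"
    unfolding period_binomial[of "- 1" j, unfolded add_uminus_conv_diff] sum_negf[symmetric]
    by (intro sum.cong refl) simp
  moreover have "period (\<lambda>z. (z + 1) ^ j) = (\<Sum>i\<le>j. of_nat (j choose i) * period (\<lambda>z. z ^ i))"
    using period_binomial[of 1 j] by simp
  ultimately show ?thesis
    unfolding sum_even_period by simp
qed

text \<open>The relation of Kohnen and Zagier between the even periods of a cusp form.\<close>
lemma even_period_extra_relation:
  assumes k: "k \<ge> 4"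
  shows "(\<Sum>j | j \<le> k - 2 \<and> odd j. (\<Sum>i\<le>j. of_nat (j choose i) * even_period i)
      * of_real (zeta_nat (Suc j) * zeta_nat (Suc (k - 2 - j))))
    = of_real (zeta_nat k) * (\<Sum>i\<le>k - 2. of_nat ((k - 1) choose i) * even_period i)"
proof -
  define K where "K = k - 2"
  have K: "k - 1 = Suc K" "odd (Suc K)" using k even_k by (auto simp: K_def)
  have shift: "period (\<lambda>z. eis_period K (z + e)) = (\<Sum>j | j \<le> K \<and> odd j.
      of_real (zeta_nat (Suc j) * zeta_nat (Suc (K - j))) * period (\<lambda>z. (z + e) ^ j))" for e
    unfolding eis_period_def
    by (subst period_sum) (auto intro!: moderate_growth_intros period_cmult sum.cong simp del: of_real_mult)
  have "(\<Sum>j | j \<le> K \<and> odd j. (\<Sum>i\<le>j. of_nat (j choose i) * even_period i)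
      * of_real (zeta_nat (Suc j) * zeta_nat (Suc (K - j))))
    = - (\<i> / 2) * (period (\<lambda>z. eis_period K (z + 1)) - period (\<lambda>z. eis_period K (z - 1)))"
  proof -
    let ?z = "\<lambda>j. of_real (zeta_nat (Suc j) * zeta_nat (Suc (K - j))) :: complex"
    have "(\<Sum>j | j \<le> K \<and> odd j. (\<Sum>i\<le>j. of_nat (j choose i) * even_period i) * ?z j)
       = (\<Sum>j | j \<le> K \<and> odd j. - (\<i> / 2) * (?z j * period (\<lambda>z. (z + 1) ^ j) - ?z j * period (\<lambda>z. (z - 1) ^ j)))"
      by (intro sum.cong refl) (simp add: even_period_binomial algebra_simps del: of_real_mult)
    then show ?thesis
      unfolding shift[of 1] shift[of "- 1", unfolded add_uminus_conv_diff]
        sum_distrib_left[symmetric] sum_subtractf .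
  qed
  also have "\<dots> = of_real (zeta_nat k) * (- (\<i> / 2) * (period (\<lambda>z. (z + 1) ^ Suc K) - period (\<lambda>z. (z - 1) ^ Suc K)))"
    using period_eis_period[OF k] unfolding K_def[symmetric] K(1) by simp
  also have "\<dots> = of_real (zeta_nat k) * (\<Sum>i\<le>Suc K. of_nat (Suc K choose i) * even_period i)"
    unfolding even_period_binomial[OF K(2)] ..
  also have "(\<Sum>i\<le>Suc K. of_nat (Suc K choose i) * even_period i)
     = (\<Sum>i\<le>K. of_nat (Suc K choose i) * even_period i)"
    using K(2) by (simp add: even_period_def)
  finally show ?thesis unfolding K_def[symmetric] K(1) .
qed

section \<open>Restricted periods\<close>

definition restricted_period :: "nat \<Rightarrow> complex" where
  "restricted_period i = (if 0 < i \<and> i < k - 2 then even_period i else 0)"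

text \<open>The subtracted sequence belongs to the coboundary \<open>1 - z ^ (k - 2)\<close> and
  satisfies the period relations itself, so restriction preserves them.\<close>

lemma restricted_period_eq:
  assumes "k \<ge> 4" "i \<le> k - 2"
  shows "restricted_period i = even_period i - completed_L f 1 * ((if i = 0 then 1 else 0) - (if i = k - 2 then 1 else 0))"
proof -
  have "even_period 0 = completed_L f 1" using even_period_eq[of 0] by simp
  moreover have "even_period (k - 2) = - even_period 0" using even_period_antisym[of 0] by simp
  ultimately show ?thesis using assms by (auto simp: restricted_period_def)
qed

text \<open>The upper index \<open>n\<close> is kept apart from \<open>j\<close> to cover both the
  coefficients \<open>c j\<close>, with \<open>n = j\<close>, and the extra relation, with
  \<open>n = k - 1\<close>.\<close>

lemma restricted_period_binomial:
  assumes "k \<ge> 4" "j \<le> k - 2"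
  shows "(\<Sum>i\<le>j. of_nat (n choose i) * restricted_period i) = (\<Sum>i\<le>j. of_nat (n choose i) * even_period i)
    - completed_L f 1 * (1 - (if j = k - 2 then of_nat (n choose j) else 0))"
proof -
  have "(\<Sum>i\<le>j. of_nat (n choose i) * restricted_period i) = (\<Sum>i\<le>j. of_nat (n choose i) * even_period i
     - completed_L f 1 * ((if i = 0 then of_nat (n choose i) else 0) - (if i = k - 2 then of_nat (n choose i) else 0)))"
    using assms by (intro sum.cong refl) (simp add: restricted_period_eq algebra_simps)
  also have "\<dots> = (\<Sum>i\<le>j. of_nat (n choose i) * even_period i)
     - completed_L f 1 * (1 - (if j = k - 2 then of_nat (n choose j) else 0))"
  proof -
    have "(\<Sum>i\<le>j. if i = 0 then of_nat (n choose i) else 0) = (1 :: complex)"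
      by (subst sum.delta) auto
    moreover have "(\<Sum>i\<le>j. if i = k - 2 then of_nat (n choose i) else 0)
        = (if j = k - 2 then of_nat (n choose j) else 0 :: complex)"
      using assms by (subst sum.delta) auto
    ultimately show ?thesis by (simp only: sum_subtractf sum_distrib_left[symmetric])
  qed
  finally show ?thesis .
qed

lemma period_sequence_restricted:
  assumes "k \<ge> 4"
  shows "period_sequence (k - 2) restricted_period"
proof
  fix j assume j: "j \<le> k - 2"
  then show "restricted_period j = (\<Sum>i\<le>j. of_nat (j choose i) * restricted_period i)
     - (\<Sum>i\<le>k - 2 - j. of_nat ((k - 2 - j) choose i) * restricted_period i)"
    unfolding restricted_period_binomial[OF assms j] restricted_period_binomial[OF assms diff_le_self]
    using assms even_period_three_term[OF j] by (auto simp: restricted_period_eq algebra_simps)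
next
  fix i assume "i \<le> k - 2"
  then show "restricted_period (k - 2 - i) = - restricted_period i"
    using even_period_antisym[of i] by (auto simp: restricted_period_def)
qed (use even_k in \<open>auto simp: restricted_period_def even_period_def\<close>)

end

text \<open>For restricted periods the right-hand side is the period polynomial at
  \<open>(x + 1, x)\<close>; this is what identifies \<open>c j\<close> with
  \<open>q (Suc j) (Suc (K - j))\<close>.\<close>

lemma (in period_sequence) c_generating:
  "(\<Sum>j\<le>K. of_nat (K choose j) * c j * x ^ j) = (\<Sum>i\<le>K. of_nat (K choose i) * l i * (x + 1) ^ (K - i) * x ^ i)"
proof -
  have "(\<Sum>j\<le>K. of_nat (K choose j) * c j * x ^ j)
     = (\<Sum>j\<le>K. \<Sum>i\<le>K. of_nat ((K choose j) * (j choose i)) * (l i * x ^ j))"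
    by (intro sum.cong refl) (simp add: c_extend[of _ K] sum_distrib_left sum_distrib_right mult_ac)
  also have "\<dots> = (\<Sum>i\<le>K. \<Sum>j\<le>K. of_nat ((K choose j) * (j choose i)) * (l i * x ^ j))"
    by (rule sum.swap)
  also have "\<dots> = (\<Sum>i\<le>K. of_nat (K choose i) * l i * (x + 1) ^ (K - i) * x ^ i)"
  proof (intro sum.cong refl)
    fix i assume "i \<in> {..K}"
    then have i: "i \<le> K" by simp
    have "(\<Sum>j\<le>K. of_nat ((K choose j) * (j choose i)) * (l i * x ^ j))
       = (\<Sum>j=i..K. of_nat ((K choose i) * ((K - i) choose (j - i))) * (l i * x ^ j))"
      by (rule sum.mono_neutral_cong_right) (auto simp: choose_mult simp del: of_nat_mult)
    also have "\<dots> = (\<Sum>t\<le>K - i. of_nat ((K choose i) * ((K - i) choose t)) * (l i * x ^ (t + i)))"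
      by (rule sum.reindex_bij_witness[of _ "\<lambda>t. t + i" "\<lambda>j. j - i"]) (use i in auto)
    also have "\<dots> = of_nat (K choose i) * l i * (x + 1) ^ (K - i) * x ^ i"
      by (simp add: binomial_ring sum_distrib_left sum_distrib_right power_add mult_ac)
    finally show "(\<Sum>j\<le>K. of_nat ((K choose j) * (j choose i)) * (l i * x ^ j))
       = of_nat (K choose i) * l i * (x + 1) ^ (K - i) * x ^ i" .
  qed
  finally show ?thesis .
qed

lemma sum_weight_pairs:
  "(\<Sum>(r, s) | r + s = K + 2 \<and> r \<ge> 1 \<and> s \<ge> 1. F r s) = (\<Sum>j\<le>K. F (Suc j) (Suc (K - j)))"
  by (rule sum.reindex_bij_witness[of _ "\<lambda>j. (Suc j, Suc (K - j))" "\<lambda>(r, s). r - 1"])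
     (auto intro!: arg_cong2[where f = F])

lemma sum_weight_pairs_ge_2:
  "(\<Sum>(r, s) | r + s = K + 2 \<and> r \<ge> 2 \<and> s \<ge> 2. F r s) = (\<Sum>j\<in>{0<..<K}. F (Suc j) (Suc (K - j)))"
  by (rule sum.reindex_bij_witness[of _ "\<lambda>j. (Suc j, Suc (K - j))" "\<lambda>(r, s). r - 1"])
     (auto intro!: arg_cong2[where f = F])

lemma sum_odd_pairs:
  assumes "even K"
  shows "(\<Sum>(r, s)\<in>odd_pairs (K + 2). F r s) = (\<Sum>i | 0 < i \<and> i < K \<and> even i. F (Suc (K - i)) (Suc i))"
  unfolding odd_pairs_def
  by (rule sum.reindex_bij_witness[of _ "\<lambda>i. (Suc (K - i), Suc i)" "\<lambda>(r, s). s - 1"])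
     (use assms in \<open>auto elim!: oddE evenE intro!: arg_cong2[where f = F]\<close>)

section \<open>Translation into the terms of the theorem\<close>

context cusp_form
begin

lemma sum_restricted_period:
  "(\<Sum>i | 0 < i \<and> i < k - 2 \<and> even i. (- 1) ^ (i div 2) * completed_L f (of_nat (Suc i)) * F i)
    = (\<Sum>i\<le>k - 2. restricted_period i * F i)"
proof (rule sum.mono_neutral_cong_left)
  have "even_period i = 0" if "odd i" for i using that by (simp add: even_period_def)
  then show "\<forall>i\<in>{..k - 2} - {i. 0 < i \<and> i < k - 2 \<and> even i}. restricted_period i * F i = 0"
    by (auto simp: restricted_period_def)
qed (auto simp: restricted_period_def even_period_eq)

lemma even_restricted_period_poly_eq:
  "even_restricted_period_poly k f X Y
    = (\<Sum>i\<le>k - 2. of_nat ((k - 2) choose i) * restricted_period i * X ^ (k - 2 - i) * Y ^ i)"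
proof -
  define K where "K = k - 2"
  have K: "K + 2 = k" "even K" using k_ge_2 even_k by (auto simp: K_def)
  show ?thesis
    using sum_odd_pairs[OF K(2), of "\<lambda>r s. (-1) ^ ((s - 1) div 2) * of_nat ((k - 2) choose (s - 1))
        * completed_L f (of_nat s) * X ^ (r - 1) * Y ^ (s - 1)"]
      sum_restricted_period[of "\<lambda>i. of_nat (K choose i) * X ^ (K - i) * Y ^ i"]
    unfolding even_restricted_period_poly_def K(1) K_def[symmetric]
    by (simp add: mult_ac)
qed

text \<open>With \<open>r = k - 1 - i\<close>, the factor \<open>(k - 1) / r\<close> is absorbed
  into the binomial coefficient, which becomes \<open>k - 1 choose i\<close> as in
  \<open>H_2_1\<close>.\<close>

lemma lambda_coeff_eq:
  "lambda_coeff k f = 1 / 2 * ((\<Sum>i\<le>k - 2. of_nat ((k - 1) choose i) * (1 / 2) ^ (k - 2 - i) * restricted_period i)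
    - of_nat (k - 1) * completed_L f 1)"
proof -
  define K where "K = k - 2"
  have K: "K + 2 = k" "even K" "k - 1 = Suc K" using k_ge_2 even_k by (auto simp: K_def)
  define F where "F = (\<lambda>i. of_nat (K choose i) / (of_nat (Suc (K - i)) * 2 ^ (K - i)) :: complex)"
  have F: "of_nat (Suc K) * F i = of_nat (Suc K choose i) * (1 / 2) ^ (K - i)" if "i \<le> K" for i
  proof -
    have "(Suc K - i) * (Suc K choose i) = Suc K * (K choose i)"
      using binomial_absorb_comp[of "Suc K" i] by simp
    then have "of_nat (Suc (K - i)) * of_nat (Suc K choose i) = (of_nat (Suc K) * of_nat (K choose i) :: complex)"
      using that by (metis Suc_diff_le of_nat_mult)
    then show ?thesis
      by (simp add: F_def power_one_over field_simps del: of_nat_Suc binomial_Suc_Suc)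
  qed
  have "(\<Sum>(r, s)\<in>odd_pairs k. (-1) ^ ((s - 1) div 2) / (of_nat r * 2 ^ (r - 1)) * of_nat ((k - 2) choose (s - 1))
        * completed_L f (of_nat s)) = (\<Sum>i\<le>K. restricted_period i * F i)"
    using sum_odd_pairs[OF K(2), of "\<lambda>r s. (-1) ^ ((s - 1) div 2) / (of_nat r * 2 ^ (r - 1))
        * of_nat ((k - 2) choose (s - 1)) * completed_L f (of_nat s)"]
      sum_restricted_period[of F]
    unfolding K(1) K_def[symmetric] F_def by (simp add: mult_ac)
  then have "lambda_coeff k f = of_nat (Suc K) / 2 * ((\<Sum>i\<le>K. restricted_period i * F i) - completed_L f 1)"
    unfolding lambda_coeff_def K(3) by (simp only:)
  also have "\<dots> = 1 / 2 * ((\<Sum>i\<le>K. restricted_period i * (of_nat (Suc K) * F i)) - of_nat (Suc K) * completed_L f 1)"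
    by (simp add: sum_distrib_left right_diff_distrib mult_ac del: of_nat_Suc)
  also have "(\<Sum>i\<le>K. restricted_period i * (of_nat (Suc K) * F i))
      = (\<Sum>i\<le>K. of_nat (Suc K choose i) * (1 / 2) ^ (K - i) * restricted_period i)"
    by (intro sum.cong refl) (simp only: F atMost_iff, simp only: mult_ac)
  finally show ?thesis unfolding K(3) K_def[symmetric] .
qed

text \<open>For \<open>k = 2\<close> the index 0 is its own mirror image, so antisymmetry forces
  \<open>completed_L f 1 = 0\<close>.\<close>

lemma lambda_coeff_weight_2: "k = 2 \<Longrightarrow> lambda_coeff k f = 0"
proof -
  assume k: "k = 2"
  have "completed_L f 1 = even_period 0" using even_period_eq[of 0] by simp
  moreover have "even_period 0 = - even_period 0" using even_period_antisym[of 0] k by simp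
  ultimately have "completed_L f 1 = 0" by simp
  moreover have "restricted_period 0 = 0" by (simp add: restricted_period_def)
  moreover have "{..k - 2} = {0}" using k by auto
  ultimately show ?thesis unfolding lambda_coeff_eq by simp
qed

lemma double_zeta_hat_relation:
  assumes k: "k \<ge> 4"
    and q: "\<And>X Y :: complex. even_restricted_period_poly k f (X + Y) X =
        (\<Sum>(r, s) | r + s = k \<and> r \<ge> 1 \<and> s \<ge> 1. of_nat ((k - 2) choose (r - 1)) * q r s * X ^ (r - 1) * Y ^ (s - 1))"
  shows "(\<Sum>(r, s) | r + s = k \<and> r \<ge> 2 \<and> s \<ge> 2. q r s * of_real (zeta_hat r s))
    = lambda_coeff k f * of_real (zeta_nat k)"
proof -
  define K where "K = k - 2"
  have K: "K + 2 = k" "even K" "k - 1 = Suc K" "K \<ge> 2" using k even_k by (auto simp: K_def)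
  interpret P: period_sequence K restricted_period
    unfolding K_def by (rule period_sequence_restricted[OF k])
  define L where "L = completed_L f 1"
  define Z :: complex where "Z = of_real (zeta_nat k)"
  define M where "M = (\<Sum>i\<le>K. of_nat (Suc K choose i) * (1 / 2) ^ (K - i) * restricted_period i)"
  \<comment> \<open>Setting the second variable to 1 loses nothing by homogeneity, and
    \<open>K choose j\<close> is nonzero, so coefficients of \<open>x ^ j\<close> can be
    compared.\<close>
  have q_eq: "q (Suc j) (Suc (K - j)) = P.c j" if j: "j \<le> K" for j
  proof -
    have "(\<Sum>j\<le>K. (of_nat (K choose j) * q (Suc j) (Suc (K - j))) * x ^ j)
       = (\<Sum>j\<le>K. (of_nat (K choose j) * P.c j) * x ^ j)" for x
      using q[of x 1] sum_weight_pairs[where K = K and F = "\<lambda>r s. of_nat (K choose (r - 1)) * q r s * x ^ (r - 1) * 1 ^ (s - 1)"]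
      unfolding even_restricted_period_poly_eq P.c_generating K(1) K_def[symmetric] by simp
    then have "\<forall>j\<le>K. of_nat (K choose j) * q (Suc j) (Suc (K - j)) = of_nat (K choose j) * P.c j"
      by (intro polyfun_eq_coeffs[THEN iffD1] allI)
    then have "of_nat (K choose j) * q (Suc j) (Suc (K - j)) = of_nat (K choose j) * P.c j"
      using j by blast
    then show ?thesis using j by simp
  qed
  have "((\<lambda>p. \<Sum>j\<in>{0<..<K}. (\<lambda>(m, n). P.c j * ((1 / of_nat (m + n)) ^ Suc j * (1 / of_nat n) ^ Suc (K - j))) p)
     has_sum (\<Sum>j\<in>{0<..<K}. P.c j * of_real (zeta_hat (Suc j) (Suc (K - j))))) lt_pairs"
  proof (rule has_sum_finite_sum)
    fix j assume "j \<in> {0<..<K}"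
    then have "Suc j \<ge> 2" "Suc (K - j) \<ge> 2" by auto
    from has_sum_cmult_right[OF zeta_hat_has_sum[OF this], of "P.c j"]
    show "((\<lambda>(m, n). P.c j * ((1 / of_nat (m + n)) ^ Suc j * (1 / of_nat n) ^ Suc (K - j)))
       has_sum P.c j * of_real (zeta_hat (Suc j) (Suc (K - j)))) lt_pairs"
      by (simp add: case_prod_unfold del: power_Suc)
  qed
  moreover have "(\<lambda>p. \<Sum>j\<in>{0<..<K}. (\<lambda>(m, n). P.c j * ((1 / of_nat (m + n)) ^ Suc j * (1 / of_nat n) ^ Suc (K - j))) p)
     = (\<lambda>(m, n). P.H (of_nat (m + n)) (of_nat n))"
  proof (intro ext, clarify)
    fix m n :: nat
    \<comment> \<open>The missing indices 0 and \<open>K\<close> have coefficient 0.\<close>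
    show "(\<Sum>j\<in>{0<..<K}. P.c j * ((1 / of_nat (m + n)) ^ Suc j * (1 / of_nat n) ^ Suc (K - j)))
       = P.H (of_nat (m + n)) (of_nat n)"
      unfolding P.H_def by (rule sum.mono_neutral_left) (auto simp: P.c_0 P.c_K not_less le_less)
  qed
  ultimately have S: "(\<Sum>j\<in>{0<..<K}. P.c j * of_real (zeta_hat (Suc j) (Suc (K - j))))
     = infsum (\<lambda>(m, n). P.H (of_nat (m + n)) (of_nat n)) lt_pairs"
    by (simp add: infsumI)
  \<comment> \<open>\<open>L\<close> has two sources: every odd \<open>c j\<close> is lowered by
    \<open>L\<close>, which Euler's formula sums to \<open>- (K + 3) / 2\<close>, and restoring the
    full periods on the right gives \<open>- K\<close>. Together these are
    \<open>- 3 / 2 * (K + 1)\<close>.\<close>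
  have E: "(\<Sum>j | j \<le> K \<and> odd j. P.c j * of_real (zeta_nat (Suc j) * zeta_nat (Suc (K - j))))
     = - Z * ((\<Sum>j\<le>K. P.c j) + 3 / 2 * of_nat (Suc K) * L)"
  proof -
    define \<zeta>\<zeta> :: "nat \<Rightarrow> complex" where "\<zeta>\<zeta> = (\<lambda>j. of_real (zeta_nat (Suc j) * zeta_nat (Suc (K - j))))"
    have c: "P.c j = (\<Sum>i\<le>j. of_nat (j choose i) * even_period i) - L" if "j \<le> K" "odd j" for j
      using restricted_period_binomial[OF k, of j j] that K(2)
      by (auto simp: P.c_def K_def[symmetric] L_def)
    have "(\<Sum>j | j \<le> K \<and> odd j. P.c j * \<zeta>\<zeta> j)
       = (\<Sum>j | j \<le> K \<and> odd j. (\<Sum>i\<le>j. of_nat (j choose i) * even_period i) * \<zeta>\<zeta> j) - L * (\<Sum>j | j \<le> K \<and> odd j. \<zeta>\<zeta> j)"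
      unfolding sum_distrib_left sum_subtractf[symmetric]
      by (intro sum.cong refl) (simp add: c left_diff_distrib)
    also have "(\<Sum>j | j \<le> K \<and> odd j. (\<Sum>i\<le>j. of_nat (j choose i) * even_period i) * \<zeta>\<zeta> j)
       = Z * (\<Sum>i\<le>K. of_nat (Suc K choose i) * even_period i)"
      using even_period_extra_relation[OF k] unfolding K_def[symmetric] K(3) \<zeta>\<zeta>_def Z_def .
    also have "(\<Sum>i\<le>K. of_nat (Suc K choose i) * even_period i)
       = - (\<Sum>j\<le>K. P.c j) + L * (1 - of_nat (Suc K))"
      using restricted_period_binomial[OF k, of K "Suc K"] P.sum_c
      by (simp add: K_def[symmetric] L_def algebra_simps)
    also have "(\<Sum>j | j \<le> K \<and> odd j. \<zeta>\<zeta> j) = of_nat (K + 3) / 2 * Z"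
      using eis_period_one[OF K(4,2), unfolded K(1)] by (simp add: eis_period_def \<zeta>\<zeta>_def Z_def K(1))
    finally show ?thesis
      unfolding \<zeta>\<zeta>_def by (simp add: field_simps)
  qed
  \<comment> \<open>The sum of the \<open>P.c j\<close> enters with coefficient -2/3 from
    \<open>E\<close>, -1/3 from the diagonal and +1 from \<open>H 2 1\<close>, and so
    cancels.\<close>
  have "2 * (\<Sum>j\<in>{0<..<K}. P.c j * of_real (zeta_hat (Suc j) (Suc (K - j)))) = Z * (M - of_nat (Suc K) * L)"
    unfolding S P.double_H_sum E P.H_2_1 M_def[symmetric] K(1) Z_def[symmetric]
    by (simp add: field_simps)
  then have "(\<Sum>j\<in>{0<..<K}. P.c j * of_real (zeta_hat (Suc j) (Suc (K - j)))) = lambda_coeff k f * Z"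
    unfolding lambda_coeff_eq K(3) K_def[symmetric] M_def[symmetric] L_def[symmetric]
    by (simp add: field_simps)
  moreover have "(\<Sum>(r, s) | r + s = k \<and> r \<ge> 2 \<and> s \<ge> 2. q r s * of_real (zeta_hat r s))
     = (\<Sum>j\<in>{0<..<K}. P.c j * of_real (zeta_hat (Suc j) (Suc (K - j))))"
    using sum_weight_pairs_ge_2[where K = K and F = "\<lambda>r s. q r s * of_real (zeta_hat r s)"]
    unfolding K(1) by (simp add: q_eq)
  ultimately show ?thesis by (simp add: Z_def)
qed

end

theorem corollary1p2:
  fixes k :: nat and f :: "complex \<Rightarrow> complex" and q :: "nat \<Rightarrow> nat \<Rightarrow> complex"
  assumes "even k" and "k > 0"
    and "cuspidal_hecke_eigenform k f"
    and "\<And>X Y :: complex.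
      even_restricted_period_poly k f (X + Y) X =
        (\<Sum>(r, s) | r + s = k \<and> r \<ge> 1 \<and> s \<ge> 1.
           of_nat ((k - 2) choose (r - 1)) * q r s * X ^ (r - 1) * Y ^ (s - 1))"
  shows "(\<Sum>(r, s) | r + s = k \<and> r \<ge> 2 \<and> s \<ge> 2. q r s * of_real (zeta_hat r s))
           = lambda_coeff k f * of_real (zeta_nat k)"
proof -
  have k2: "k \<ge> 2" using assms(1,2) by (auto elim!: evenE)
  interpret cusp_form k f
    by unfold_locales (use assms k2 in \<open>auto simp: cuspidal_hecke_eigenform_def\<close>)
  show ?thesis
  proof (cases "k = 2")
    case True
    have "{(r, s). r + s = k \<and> r \<ge> 2 \<and> s \<ge> 2} = {}" using True by auto
    then show ?thesis unfolding lambda_coeff_weight_2[OF True] by (simp only:) simp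
  next
    case False
    then have "k \<ge> 4" using k2 assms(1) by (auto elim!: evenE)
    then show ?thesis by (rule double_zeta_hat_relation) (rule assms(4))
  qed
qed

end
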